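(* Let $\mathcal{D}=\{C_1,\ldots,C_k\}\subset \mathbb{P}^{2}_{\mathbb{C}}$ be a $d$-arrangement with $d\geq 3$ and $k\geq 3$ all of whose singularities are ordinary singularities of multiplicity less than $5$. Then $\mathcal{D}$ (the reduced curve defined by the product of the equations of the $C_i$) is never free.
   Context: A $d$-arrangement is an arrangement $\mathcal{D}=\{C_1,\ldots,C_k\}$ of irreducible plane curves such that every $C_i$ is smooth of degree $d\ge1$ and all intersection points are ordinary singularities (a point of multiplicity $m$ where $m$ smooth branches meet with pairwise distinct tangents). Let $S=\mathbb{C}[x,y,z]$ and for a homogeneous reduced $f\in S$ of degree $D$ let $M(f)=S/(\partial_x f,\partial_y f,\partial_z f)$. The curve $f=0$ is free if $M(f)$ has a minimal graded free resolution $0\to S(1-D-d_1)\oplus S(1-D-d_2)\to S^3(1-D)\to S$ with $d_1+d_2=D-1$. *)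

theory Defs
  imports Complex_Main "HOL-Library.Poly_Mapping" "HOL-Library.Product_Plus"
    "HOL-Computational_Algebra.Factorial_Ring"
begin

text \<open>Polynomials in S = C[x,y,z]: finitely supported maps from exponent triples
  (a,b,c) (monomial x^a y^b z^c) to complex coefficients, with the convolution
  product of Poly_Mapping (a commutative ring).\<close>

type_synonym mono3 = "nat \<times> nat \<times> nat"
type_synonym poly3 = "mono3 \<Rightarrow>\<^sub>0 complex"
type_synonym point3 = "complex \<times> complex \<times> complex"

definition mdeg :: "mono3 \<Rightarrow> nat" where
  "mdeg m = (case m of (a, b, c) \<Rightarrow> a + b + c)"

definition homogeneous :: "nat \<Rightarrow> poly3 \<Rightarrow> bool" where
  "homogeneous n p \<longleftrightarrow> (\<forall>m \<in> Poly_Mapping.keys p. mdeg m = n)"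

definition eval3 :: "poly3 \<Rightarrow> point3 \<Rightarrow> complex" where
  "eval3 p q = (case q of (x, y, z) \<Rightarrow>
     (\<Sum>m \<in> Poly_Mapping.keys p. Poly_Mapping.lookup p m * (case m of (a, b, c) \<Rightarrow> x ^ a * y ^ b * z ^ c)))"

definition dx :: "poly3 \<Rightarrow> poly3" where
  "dx p = (\<Sum>m \<in> Poly_Mapping.keys p. case m of (a, b, c) \<Rightarrow>
      (if a = 0 then 0 else Poly_Mapping.single (a - 1, b, c) (of_nat a * Poly_Mapping.lookup p m)))"

definition dy :: "poly3 \<Rightarrow> poly3" where
  "dy p = (\<Sum>m \<in> Poly_Mapping.keys p. case m of (a, b, c) \<Rightarrow>
      (if b = 0 then 0 else Poly_Mapping.single (a, b - 1, c) (of_nat b * Poly_Mapping.lookup p m)))"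

definition dz :: "poly3 \<Rightarrow> poly3" where
  "dz p = (\<Sum>m \<in> Poly_Mapping.keys p. case m of (a, b, c) \<Rightarrow>
      (if c = 0 then 0 else Poly_Mapping.single (a, b, c - 1) (of_nat c * Poly_Mapping.lookup p m)))"

text \<open>Points of P^2 are represented by nonzero vectors of C^3.\<close>

definition smooth_curve :: "poly3 \<Rightarrow> bool" where
  "smooth_curve f \<longleftrightarrow> (\<forall>q. q \<noteq> (0, 0, 0) \<longrightarrow>
     \<not> (eval3 f q = 0 \<and> eval3 (dx f) q = 0 \<and> eval3 (dy f) q = 0 \<and> eval3 (dz f) q = 0))"

definition tangent_line :: "poly3 \<Rightarrow> point3 \<Rightarrow> point3 set" where
  "tangent_line f q = {(u, v, w). eval3 (dx f) q * u + eval3 (dy f) q * v + eval3 (dz f) q * w = 0}"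

text \<open>A d-arrangement of k curves C_i = V(fs i), i < k: irreducible, smooth, of degree d,
  pairwise distinct, with every intersection point an ordinary singularity
  (pairwise distinct tangent lines of the smooth branches through it).\<close>
definition d_arrangement :: "nat \<Rightarrow> nat \<Rightarrow> (nat \<Rightarrow> poly3) \<Rightarrow> bool" where
  "d_arrangement d k fs \<longleftrightarrow> d \<ge> 1 \<and>
     (\<forall>i < k. fs i \<noteq> 0 \<and> homogeneous d (fs i) \<and> irreducible (fs i) \<and> smooth_curve (fs i)) \<and>
     (\<forall>i < k. \<forall>j < k. i \<noteq> j \<longrightarrow> \<not> (fs i dvd fs j)) \<and>
     (\<forall>q. q \<noteq> (0, 0, 0) \<longrightarrow> (\<forall>i < k. \<forall>j < k. i \<noteq> j \<longrightarrow>
         eval3 (fs i) q = 0 \<longrightarrow> eval3 (fs j) q = 0 \<longrightarrow>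
         tangent_line (fs i) q \<noteq> tangent_line (fs j) q))"

definition arr_mult :: "nat \<Rightarrow> (nat \<Rightarrow> poly3) \<Rightarrow> point3 \<Rightarrow> nat" where
  "arr_mult k fs q = card {i. i < k \<and> eval3 (fs i) q = 0}"

text \<open>Freeness: M(f) = S/J_f has a minimal graded free resolution
  0 \<rightarrow> S(1-D-d1) \<oplus> S(1-D-d2) \<rightarrow> S^3(1-D) \<rightarrow> S with d1 + d2 = D - 1.
  The map S^3(1-D) \<rightarrow> S is given by forms g1,g2,g3 of degree D-1 generating J_f;
  the map from S(1-D-d1) \<oplus> S(1-D-d2) is given by the columns r1, r2 whose entries are
  forms of degrees d1, d2; exactness = injectivity plus image = kernel;
  minimality = all matrix entries lie in the homogeneous maximal ideal.\<close>
definition free_curve :: "poly3 \<Rightarrow> nat \<Rightarrow> bool" where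
  "free_curve f D \<longleftrightarrow>
    (\<exists>g1 g2 g3 r11 r12 r13 r21 r22 r23 :: poly3. \<exists>d1 d2 :: nat.
       d1 + d2 = D - 1 \<and>
       homogeneous (D - 1) g1 \<and> homogeneous (D - 1) g2 \<and> homogeneous (D - 1) g3 \<and>
       homogeneous d1 r11 \<and> homogeneous d1 r12 \<and> homogeneous d1 r13 \<and>
       homogeneous d2 r21 \<and> homogeneous d2 r22 \<and> homogeneous d2 r23 \<and>
       {a * g1 + b * g2 + c * g3 | a b c. True} =
         {a * dx f + b * dy f + c * dz f | a b c. True} \<and>
       {(a, b, c). a * g1 + b * g2 + c * g3 = 0} =
         {(s * r11 + t * r21, s * r12 + t * r22, s * r13 + t * r23) | s t. True} \<and>
       (\<forall>s t. (s * r11 + t * r21, s * r12 + t * r22, s * r13 + t * r23) = (0, 0, 0)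
          \<longrightarrow> s = 0 \<and> t = 0) \<and>
       (\<forall>p \<in> {g1, g2, g3, r11, r12, r13, r21, r22, r23}. Poly_Mapping.lookup p (0, 0, 0) = 0))"

end

theory Submission
  imports Defs "HOL-Computational_Algebra.Polynomial_Factorial" "HOL-Computational_Algebra.Field_as_Ring"
    "HOL-Computational_Algebra.Fundamental_Theorem_Algebra" "HOL-Computational_Algebra.Formal_Power_Series"
begin

text \<open>Let \<open>D = k d\<close> and let \<open>J\<close> be the Jacobian ideal of the product of the \<open>k\<close> equations. A free
  resolution with exponents \<open>d\<^sub>1 + d\<^sub>2 = D - 1\<close> forces \<open>J\<close> to have codimension
  \<open>(D - 1)\<^sup>2 - d\<^sub>1 d\<^sub>2 \<ge> 3/4 (D - 1)\<^sup>2\<close> in large degrees. In the other direction the codimension (the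
  total Tjurina number) is bounded by adding one curve at a time. If a smooth curve \<open>g\<close> is added to
  \<open>f\<close> of degree \<open>e\<close>, then the codimension grows by at most \<open>d e\<close> plus the codimension of the ideal
  generated by \<open>g\<close> and the minors of \<open>(\<nabla>f, \<nabla>g)\<close>. In large degrees that ideal contains \<open>(f, g)\<close>, of
  codimension \<open>d e\<close>, and it contains one further element for each point of \<open>f = g = 0\<close>: along the curve
  \<open>g = 0\<close> the derivative of \<open>f\<close> vanishes to order one less than \<open>f\<close>. Hence the codimension of \<open>J\<close> is at
  most \<open>d\<^sup>2 k (k - 1) - \<Sum>\<^sub>p (m\<^sub>p - 1)\<close>. By Bezout's theorem \<open>\<Sum>\<^sub>p m\<^sub>p (m\<^sub>p - 1) = d\<^sup>2 k (k - 1)\<close>, so for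
  multiplicities \<open>m\<^sub>p \<le> 4\<close> it is at most \<open>3/4 (D\<^sup>2 - d D)\<close>, which is less than \<open>3/4 (D - 1)\<^sup>2\<close>.\<close>

subsection \<open>Dimensions of subspaces\<close>

text \<open>Every local invariant is read off from dimensions of graded pieces in large degree, so
  neither local rings nor intersection multiplicities appear. Points enter in two ways: as
  eigenvalues of the coordinates acting modulo an ideal of bounded codimension, which gives the
  Nullstellensatz and the common zero behind Bezout's bound, and as centres of formal
  parametrisations of a smooth curve, which give linear functionals. The estimates are one-sided:
  Bezout enters as a lower bound for the number of points, freeness as a lower bound for the
  codimension. The ideal of \<open>g\<close> and the minors contains \<open>(f, g)\<close> in large
  degrees because Euler's formula puts \<open>f\<close> times every partial derivative of
  \<open>g\<close> into it, and the partials of a smooth \<open>g\<close> generate all forms of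
  large degree. The constant 3/4 arises twice, independently: from \<open>d1 * d2\<close> being at
  most (D - 1)^2 / 4, and from m - 1 being at least m (m - 1) / 4 for m at most 4. Multiplicity 5
  would turn the second constant into 4/5, and the comparison of leading terms would fail.\<close>

context vector_space
begin

text \<open>\<open>dim\<close> is 0 on spaces with an infinite basis, so it is not monotone in
  general. The polynomial ring is infinite-dimensional; the finite spanning set \<open>W\<close>
  confines the spaces to one graded piece.\<close>

lemma dim_mono_fin:
  assumes "U \<subseteq> V" "V \<subseteq> span W" "finite W"
  shows "dim U \<le> dim V"
proof -
  obtain C where C: "C \<subseteq> V" "independent C" "V \<subseteq> span C" "card C = dim V"
    by (rule basis_exists)
  have "C \<subseteq> span W" using C assms by blast
  then have "finite C" using independent_span_bound[of W C] C assms by blast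
  then show ?thesis using dim_le_card[of U C] C assms by auto
qed

lemma dim_eq_imp_eq:
  assumes "subspace U" "U \<subseteq> V" "V \<subseteq> span W" "finite W" "dim V \<le> dim U"
  shows "U = V"
proof -
  obtain B where B: "B \<subseteq> U" "independent B" "U \<subseteq> span B" "card B = dim U"
    by (rule basis_exists)
  obtain C where C: "B \<subseteq> C" "C \<subseteq> V" "independent C" "V \<subseteq> span C"
    using maximal_independent_subset_extend[of B V] B assms by blast
  have "finite C" using independent_span_bound[of W C] C assms by blast
  moreover have "card C = dim V" using basis_card_eq_dim C by blast
  ultimately have "B = C" using card_seteq[of C B] C B assms by auto
  then have "V \<subseteq> U" using C B span_minimal[of B U] assms by blast
  then show ?thesis using assms by blast
qed

lemma obtain_fin_basis:
  assumes "V \<subseteq> span W" "finite W"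
  obtains B where "B \<subseteq> V" "independent B" "V \<subseteq> span B" "card B = dim V" "finite B"
proof -
  obtain C where C: "C \<subseteq> V" "independent C" "V \<subseteq> span C" "card C = dim V"
    by (rule basis_exists)
  have "C \<subseteq> span W" using C assms by blast
  then have "finite C" using independent_span_bound[of W C] C assms by blast
  then show ?thesis using C that by blast
qed

end

context vector_space_pair
begin

lemma rank_nullity:
  assumes f: "Vector_Spaces.linear s1 s2 f" and V: "vs1.subspace V" and W: "V \<subseteq> vs1.span W" "finite W"
  shows "vs1.dim V = vs2.dim (f ` V) + vs1.dim (V \<inter> {x. f x = 0})"
proof -
  let ?K = "V \<inter> {x. f x = 0}"
  obtain B0 where B0: "B0 \<subseteq> ?K" "vs1.independent B0" "?K \<subseteq> vs1.span B0" "card B0 = vs1.dim ?K"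
    by (rule vs1.basis_exists)
  obtain B where B: "B0 \<subseteq> B" "B \<subseteq> V" "vs1.independent B" "V \<subseteq> vs1.span B"
    using vs1.maximal_independent_subset_extend[of B0 V] B0 by blast
  have fin: "finite B" using vs1.independent_span_bound[of W B] B W by blast
  have cB: "card B = vs1.dim V" using vs1.basis_card_eq_dim B by blast
  let ?C = "B - B0"
  interpret P: vector_space_pair s1 s1 by unfold_locales
  \<comment> \<open>\<open>g\<close> kills \<open>B0\<close> and fixes the other basis vectors. A
    vector in the span of \<open>B0\<close> and in the span of the rest is both killed and fixed,
    hence 0.\<close>
  obtain g where g: "Vector_Spaces.linear s1 s1 g" "\<And>x. x \<in> B \<Longrightarrow> g x = (if x \<in> B0 then 0 else x)"
    using P.linear_independent_extend[OF B(3), of "\<lambda>x. if x \<in> B0 then 0 else x"] by auto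
  have g0: "g x = 0" if "x \<in> vs1.span B0" for x
    using P.linear_eq_0_on_span[OF g(1), of B0 x] that g(2) B by (auto simp: subset_iff)
  have g1: "g x = x" if "x \<in> vs1.span ?C" for x
    using P.linear_eq_on[OF g(1) vs1.module_hom_ident[unfolded module_hom_iff_linear] that] g(2) by auto
  have inj: "inj_on f (vs1.span ?C)"
    unfolding linear_inj_on_iff_eq_0[OF f vs1.subspace_span]
  proof safe
    fix x assume x: "x \<in> vs1.span ?C" "f x = 0"
    have "vs1.span ?C \<subseteq> V" using vs1.span_minimal[of ?C V] B V by blast
    then have "x \<in> vs1.span B0" using x B0 by blast
    then show "x = 0" using g0 g1 x by metis
  qed
  have ind: "vs2.independent (f ` ?C)"
    by (rule linear_independent_injective_image[OF f _ inj]) (meson B(3) vs1.independent_mono Diff_subset)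
  have "f ` V \<subseteq> vs2.span (f ` B)"
    using B(4) linear_span_image[OF f, of B] by blast
  also have "\<dots> \<subseteq> vs2.span (f ` ?C)"
  proof (rule vs2.span_minimal)
    show "f ` B \<subseteq> vs2.span (f ` ?C)"
    proof
      fix y assume "y \<in> f ` B"
      then obtain b where b: "b \<in> B" "y = f b" by auto
      show "y \<in> vs2.span (f ` ?C)"
      proof (cases "b \<in> B0")
        case True then have "y = 0" using b B0 by auto
        then show ?thesis by (simp add: vs2.span_zero)
      next
        case False then show ?thesis using b by (auto intro: vs2.span_base)
      qed
    qed
  qed auto
  finally have sp: "f ` V \<subseteq> vs2.span (f ` ?C)" .
  have "vs2.dim (f ` V) = card (f ` ?C)"
    by (rule vs2.dim_unique[OF _ sp ind]) (use B in auto)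
  also have "\<dots> = card ?C"
    by (rule card_image) (meson inj inj_on_subset vs1.span_superset)
  finally have "vs2.dim (f ` V) = card B - card B0" using fin B by (simp add: card_Diff_subset finite_subset)
  moreover have "card B0 \<le> card B" using B fin by (simp add: card_mono)
  ultimately show ?thesis using cB B0 by linarith
qed

lemma dim_image_inj_on:
  assumes f: "Vector_Spaces.linear s1 s2 f" and V: "vs1.subspace V" and W: "V \<subseteq> vs1.span W" "finite W"
    and "\<And>x. x \<in> V \<Longrightarrow> f x = 0 \<Longrightarrow> x = 0"
  shows "vs2.dim (f ` V) = vs1.dim V"
proof -
  have "V \<inter> {x. f x = 0} = {0}" using assms(5) vs1.subspace_0[OF V] linear_0[OF f] by auto
  moreover have "vs1.dim {0} = 0" using vs1.dim_le_card[of "{0}" "{}"] by simp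
  ultimately show ?thesis using rank_nullity[OF f V W] by simp
qed

end

context vector_space
begin

text \<open>A linear map with kernel exactly \<open>B\<close> has the same image on the sum as on
  \<open>A\<close>, with kernels \<open>B\<close> and the intersection. Rank-nullity for both
  restrictions gives the formula.\<close>

lemma dim_sum_Int:
  assumes A: "subspace A" "A \<subseteq> span W" and B: "subspace B" "B \<subseteq> span W" and W: "finite W"
  shows "dim {x + y |x y. x \<in> A \<and> y \<in> B} + dim (A \<inter> B) = dim A + dim B"
proof -
  interpret P: vector_space_pair scale scale by unfold_locales
  obtain B0 where B0: "B0 \<subseteq> B" "independent B0" "B \<subseteq> span B0" by (rule maximal_independent_subset)
  have BB: "span B0 = B" using B0 B span_minimal[of B0 B] by blast
  obtain C where C: "B0 \<subseteq> C" "C \<subseteq> UNIV" "independent C" "UNIV \<subseteq> span C"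
    by (rule maximal_independent_subset_extend[OF subset_UNIV B0(2)])
  obtain g where g: "Vector_Spaces.linear scale scale g" "\<And>x. x \<in> C \<Longrightarrow> g x = (if x \<in> B0 then 0 else x)"
    using P.linear_independent_extend[OF C(3), of "\<lambda>x. if x \<in> B0 then 0 else x"] by auto
  have kerg: "g x = 0 \<longleftrightarrow> x \<in> B" for x
  proof
    assume "x \<in> B"
    then show "g x = 0"
      using P.linear_eq_0_on_span[OF g(1), of B0 x] BB g(2) C by (auto simp: subset_iff)
  next
    assume gx: "g x = 0"
    have "x \<in> span (B0 \<union> (C - B0))" using C by (simp add: Un_absorb1) blast
    then obtain u w where uw: "x = u + w" "u \<in> span B0" "w \<in> span (C - B0)"
      unfolding span_Un by auto
    have "g u = 0" using P.linear_eq_0_on_span[OF g(1), of B0 u] uw g(2) C by (auto simp: subset_iff)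
    moreover have "g w = w"
      using P.linear_eq_on[OF g(1) module_hom_ident[unfolded module_hom_iff_linear] uw(3)] g(2) by auto
    ultimately have "w = 0" using gx uw P.linear_add[OF g(1)] by simp
    then show "x \<in> B" using uw BB by simp
  qed
  let ?S = "{x + y |x y. x \<in> A \<and> y \<in> B}"
  have S: "subspace ?S" using subspace_sums A B by blast
  have SW: "?S \<subseteq> span W" using A B span_add by blast
  have img: "g ` ?S = g ` A"
  proof
    show "g ` ?S \<subseteq> g ` A"
    proof safe
      fix x y assume "x \<in> A" "y \<in> B"
      then have "g (x + y) = g x" using kerg P.linear_add[OF g(1)] by simp
      then show "g (x + y) \<in> g ` A" using \<open>x \<in> A\<close> by blast
    qed
    show "g ` A \<subseteq> g ` ?S"
    proof (rule image_mono)
      show "A \<subseteq> ?S" using subspace_0[OF B(1)] by force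
    qed
  qed
  have "?S \<inter> {x. g x = 0} = B" using kerg subspace_0[OF A(1)] S B
    by force
  moreover have "A \<inter> {x. g x = 0} = A \<inter> B" using kerg by auto
  ultimately show ?thesis
    using P.rank_nullity[OF g(1) S SW W] P.rank_nullity[OF g(1) A W] img by simp
qed

text \<open>The functionals vanish on \<open>U\<close> and have a diagonal matrix with nonzero
  diagonal on the vectors \<open>u p\<close>, which are therefore independent modulo
  \<open>U\<close>. Later \<open>P\<close> is a set of points and each functional reads off local
  data at one of them.\<close>

lemma dim_add_card_le:
  assumes V: "subspace V" "V \<subseteq> span W" "finite W" and U: "subspace U" "U \<subseteq> V"
    and fin: "finite P" and u: "\<And>p. p \<in> P \<Longrightarrow> u p \<in> V"
    and \<phi>: "\<And>p x y. p \<in> P \<Longrightarrow> \<phi> p (x + y) = \<phi> p x + \<phi> p y" "\<And>p c x. p \<in> P \<Longrightarrow> \<phi> p (scale c x) = c * \<phi> p x"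
    and \<phi>U: "\<And>p x. p \<in> P \<Longrightarrow> x \<in> U \<Longrightarrow> \<phi> p x = 0"
    and diag: "\<And>p. p \<in> P \<Longrightarrow> \<phi> p (u p) \<noteq> 0"
    and off: "\<And>p q. p \<in> P \<Longrightarrow> q \<in> P \<Longrightarrow> p \<noteq> q \<Longrightarrow> \<phi> p (u q) = 0"
  shows "dim U + card P \<le> dim V"
proof -
  obtain B where B: "B \<subseteq> U" "independent B" "U \<subseteq> span B" "card B = dim U" "finite B"
    using obtain_fin_basis[of U W] U V by blast
  have "independent (B \<union> u ` Q) \<and> card (B \<union> u ` Q) = card B + card Q" if "Q \<subseteq> P" for Q
    using finite_subset[OF that fin] that
  proof (induction rule: finite_induct)
    case empty then show ?case using B by simp
  next
    case (insert q Q)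
    have z: "\<phi> q x = 0" if "x \<in> span (B \<union> u ` Q)" for x
      using that
    proof (induction rule: span_induct_alt)
      case base
      show ?case using \<phi>(2)[of q 0 0] insert by simp
    next
      case (step c x y)
      have q: "q \<in> P" using insert by auto
      have "\<phi> q x = 0" using step(1)
      proof
        assume "x \<in> B" then show ?thesis using \<phi>U q B by blast
      next
        assume "x \<in> u ` Q" then show ?thesis using off q insert by blast
      qed
      then show ?case using \<phi>[OF q] step by simp
    qed
    have n: "u q \<notin> span (B \<union> u ` Q)" using z diag[of q] insert by auto
    then have n2: "u q \<notin> B \<union> u ` Q" by (meson span_base)
    have "independent (insert (u q) (B \<union> u ` Q))" using insert n by (intro independent_insertI) auto
    moreover have "card (insert (u q) (B \<union> u ` Q)) = Suc (card (B \<union> u ` Q))"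
      using insert.hyps B n2 by (intro card_insert_disjoint) auto
    ultimately show ?case using insert by simp
  qed
  from this[of P] have i: "independent (B \<union> u ` P)" "card (B \<union> u ` P) = card B + card P" by auto
  obtain C where C: "C \<subseteq> V" "independent C" "V \<subseteq> span C" "card C = dim V" "finite C"
    using obtain_fin_basis[OF V(2,3)] .
  have "B \<union> u ` P \<subseteq> span C" using B U C u by blast
  then have "card (B \<union> u ` P) \<le> card C" using independent_span_bound[of C "B \<union> u ` P"] C i by blast
  then show ?thesis using i B C by linarith
qed

lemma dim_conditions:
  assumes V: "subspace V" "V \<subseteq> span W" "finite W" and fin: "finite P"
    and \<phi>: "\<And>p x y. p \<in> P \<Longrightarrow> \<phi> p (x + y) = \<phi> p x + \<phi> p y" "\<And>p c x. p \<in> P \<Longrightarrow> \<phi> p (scale c x) = c * \<phi> p x"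
  shows "dim V \<le> dim {x \<in> V. \<forall>p \<in> P. \<phi> p x = 0} + card P"
  using fin \<phi>
proof (induction P rule: finite_induct)
  case empty then show ?case by simp
next
  case (insert q P)
  let ?A = "{x \<in> V. \<forall>p \<in> P. \<phi> p x = 0}"
  have z: "\<phi> p 0 = 0" if "p \<in> insert q P" for p using insert.prems(2)[OF that, of 0 0] by simp
  have A: "subspace ?A" using V(1) insert.prems z unfolding subspace_def by auto
  interpret P: vector_space_pair scale "(*) :: 'a \<Rightarrow> 'a \<Rightarrow> 'a" by unfold_locales (auto simp: algebra_simps)
  have l: "Vector_Spaces.linear scale (*) (\<phi> q)" unfolding Vector_Spaces.linear_iff
    using insert.prems by (auto intro: vector_space_axioms P.vs2.vector_space_axioms)
  have "P.vs2.dim (\<phi> q ` ?A) \<le> card {1::'a}"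
  proof (rule P.vs2.dim_le_card)
    show "\<phi> q ` ?A \<subseteq> P.vs2.span {1}" by (auto simp: P.vs2.span_singleton)
  qed auto
  then have "dim ?A \<le> 1 + dim (?A \<inter> {x. \<phi> q x = 0})"
    using P.rank_nullity[OF l A subset_trans[OF _ V(2)] V(3)] by auto
  moreover have "?A \<inter> {x. \<phi> q x = 0} = {x \<in> V. \<forall>p \<in> insert q P. \<phi> p x = 0}" by auto
  ultimately show ?case using insert by auto
qed

end

section \<open>Monomial induction and evaluation homomorphisms\<close>

lemma poly_mapping_monomial_sum:
  fixes p :: "'a \<Rightarrow>\<^sub>0 'b::comm_monoid_add"
  shows "p = (\<Sum>m\<in>Poly_Mapping.keys p. Poly_Mapping.single m (Poly_Mapping.lookup p m))"
proof (rule poly_mapping_eqI)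
  fix k
  show "Poly_Mapping.lookup p k = Poly_Mapping.lookup (\<Sum>m\<in>Poly_Mapping.keys p. Poly_Mapping.single m (Poly_Mapping.lookup p m)) k"
    by (auto simp: lookup_sum lookup_single when_def in_keys_iff)
qed

lemma poly_mapping_induct_add [case_names zero single add]:
  fixes p :: "'a \<Rightarrow>\<^sub>0 'b::comm_monoid_add"
  assumes "P 0" "\<And>m c. P (Poly_Mapping.single m c)" "\<And>p q. P p \<Longrightarrow> P q \<Longrightarrow> P (p + q)"
  shows "P p"
proof -
  have "P (\<Sum>m\<in>A. Poly_Mapping.single m (Poly_Mapping.lookup p m))" if "finite A" for A
    using that by (induction A rule: finite_induct) (auto intro: assms)
  then show ?thesis by (subst poly_mapping_monomial_sum) simp
qed

text \<open>One evaluation serves two purposes: values at a point of C^3, and the passage to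
  iterated univariate polynomials. The coefficient map and the monomial map are kept separate for
  this reason.\<close>

definition poly_mapping_eval :: "('b::comm_ring_1 \<Rightarrow> 'c::comm_ring_1) \<Rightarrow> ('a::comm_monoid_add \<Rightarrow> 'c) \<Rightarrow> ('a \<Rightarrow>\<^sub>0 'b) \<Rightarrow> 'c" where
  "poly_mapping_eval \<kappa> M p = (\<Sum>m\<in>Poly_Mapping.keys p. \<kappa> (Poly_Mapping.lookup p m) * M m)"

lemma poly_mapping_eval_superset:
  assumes "\<kappa> 0 = 0" "finite A" "Poly_Mapping.keys p \<subseteq> A"
  shows "poly_mapping_eval \<kappa> M p = (\<Sum>m\<in>A. \<kappa> (Poly_Mapping.lookup p m) * M m)"
  unfolding poly_mapping_eval_def
  by (rule sum.mono_neutral_left) (use assms in \<open>auto simp: in_keys_iff\<close>)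

lemma poly_mapping_eval_add:
  assumes "\<kappa> 0 = 0" "\<And>a b. \<kappa> (a + b) = \<kappa> a + \<kappa> b"
  shows "poly_mapping_eval \<kappa> M (p + q) = poly_mapping_eval \<kappa> M p + poly_mapping_eval \<kappa> M q"
proof -
  let ?A = "Poly_Mapping.keys p \<union> Poly_Mapping.keys q"
  have "Poly_Mapping.keys (p + q) \<subseteq> ?A" by (rule keys_add)
  then show ?thesis
    by (subst (1 2 3) poly_mapping_eval_superset[of \<kappa> ?A])
       (auto simp: assms lookup_add algebra_simps sum.distrib)
qed

lemma poly_mapping_eval_single:
  assumes "\<kappa> 0 = 0"
  shows "poly_mapping_eval \<kappa> M (Poly_Mapping.single m c) = \<kappa> c * M m"
  by (subst poly_mapping_eval_superset[of \<kappa> "{m}"]) (auto simp: assms)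

lemma poly_mapping_eval_mult:
  assumes \<kappa>: "\<kappa> 0 = 0" "\<And>a b. \<kappa> (a + b) = \<kappa> a + \<kappa> b" "\<And>a b. \<kappa> (a * b) = \<kappa> a * \<kappa> b"
    and M: "\<And>m n. M (m + n) = M m * M n"
  shows "poly_mapping_eval \<kappa> M (p * q) = poly_mapping_eval \<kappa> M p * poly_mapping_eval \<kappa> M q"
proof (induction p rule: poly_mapping_induct_add)
  case zero
  show ?case by (simp add: poly_mapping_eval_def)
next
  case (single m c)
  show ?case
  proof (induction q rule: poly_mapping_induct_add)
    case zero
    show ?case by (simp add: poly_mapping_eval_def)
  next
    case (single m' c')
    show ?case by (simp add: mult_single poly_mapping_eval_single \<kappa> M ac_simps)
  next
    case (add p q)
    then show ?case by (simp add: poly_mapping_eval_add \<kappa> algebra_simps)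
  qed
next
  case (add p q)
  then show ?case by (simp add: poly_mapping_eval_add \<kappa> algebra_simps)
qed

subsection \<open>The polynomial ring in three variables\<close>

definition cst :: "complex \<Rightarrow> poly3" where "cst c = Poly_Mapping.single 0 c"
definition vX :: poly3 where "vX = Poly_Mapping.single (1, 0, 0) 1"
definition vY :: poly3 where "vY = Poly_Mapping.single (0, 1, 0) 1"
definition vZ :: poly3 where "vZ = Poly_Mapping.single (0, 0, 1) 1"

lemma cst_simps [simp]: "cst 0 = 0" "cst 1 = 1" "cst (a + b) = cst a + cst b" "cst (a * b) = cst a * cst b"
  "cst (- a) = - cst a" "cst (a - b) = cst a - cst b" "cst (of_nat n) = of_nat n"
  by (simp_all add: cst_def single_add mult_single single_uminus single_diff)

lemma cst_cancel: "c \<noteq> 0 \<Longrightarrow> cst (inverse c) * (cst c * p) = p"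
  by (metis cst_simps(2,4) left_inverse mult.assoc mult_1)

lemma cst_mult_single: "cst c * Poly_Mapping.single m d = Poly_Mapping.single m (c * d)"
  by (simp add: cst_def mult_single)

lemma lookup_cst_mult [simp]: "Poly_Mapping.lookup (cst c * p) m = c * Poly_Mapping.lookup p m"
  by (induction p rule: poly_mapping_induct_add)
     (auto simp: cst_mult_single lookup_single lookup_add algebra_simps when_def)

lemma vector_space_poly3: "vector_space (\<lambda>c p. cst c * p)"
  by unfold_locales (simp_all add: algebra_simps)

interpretation poly3: vector_space "\<lambda>c (p :: poly3). cst c * p"
  by (rule vector_space_poly3)

lemma eval3_eval:
  "eval3 p (x, y, z) = poly_mapping_eval (\<lambda>c. c) (\<lambda>(a, b, c). x ^ a * y ^ b * z ^ c) p"
  by (simp add: eval3_def poly_mapping_eval_def)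

lemma eval3_add [simp]: "eval3 (p + q) v = eval3 p v + eval3 q v"
  by (cases v) (simp add: eval3_eval poly_mapping_eval_add)

lemma eval3_single: "eval3 (Poly_Mapping.single (a, b, c) k) (x, y, z) = k * (x ^ a * y ^ b * z ^ c)"
  by (simp add: eval3_eval poly_mapping_eval_single)

lemma eval3_mult [simp]: "eval3 (p * q) v = eval3 p v * eval3 q v"
proof (cases v)
  case (fields x y z)
  show ?thesis unfolding fields eval3_eval
    by (rule poly_mapping_eval_mult) (auto simp: power_add)
qed

lemma eval3_0 [simp]: "eval3 0 v = 0"
  by (simp add: eval3_def split: prod.split)

lemma eval3_cst [simp]: "eval3 (cst c) v = c"
  by (cases v) (simp add: cst_def eval3_single zero_prod_def)

lemma eval3_1 [simp]: "eval3 1 v = 1"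
  using eval3_cst[of 1 v] by simp

lemma eval3_vars [simp]: "eval3 vX (x, y, z) = x" "eval3 vY (x, y, z) = y" "eval3 vZ (x, y, z) = z"
  by (simp_all add: vX_def vY_def vZ_def eval3_single)

lemma eval3_uminus [simp]: "eval3 (- p) v = - eval3 p v"
  by (metis add.right_inverse add_eq_0_iff eval3_0 eval3_add)

lemma eval3_diff [simp]: "eval3 (p - q) v = eval3 p v - eval3 q v"
  using eval3_add[of p "- q" v] by simp

lemma eval3_power [simp]: "eval3 (p ^ n) v = eval3 p v ^ n"
  by (induction n) auto

lemma eval3_prod: "eval3 (prod f A) v = (\<Prod>i\<in>A. eval3 (f i) v)"
  by (induction A rule: infinite_finite_induct) auto

text \<open>Unique factorisation is transferred from iterated univariate polynomials.\<close>

definition iter_poly :: "poly3 \<Rightarrow> complex poly poly poly" where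
  "iter_poly = poly_mapping_eval (\<lambda>k. [:[:[:k:]:]:]) (\<lambda>(a, b, c). monom (monom (monom 1 a) b) c)"

lemma iter_poly_add: "iter_poly (p + q) = iter_poly p + iter_poly q"
  unfolding iter_poly_def by (rule poly_mapping_eval_add) auto

lemma iter_poly_mult: "iter_poly (p * q) = iter_poly p * iter_poly q"
  unfolding iter_poly_def by (rule poly_mapping_eval_mult) (auto simp: mult_monom)

lemma iter_poly_single: "iter_poly (Poly_Mapping.single (a, b, c) k) = monom (monom (monom k a) b) c"
  unfolding iter_poly_def by (simp add: poly_mapping_eval_single smult_monom)

lemma iter_poly_0 [simp]: "iter_poly 0 = 0"
  by (simp add: iter_poly_def poly_mapping_eval_def)

lemma iter_poly_1 [simp]: "iter_poly 1 = 1"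
proof -
  have "iter_poly (Poly_Mapping.single (0, 0, 0) 1) = 1" by (simp add: iter_poly_single monom_0 one_pCons)
  moreover have "Poly_Mapping.single (0, 0, 0) 1 = (1 :: poly3)" by (metis single_one zero_prod_def)
  ultimately show ?thesis by simp
qed

lemma coeff_iter_poly: "coeff (coeff (coeff (iter_poly p) c) b) a = Poly_Mapping.lookup p (a, b, c)"
proof (induction p rule: poly_mapping_induct_add)
  case (single m k)
  obtain a' b' c' where "m = (a', b', c')" by (cases m)
  then show ?case by (auto simp: iter_poly_single lookup_single when_def)
qed (auto simp: iter_poly_add lookup_add)

lemma iter_poly_inject: "iter_poly p = iter_poly q \<longleftrightarrow> p = q"
proof
  assume "iter_poly p = iter_poly q"
  then have "Poly_Mapping.lookup p (a, b, c) = Poly_Mapping.lookup q (a, b, c)" for a b c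
    by (metis coeff_iter_poly)
  then show "p = q" by (intro poly_mapping_eqI) auto
qed auto

lemma iter_poly_eq_0_iff [simp]: "iter_poly p = 0 \<longleftrightarrow> p = 0"
  using iter_poly_inject[of p 0] by simp

lemma poly_range_if_monom:
  assumes "\<And>p q. p \<in> R \<Longrightarrow> q \<in> R \<Longrightarrow> p + q \<in> R" "\<And>c i. monom c i \<in> R"
  shows "p \<in> R"
proof -
  have [simp]: "(0 :: 'a poly) \<in> R" using assms(2)[of 0 0] by simp
  have "(\<Sum>i\<in>A. monom (f i) i) \<in> R" if "finite A" for A and f :: "nat \<Rightarrow> 'a"
    using that by (induction A rule: finite_induct) (simp_all add: assms)
  from this[of "{..degree p}" "coeff p"] show ?thesis by (simp add: poly_as_sum_of_monoms)
qed

lemma surj_iter_poly: "q \<in> range iter_poly"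
proof (rule poly_range_if_monom)
  have add: "p + q \<in> range iter_poly" if "p \<in> range iter_poly" "q \<in> range iter_poly" for p q
    using that by (metis (mono_tags) imageE iter_poly_add rangeI)
  then show "\<And>p q. p \<in> range iter_poly \<Longrightarrow> q \<in> range iter_poly \<Longrightarrow> p + q \<in> range iter_poly" .
  fix u :: "complex poly poly" and k
  have "u \<in> {u. monom u k \<in> range iter_poly}"
  proof (rule poly_range_if_monom)
    fix w :: "complex poly" and j
    have "w \<in> {w. monom (monom w j) k \<in> range iter_poly}"
    proof (rule poly_range_if_monom)
      fix x i
      show "monom x i \<in> {w. monom (monom w j) k \<in> range iter_poly}"
        unfolding mem_Collect_eq by (metis iter_poly_single rangeI)
    qed (simp add: add flip: add_monom)
    then show "monom w j \<in> {u. monom u k \<in> range iter_poly}" by simp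
  qed (simp add: add flip: add_monom)
  then show "monom u k \<in> range iter_poly" by simp
qed

lemma poly3_mult_eq_0_iff: "(p :: poly3) * q = 0 \<longleftrightarrow> p = 0 \<or> q = 0"
  using iter_poly_eq_0_iff[of "p * q"] by (simp add: iter_poly_mult del: iter_poly_eq_0_iff) simp

lemma poly3_mult_left_cancel: "(r :: poly3) \<noteq> 0 \<Longrightarrow> r * p = r * q \<longleftrightarrow> p = q"
  using poly3_mult_eq_0_iff[of r "p - q"] by (auto simp: algebra_simps)

lemma iter_poly_dvd: "iter_poly p dvd iter_poly q \<longleftrightarrow> p dvd q"
proof
  assume "iter_poly p dvd iter_poly q"
  then obtain r where "iter_poly q = iter_poly p * r" by auto
  moreover obtain r' where "r = iter_poly r'" using surj_iter_poly[of r] by auto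
  ultimately show "p dvd q" by (metis iter_poly_mult iter_poly_inject dvd_triv_left)
next
  assume "p dvd q"
  then show "iter_poly p dvd iter_poly q" by (auto simp: iter_poly_mult)
qed

lemma irreducible_dvd_mult_poly3:
  fixes f :: poly3
  assumes "irreducible f" "f dvd a * b"
  shows "f dvd a \<or> f dvd b"
proof -
  have "irreducible (iter_poly f)"
  proof (rule irreducibleI)
    show "iter_poly f \<noteq> 0" using assms by (auto simp: irreducible_def)
    show "\<not> iter_poly f dvd 1"
      using assms iter_poly_dvd[of f 1] by (auto simp: irreducible_def)
    fix a b assume ab: "iter_poly f = a * b"
    obtain a' b' where a': "a = iter_poly a'" "b = iter_poly b'"
      using surj_iter_poly[of a] surj_iter_poly[of b] by auto
    then have "f = a' * b'" using ab by (simp add: iter_poly_inject flip: iter_poly_mult)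
    then have "a' dvd 1 \<or> b' dvd 1" using assms by (auto simp: irreducible_def)
    then show "a dvd 1 \<or> b dvd 1" using a' iter_poly_dvd[of _ 1] by auto
  qed
  then have "prime_elem (iter_poly f)" by (rule irreducible_imp_prime_elem)
  moreover have "iter_poly f dvd iter_poly a * iter_poly b"
    using assms by (simp add: iter_poly_dvd flip: iter_poly_mult)
  ultimately show ?thesis using iter_poly_dvd prime_elem_dvd_mult_iff by blast
qed

section \<open>Partial derivatives, homogeneity and Euler's formula\<close>

lemma lookup_dx: "Poly_Mapping.lookup (dx p) (a, b, c) = of_nat (a + 1) * Poly_Mapping.lookup p (a + 1, b, c)"
proof -
  have "Poly_Mapping.lookup (dx p) (a, b, c) =
    (\<Sum>m\<in>Poly_Mapping.keys p. if m = (a + 1, b, c) then of_nat (a + 1) * Poly_Mapping.lookup p m else 0)"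
    unfolding dx_def lookup_sum
    by (rule sum.cong) (auto simp: lookup_single when_def split: prod.split)
  also have "\<dots> = of_nat (a + 1) * Poly_Mapping.lookup p (a + 1, b, c)"
    by (simp add: sum.delta in_keys_iff)
  finally show ?thesis .
qed

lemma lookup_dy: "Poly_Mapping.lookup (dy p) (a, b, c) = of_nat (b + 1) * Poly_Mapping.lookup p (a, b + 1, c)"
proof -
  have "Poly_Mapping.lookup (dy p) (a, b, c) =
    (\<Sum>m\<in>Poly_Mapping.keys p. if m = (a, b + 1, c) then of_nat (b + 1) * Poly_Mapping.lookup p m else 0)"
    unfolding dy_def lookup_sum
    by (rule sum.cong) (auto simp: lookup_single when_def split: prod.split)
  also have "\<dots> = of_nat (b + 1) * Poly_Mapping.lookup p (a, b + 1, c)"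
    by (simp add: sum.delta in_keys_iff)
  finally show ?thesis .
qed

lemma lookup_dz: "Poly_Mapping.lookup (dz p) (a, b, c) = of_nat (c + 1) * Poly_Mapping.lookup p (a, b, c + 1)"
proof -
  have "Poly_Mapping.lookup (dz p) (a, b, c) =
    (\<Sum>m\<in>Poly_Mapping.keys p. if m = (a, b, c + 1) then of_nat (c + 1) * Poly_Mapping.lookup p m else 0)"
    unfolding dz_def lookup_sum
    by (rule sum.cong) (auto simp: lookup_single when_def split: prod.split)
  also have "\<dots> = of_nat (c + 1) * Poly_Mapping.lookup p (a, b, c + 1)"
    by (simp add: sum.delta in_keys_iff)
  finally show ?thesis .
qed

lemma poly3_eqI:
  fixes p q :: poly3
  assumes "\<And>a b c. Poly_Mapping.lookup p (a, b, c) = Poly_Mapping.lookup q (a, b, c)"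
  shows "p = q"
  by (rule poly_mapping_eqI) (use assms in auto)

lemma d_add: "dx (p + q) = dx p + dx q" "dy (p + q) = dy p + dy q" "dz (p + q) = dz p + dz q"
  by (auto intro!: poly3_eqI simp: lookup_dx lookup_dy lookup_dz lookup_add algebra_simps)

lemma d_0: "dx 0 = 0" "dy 0 = 0" "dz 0 = 0"
  by (auto simp: dx_def dy_def dz_def)

text \<open>The truncated exponent at 0 does no harm, as the coefficient \<open>of_nat 0 * k\<close>
  vanishes there.\<close>

lemma d_single:
  "dx (Poly_Mapping.single (a, b, c) k) = Poly_Mapping.single (a - 1, b, c) (of_nat a * k)"
  "dy (Poly_Mapping.single (a, b, c) k) = Poly_Mapping.single (a, b - 1, c) (of_nat b * k)"
  "dz (Poly_Mapping.single (a, b, c) k) = Poly_Mapping.single (a, b, c - 1) (of_nat c * k)"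
  by (auto intro!: poly3_eqI simp: lookup_dx lookup_dy lookup_dz lookup_single when_def)

lemma d_mult:
  "dx (p * q) = dx p * q + p * dx q" "dy (p * q) = dy p * q + p * dy q" "dz (p * q) = dz p * q + p * dz q"
proof -
  have "dx (p * q) = dx p * q + p * dx q \<and> dy (p * q) = dy p * q + p * dy q \<and> dz (p * q) = dz p * q + p * dz q"
  proof (induction p rule: poly_mapping_induct_add)
    case zero
    show ?case by (simp add: d_0)
  next
    case (single m k)
    show ?case
    proof (induction q rule: poly_mapping_induct_add)
      case zero
      show ?case by (simp add: d_0)
    next
      case (single m' k')
      obtain a b c a' b' c' where m: "m = (a, b, c)" "m' = (a', b', c')" by (cases m; cases m') auto
      have [simp]: "Poly_Mapping.single m0 u + Poly_Mapping.single m0 v = Poly_Mapping.single m0 (u + v)"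
        for m0 and u v :: complex by (simp add: single_add)
      show ?case unfolding m d_single mult_single plus_prod_def
        by (cases a; cases a'; cases b; cases b'; cases c; cases c') (simp_all add: d_single algebra_simps)
    next
      case (add p q)
      then show ?case by (simp add: d_add algebra_simps)
    qed
  next
    case (add p q)
    then show ?case by (simp add: d_add algebra_simps)
  qed
  then show "dx (p * q) = dx p * q + p * dx q" "dy (p * q) = dy p * q + p * dy q"
    "dz (p * q) = dz p * q + p * dz q" by auto
qed

lemma d_cst [simp]: "dx (cst c) = 0" "dy (cst c) = 0" "dz (cst c) = 0"
  by (simp_all add: cst_def zero_prod_def d_single)

lemma d_vars [simp]: "dx vX = 1" "dy vX = 0" "dz vX = 0" "dx vY = 0" "dy vY = 1" "dz vY = 0"
  "dx vZ = 0" "dy vZ = 0" "dz vZ = 1"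
proof -
  have "Poly_Mapping.single (0, 0, 0) 1 = (1 :: poly3)" by (metis single_one zero_prod_def)
  then show "dx vX = 1" "dy vX = 0" "dz vX = 0" "dx vY = 0" "dy vY = 1" "dz vY = 0"
  "dx vZ = 0" "dy vZ = 0" "dz vZ = 1"
    by (simp_all add: vX_def vY_def vZ_def d_single)
qed

lemma homogeneous_lookup: "homogeneous n p \<longleftrightarrow> (\<forall>a b c. Poly_Mapping.lookup p (a, b, c) \<noteq> 0 \<longrightarrow> a + b + c = n)"
  unfolding homogeneous_def by (force simp: in_keys_iff mdeg_def)

lemma homogeneous_0 [simp]: "homogeneous n 0"
  by (simp add: homogeneous_def)

lemma homogeneous_add: "homogeneous n p \<Longrightarrow> homogeneous n q \<Longrightarrow> homogeneous n (p + q)"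
  unfolding homogeneous_lookup lookup_add by (metis add.right_neutral)

lemma homogeneous_uminus: "homogeneous n p \<Longrightarrow> homogeneous n (- p)"
  unfolding homogeneous_lookup by simp

lemma homogeneous_diff: "homogeneous n p \<Longrightarrow> homogeneous n q \<Longrightarrow> homogeneous n (p - q)"
  using homogeneous_add[of n p "- q"] homogeneous_uminus by simp

lemma homogeneous_single: "mdeg m = n \<Longrightarrow> homogeneous n (Poly_Mapping.single m c)"
  by (auto simp: homogeneous_def)

lemma homogeneous_sum: "(\<And>i. i \<in> A \<Longrightarrow> homogeneous n (f i)) \<Longrightarrow> homogeneous n (sum f A)"
  by (induction A rule: infinite_finite_induct) (auto intro: homogeneous_add)

lemma homogeneous_mult:
  assumes "homogeneous m p" "homogeneous n q"
  shows "homogeneous (m + n) (p * q)"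
  unfolding homogeneous_def
proof
  fix k assume "k \<in> Poly_Mapping.keys (p * q)"
  then obtain a b where "k = a + b" "a \<in> Poly_Mapping.keys p" "b \<in> Poly_Mapping.keys q"
    using keys_mult by blast
  then show "mdeg k = m + n" using assms by (cases a; cases b) (force simp: homogeneous_def mdeg_def)
qed

lemma homogeneous_cst: "homogeneous 0 (cst c)"
  unfolding cst_def by (rule homogeneous_single) (simp add: mdeg_def zero_prod_def)

lemma homogeneous_1: "homogeneous 0 1"
  using homogeneous_cst[of 1] by simp

lemma homogeneous_cst_mult: "homogeneous n p \<Longrightarrow> homogeneous n (cst c * p)"
  using homogeneous_mult[OF homogeneous_cst] by fastforce

lemma homogeneous_vars: "homogeneous 1 vX" "homogeneous 1 vY" "homogeneous 1 vZ"
  unfolding vX_def vY_def vZ_def by (auto intro!: homogeneous_single simp: mdeg_def)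

lemma homogeneous_power: "homogeneous n p \<Longrightarrow> homogeneous (k * n) (p ^ k)"
  by (induction k) (auto intro: homogeneous_mult simp: homogeneous_1)

lemma homogeneous_prod: "finite A \<Longrightarrow> (\<And>i. i \<in> A \<Longrightarrow> homogeneous n (f i)) \<Longrightarrow> homogeneous (card A * n) (prod f A)"
  by (induction A rule: finite_induct) (auto intro: homogeneous_mult simp: homogeneous_1)

lemma homogeneous_d:
  assumes "homogeneous n p"
  shows "homogeneous (n - 1) (dx p)" "homogeneous (n - 1) (dy p)" "homogeneous (n - 1) (dz p)"
  using assms unfolding homogeneous_lookup lookup_dx lookup_dy lookup_dz by fastforce+

lemma euler:
  assumes "homogeneous n p"
  shows "vX * dx p + vY * dy p + vZ * dz p = of_nat n * p"
proof -
  have "vX * dx p + vY * dy p + vZ * dz p =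
    (\<Sum>m\<in>Poly_Mapping.keys p. vX * dx (Poly_Mapping.single m (Poly_Mapping.lookup p m))
      + vY * dy (Poly_Mapping.single m (Poly_Mapping.lookup p m))
      + vZ * dz (Poly_Mapping.single m (Poly_Mapping.lookup p m)))"
  proof -
    have "dx (sum g A) = (\<Sum>i\<in>A. dx (g i))" "dy (sum g A) = (\<Sum>i\<in>A. dy (g i))" "dz (sum g A) = (\<Sum>i\<in>A. dz (g i))"
      for g :: "mono3 \<Rightarrow> poly3" and A
      by (induction A rule: infinite_finite_induct) (auto simp: d_add d_0)
    then show ?thesis
      by (subst (1 2 3) poly_mapping_monomial_sum[of p]) (simp add: sum_distrib_left sum.distrib)
  qed
  also have "\<dots> = (\<Sum>m\<in>Poly_Mapping.keys p. of_nat n * Poly_Mapping.single m (Poly_Mapping.lookup p m))"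
  proof (rule sum.cong)
    fix m assume "m \<in> Poly_Mapping.keys p"
    then have "mdeg m = n" using assms by (simp add: homogeneous_def)
    moreover obtain a b c where m: "m = (a, b, c)" by (cases m)
    ultimately have n: "n = a + b + c" by (simp add: mdeg_def)
    have [simp]: "Poly_Mapping.single m0 u + Poly_Mapping.single m0 v = Poly_Mapping.single m0 (u + v)"
      for m0 :: mono3 and u v :: complex by (simp add: single_add)
    show "vX * dx (Poly_Mapping.single m (Poly_Mapping.lookup p m))
      + vY * dy (Poly_Mapping.single m (Poly_Mapping.lookup p m))
      + vZ * dz (Poly_Mapping.single m (Poly_Mapping.lookup p m)) = of_nat n * Poly_Mapping.single m (Poly_Mapping.lookup p m)"
      unfolding m n cst_simps(7)[symmetric] cst_mult_single
      by (cases a; cases b; cases c) (simp_all add: vX_def vY_def vZ_def d_single mult_single algebra_simps)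
  qed simp
  also have "\<dots> = of_nat n * p"
    by (subst (2) poly_mapping_monomial_sum[of p]) (simp add: sum_distrib_left)
  finally show ?thesis .
qed

subsection \<open>Forms and homogeneous ideals\<close>

definition hcomp :: "nat \<Rightarrow> poly3 \<Rightarrow> poly3" where
  "hcomp n p = (\<Sum>m\<in>{m \<in> Poly_Mapping.keys p. mdeg m = n}. Poly_Mapping.single m (Poly_Mapping.lookup p m))"

lemma lookup_hcomp: "Poly_Mapping.lookup (hcomp n p) m = (if mdeg m = n then Poly_Mapping.lookup p m else 0)"
  unfolding hcomp_def lookup_sum
  by (auto simp: lookup_single when_def in_keys_iff)

lemma hcomp_add: "hcomp n (p + q) = hcomp n p + hcomp n q"
  by (rule poly_mapping_eqI) (simp add: lookup_hcomp lookup_add)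

lemma homogeneous_hcomp: "homogeneous n (hcomp n p)"
  by (auto simp: homogeneous_def in_keys_iff lookup_hcomp simp del: lookup_not_eq_zero_eq_in_keys split: if_splits)

lemma hcomp_homogeneous: "homogeneous k p \<Longrightarrow> hcomp n p = (if n = k then p else 0)"
  by (rule poly_mapping_eqI) (auto simp: lookup_hcomp homogeneous_def in_keys_iff)

lemma hcomp_mult:
  assumes "homogeneous e f"
  shows "hcomp n (a * f) = (if e \<le> n then hcomp (n - e) a * f else 0)"
proof (induction a rule: poly_mapping_induct_add)
  case zero
  show ?case using hcomp_homogeneous[OF homogeneous_0] by simp
next
  case (single m c)
  have s: "homogeneous (mdeg m) (Poly_Mapping.single m c)" by (rule homogeneous_single) simp
  have "homogeneous (mdeg m + e) (Poly_Mapping.single m c * f)" by (rule homogeneous_mult[OF s assms])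
  then show ?case using hcomp_homogeneous[OF s, of "n - e"] hcomp_homogeneous[of "mdeg m + e" _ n] by auto
next
  case (add p q)
  then show ?case by (simp add: algebra_simps hcomp_add)
qed

text \<open>The component of degree \<open>n\<close> of \<open>f * c\<close> involves a single
  component of \<open>c\<close>. Cancelling \<open>f\<close> identifies that component with
  \<open>c\<close>.\<close>

lemma homogeneous_cofactor:
  assumes "homogeneous e f" "f \<noteq> 0" "homogeneous n (f * c)" "c \<noteq> 0"
  shows "e \<le> n" "homogeneous (n - e) c"
proof -
  have "f * c = hcomp n (c * f)" using hcomp_homogeneous[OF assms(3), of n] by (simp add: mult.commute)
  also have "\<dots> = (if e \<le> n then f * hcomp (n - e) c else 0)"
    using hcomp_mult[OF assms(1), of n c] by (simp add: mult.commute)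
  finally have *: "f * c = (if e \<le> n then f * hcomp (n - e) c else 0)" .
  moreover have "f * c \<noteq> 0" using assms poly3_mult_eq_0_iff by auto
  ultimately show "e \<le> n" by (auto split: if_splits)
  then have "c = hcomp (n - e) c" using * poly3_mult_left_cancel[OF assms(2)] by simp
  then show "homogeneous (n - e) c" by (metis homogeneous_hcomp)
qed

definition form :: "nat \<Rightarrow> poly3 set" where "form n = {p. homogeneous n p}"

text \<open>The Hilbert function of the polynomial ring in three variables, the binomial coefficient
  of n + 2 over 2.\<close>

definition hf :: "nat \<Rightarrow> nat" where "hf n = (n + 1) * (n + 2) div 2"

lemma hf_eq: "2 * int (hf n) = (int n + 1) * (int n + 2)"
proof -
  have "2 * hf n = (n + 1) * (n + 2)" unfolding hf_def by (rule dvd_mult_div_cancel) simp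
  then have "int (2 * hf n) = int ((n + 1) * (n + 2))" by simp
  then show ?thesis by (simp add: algebra_simps)
qed

definition monoset :: "nat \<Rightarrow> mono3 set" where "monoset n = {m. mdeg m = n}"

lemma monoset_eq: "monoset n = (\<lambda>(a, b). (a, b, n - a - b)) ` (SIGMA a:{..n}. {..n - a})"
  unfolding monoset_def mdeg_def by (force split: prod.splits simp: image_iff)

lemma finite_monoset: "finite (monoset n)"
  unfolding monoset_eq by auto

lemma card_monoset: "card (monoset n) = hf n"
proof -
  have "card (monoset n) = card (SIGMA a:{..n}. {..n - a})"
    unfolding monoset_eq by (rule card_image) (auto simp: inj_on_def)
  also have "\<dots> = (\<Sum>a\<le>n. n - a + 1)" by simp
  also have "\<dots> = (\<Sum>a\<le>n. a + 1)"
    by (rule sum.reindex_bij_witness[of _ "\<lambda>a. n - a" "\<lambda>a. n - a"]) auto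
  also have "2 * \<dots> = (n + 1) * (n + 2)" by (induction n) auto
  then have "(\<Sum>a\<le>n. a + 1) = hf n" unfolding hf_def by simp
  finally show ?thesis .
qed

definition mon :: "mono3 \<Rightarrow> poly3" where "mon m = Poly_Mapping.single m 1"

lemma form_span: "form n \<subseteq> poly3.span (mon ` monoset n)"
proof
  fix p assume "p \<in> form n"
  then have k: "Poly_Mapping.keys p \<subseteq> monoset n" by (auto simp: form_def homogeneous_def monoset_def)
  have "p = (\<Sum>m\<in>Poly_Mapping.keys p. cst (Poly_Mapping.lookup p m) * mon m)"
    by (subst poly_mapping_monomial_sum) (simp add: mon_def cst_mult_single)
  also have "\<dots> \<in> poly3.span (mon ` monoset n)"
    using k by (intro poly3.span_sum poly3.span_scale poly3.span_base) auto
  finally show "p \<in> poly3.span (mon ` monoset n)" .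
qed

lemma finite_mon: "finite (mon ` monoset n)"
  using finite_monoset by simp

lemma mon_in_form: "m \<in> monoset n \<Longrightarrow> mon m \<in> form n"
  by (auto simp: mon_def form_def monoset_def intro: homogeneous_single)

lemma subspace_form: "poly3.subspace (form n)"
  unfolding poly3.subspace_def form_def by (auto intro: homogeneous_add homogeneous_cst_mult)

lemma dim_form: "poly3.dim (form n) = hf n"
proof -
  have inj: "inj_on mon (monoset n)"
    by (rule inj_onI) (metis keys_single mon_def singleton_inject zero_neq_one)
  have "card (mon ` monoset n) = hf n" using card_image[OF inj] card_monoset by simp
  moreover have "poly3.independent (mon ` monoset n)"
  proof (rule poly3.independent_if_scalars_zero[OF finite_mon])
    fix f x assume s: "(\<Sum>x\<in>mon ` monoset n. cst (f x) * x) = 0" and x: "x \<in> mon ` monoset n"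
    then obtain m where m: "m \<in> monoset n" "x = mon m" by auto
    have "0 = Poly_Mapping.lookup (\<Sum>k\<in>monoset n. cst (f (mon k)) * mon k) m"
      using s by (simp add: sum.reindex[OF inj])
    also have "\<dots> = (\<Sum>k\<in>monoset n. if k = m then f (mon k) else 0)"
      unfolding lookup_sum by (rule sum.cong) (auto simp: mon_def lookup_single when_def)
    also have "\<dots> = f x" using m finite_monoset by simp
    finally show "f x = 0" by simp
  qed
  ultimately show ?thesis
    using poly3.dim_unique[OF _ form_span] mon_in_form by blast
qed

lemma dim_mono_form: "U \<subseteq> V \<Longrightarrow> V \<subseteq> form n \<Longrightarrow> poly3.dim U \<le> poly3.dim V"
  by (rule poly3.dim_mono_fin[OF _ _ finite_mon]) (use form_span in blast)+

lemma dim_sum_Int_form: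
  assumes "poly3.subspace A" "A \<subseteq> form n" "poly3.subspace B" "B \<subseteq> form n"
  shows "poly3.dim {x + y |x y. x \<in> A \<and> y \<in> B} + poly3.dim (A \<inter> B) = poly3.dim A + poly3.dim B"
  by (rule poly3.dim_sum_Int[OF _ _ _ _ finite_mon]) (use assms form_span in blast)+

interpretation poly3_pair: vector_space_pair "\<lambda>c (p :: poly3). cst c * p" "\<lambda>c (p :: poly3). cst c * p"
  by unfold_locales

lemma linear_mult: "Vector_Spaces.linear (\<lambda>c (p :: poly3). cst c * p) (\<lambda>c (p :: poly3). cst c * p) ((*) f)"
  unfolding Vector_Spaces.linear_iff using poly3.vector_space_axioms by (auto simp: ring_distribs mult.left_commute)

lemma dim_mult:
  assumes "poly3.subspace V" "V \<subseteq> form n" "f \<noteq> 0"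
  shows "poly3.dim ((*) f ` V) = poly3.dim V"
  by (rule poly3_pair.dim_image_inj_on[OF linear_mult assms(1) _ finite_mon])
     (use assms form_span poly3_mult_eq_0_iff in blast)+

lemma subspace_mult: "poly3.subspace V \<Longrightarrow> poly3.subspace ((*) f ` V)"
  by (rule poly3_pair.linear_subspace_image[OF linear_mult])

lemma mult_form: "homogeneous e f \<Longrightarrow> V \<subseteq> form n \<Longrightarrow> (*) f ` V \<subseteq> form (e + n)"
  by (auto simp: form_def intro!: homogeneous_mult)

section \<open>Ideals and their codimension in a fixed degree\<close>

definition is_ideal :: "poly3 set \<Rightarrow> bool" where
  "is_ideal I \<longleftrightarrow> 0 \<in> I \<and> (\<forall>x\<in>I. \<forall>y\<in>I. x + y \<in> I) \<and> (\<forall>a. \<forall>x\<in>I. a * x \<in> I)"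

lemma is_ideal_0: "is_ideal I \<Longrightarrow> 0 \<in> I"
  and is_ideal_add: "is_ideal I \<Longrightarrow> x \<in> I \<Longrightarrow> y \<in> I \<Longrightarrow> x + y \<in> I"
  and is_ideal_mult: "is_ideal I \<Longrightarrow> x \<in> I \<Longrightarrow> a * x \<in> I"
  by (auto simp: is_ideal_def)

lemma is_ideal_mult': "is_ideal I \<Longrightarrow> x \<in> I \<Longrightarrow> x * a \<in> I"
  using is_ideal_mult[of I x a] by (simp add: mult.commute)

lemma is_ideal_diff: "is_ideal I \<Longrightarrow> x \<in> I \<Longrightarrow> y \<in> I \<Longrightarrow> x - y \<in> I"
  using is_ideal_add[of I x "-y"] is_ideal_mult[of I y "-1"] by simp

lemma is_ideal_cst_cancel: "is_ideal I \<Longrightarrow> c \<noteq> 0 \<Longrightarrow> cst c * x \<in> I \<Longrightarrow> x \<in> I"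
  using is_ideal_mult[of I "cst c * x" "cst (inverse c)"] cst_cancel[of c x] by simp

lemma subspace_ideal_form: "is_ideal I \<Longrightarrow> poly3.subspace (I \<inter> form n)"
  unfolding poly3.subspace_def is_ideal_def form_def by (auto intro: homogeneous_add homogeneous_cst_mult)

fun ideal_gen :: "poly3 list \<Rightarrow> poly3 set" where
  "ideal_gen [] = {0}"
| "ideal_gen (f # fs) = {a * f + b |a b. b \<in> ideal_gen fs}"

lemma is_ideal_gen: "is_ideal (ideal_gen fs)"
proof (induction fs)
  case Nil
  then show ?case by (simp add: is_ideal_def)
next
  case (Cons f fs)
  show ?case unfolding is_ideal_def
  proof (intro conjI ballI allI)
    show "0 \<in> ideal_gen (f # fs)" using is_ideal_0[OF Cons] by (force intro: exI[of _ 0])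
  next
    fix x y assume "x \<in> ideal_gen (f # fs)" "y \<in> ideal_gen (f # fs)"
    then obtain a b a' b' where "x = a * f + b" "y = a' * f + b'" "b \<in> ideal_gen fs" "b' \<in> ideal_gen fs" by auto
    then have "x + y = (a + a') * f + (b + b')" "b + b' \<in> ideal_gen fs"
      using is_ideal_add[OF Cons] by (auto simp: algebra_simps)
    then show "x + y \<in> ideal_gen (f # fs)" by auto
  next
    fix c x assume "x \<in> ideal_gen (f # fs)"
    then obtain a b where "x = a * f + b" "b \<in> ideal_gen fs" by auto
    then have "c * x = (c * a) * f + c * b" "c * b \<in> ideal_gen fs"
      using is_ideal_mult[OF Cons] by (auto simp: algebra_simps)
    then show "c * x \<in> ideal_gen (f # fs)" by auto
  qed
qed

lemma ideal_gen_superset: "f \<in> set fs \<Longrightarrow> f \<in> ideal_gen fs"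
proof (induction fs)
  case (Cons g fs)
  show ?case
  proof (cases "f = g")
    case True
    then have "f = 1 * g + 0" by simp
    then show ?thesis using is_ideal_0[OF is_ideal_gen, of fs] unfolding ideal_gen.simps mem_Collect_eq by blast
  next
    case False
    then have "f = 0 * g + f" "f \<in> ideal_gen fs" using Cons by auto
    then show ?thesis unfolding ideal_gen.simps mem_Collect_eq by blast
  qed
qed auto

lemma ideal_gen_minimal: "is_ideal I \<Longrightarrow> set fs \<subseteq> I \<Longrightarrow> ideal_gen fs \<subseteq> I"
  by (induction fs) (auto simp: is_ideal_def)

lemma ideal_gen_2: "ideal_gen [f, g] = {a * f + b * g |a b. True}"
  by auto

lemma ideal_gen_3: "ideal_gen [f, g, h] = {a * f + b * g + c * h |a b c. True}"
proof -
  have "ideal_gen [f, g, h] = {a * f + (b * g + c * h) |a b c. True}" by fastforce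
  then show ?thesis by (simp add: add.assoc)
qed

text \<open>Taking components of degree \<open>s\<close> replaces each coefficient by its component
  of the complementary degree.\<close>

lemma ideal_gen_3_form:
  assumes "homogeneous e1 f" "homogeneous e2 g" "homogeneous e3 h"
    and "p \<in> ideal_gen [f, g, h] \<inter> form s" "e1 \<le> s" "e2 \<le> s" "e3 \<le> s"
  obtains a b c where "p = a * f + b * g + c * h" "homogeneous (s - e1) a" "homogeneous (s - e2) b" "homogeneous (s - e3) c"
proof -
  obtain a b c where p: "p = a * f + b * g + c * h" using assms unfolding ideal_gen_3 by auto
  have "p = hcomp s p" using assms hcomp_homogeneous[of s p s] by (simp add: form_def)
  also have "\<dots> = hcomp (s - e1) a * f + hcomp (s - e2) b * g + hcomp (s - e3) c * h"
    using assms by (simp add: p hcomp_add hcomp_mult)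
  finally show ?thesis using that homogeneous_hcomp by blast
qed

lemma ideal_gen_2_form:
  assumes "homogeneous e1 f" "homogeneous e2 g" "p \<in> ideal_gen [f, g] \<inter> form s" "e1 \<le> s" "e2 \<le> s"
  obtains a b where "p = a * f + b * g" "homogeneous (s - e1) a" "homogeneous (s - e2) b"
proof -
  have "p \<in> ideal_gen [f, g, 0] \<inter> form s" using assms by auto
  from ideal_gen_3_form[OF assms(1,2) homogeneous_0 this assms(4,5), of 0]
  show ?thesis using that by auto
qed

text \<open>The Hilbert function of the quotient by a homogeneous ideal. For \<open>jac f\<close>
  with \<open>f\<close> reduced its value in large degrees is the total Tjurina number. It is
  integer-valued so that differences are not truncated.\<close>

definition codim :: "poly3 set \<Rightarrow> nat \<Rightarrow> int" where
  "codim I n = int (hf n) - int (poly3.dim (I \<inter> form n))"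

lemma codim_mono: "I \<subseteq> J \<Longrightarrow> codim J n \<le> codim I n"
  unfolding codim_def using dim_mono_form[of "I \<inter> form n" "J \<inter> form n" n] by auto

text \<open>The Koszul computation: the multiples of \<open>f\<close> and the multiples of
  \<open>g\<close> meet exactly in the multiples of \<open>f * g\<close>, since \<open>g\<close> is
  prime and does not divide \<open>f\<close>. The codimension becomes a second difference of the
  quadratic \<open>hf\<close>, which is the constant \<open>d * e\<close> once all degrees are
  nonnegative.\<close>

lemma codim_complete_intersection:
  assumes g: "irreducible g" "homogeneous d g" and f: "\<not> g dvd f" "homogeneous e f" and s: "d + e \<le> s"
  shows "codim (ideal_gen [f, g]) s = int (d * e)"
proof -
  have g0: "g \<noteq> 0" using g by (auto simp: irreducible_def)
  have f0: "f \<noteq> 0" using f by auto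
  let ?A = "(*) f ` form (s - e)" and ?B = "(*) g ` form (s - d)"
  have A: "poly3.subspace ?A" "?A \<subseteq> form s" "poly3.dim ?A = hf (s - e)"
    using subspace_mult[OF subspace_form] mult_form[OF f(2) subset_refl, of "s - e"] s
      dim_mult[OF subspace_form subset_refl f0] dim_form by auto
  have B: "poly3.subspace ?B" "?B \<subseteq> form s" "poly3.dim ?B = hf (s - d)"
    using subspace_mult[OF subspace_form] mult_form[OF g(2) subset_refl, of "s - d"] s
      dim_mult[OF subspace_form subset_refl g0] dim_form by auto
  have sum: "ideal_gen [f, g] \<inter> form s = {x + y |x y. x \<in> ?A \<and> y \<in> ?B}"
  proof (intro set_eqI iffI)
    fix p assume "p \<in> ideal_gen [f, g] \<inter> form s"
    from ideal_gen_2_form[OF f(2) g(2) this]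
    obtain a b where ab: "p = a * f + b * g" "homogeneous (s - e) a" "homogeneous (s - d) b" using s by auto
    have "f * a \<in> ?A" "g * b \<in> ?B" "p = f * a + g * b" using ab by (auto simp: form_def mult.commute)
    then show "p \<in> {x + y |x y. x \<in> ?A \<and> y \<in> ?B}" by blast
  next
    fix p assume "p \<in> {x + y |x y. x \<in> ?A \<and> y \<in> ?B}"
    then obtain a b where ab: "p = f * a + g * b" "a \<in> form (s - e)" "b \<in> form (s - d)" by auto
    then have "p \<in> form s" using A(2) B(2) by (auto simp: form_def intro!: homogeneous_add)
    moreover have "p \<in> ideal_gen [f, g]" unfolding ideal_gen_2 ab(1) mult.commute[of f] mult.commute[of g] by blast
    ultimately show "p \<in> ideal_gen [f, g] \<inter> form s" by simp
  qed
  have int: "?A \<inter> ?B = (*) (f * g) ` form (s - d - e)"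
  proof (intro set_eqI iffI)
    fix p assume "p \<in> ?A \<inter> ?B"
    then obtain a b where ab: "p = f * a" "p = g * b" "homogeneous (s - e) a"
      unfolding form_def by blast
    then have "g dvd f * a" by (metis dvd_triv_left)
    then obtain c where c: "a = g * c" using irreducible_dvd_mult_poly3[OF g(1), of f a] f(1)
      by (auto elim: dvdE)
    have "homogeneous (s - d - e) c"
    proof (cases "c = 0")
      case False
      have "homogeneous (s - e - d) c"
        using homogeneous_cofactor(2)[OF g(2) g0 _ False, of "s - e"] ab c by simp
      moreover have "s - e - d = s - d - e" by simp
      ultimately show ?thesis by metis
    qed simp
    then show "p \<in> (*) (f * g) ` form (s - d - e)" using ab c by (auto simp: form_def mult.assoc)
  next
    fix p assume "p \<in> (*) (f * g) ` form (s - d - e)"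
    then obtain c where c: "p = f * g * c" "homogeneous (s - d - e) c" by (auto simp: form_def)
    have "homogeneous (s - e) (g * c)" "homogeneous (s - d) (f * c)"
      using homogeneous_mult[OF g(2) c(2)] homogeneous_mult[OF f(2) c(2)] s by auto
    moreover have "p = f * (g * c)" "p = g * (f * c)" using c by (auto simp: algebra_simps)
    ultimately show "p \<in> ?A \<inter> ?B" unfolding form_def by blast
  qed
  have "f * g \<noteq> 0" using f0 g0 poly3_mult_eq_0_iff by simp
  then have "poly3.dim (?A \<inter> ?B) = hf (s - d - e)"
    unfolding int using dim_mult[OF subspace_form subset_refl] dim_form by simp
  then have "poly3.dim (ideal_gen [f, g] \<inter> form s) + hf (s - d - e) = hf (s - e) + hf (s - d)"
    using dim_sum_Int_form[OF A(1,2) B(1,2)] A(3) B(3) sum by simp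
  then have "codim (ideal_gen [f, g]) s = int (hf s) + int (hf (s - d - e)) - int (hf (s - e)) - int (hf (s - d))"
    unfolding codim_def by linarith
  then have "2 * codim (ideal_gen [f, g]) s = 2 * int (d * e)"
    using hf_eq[of s] hf_eq[of "s - d - e"] hf_eq[of "s - e"] hf_eq[of "s - d"] s
    by (simp add: of_nat_diff algebra_simps)
  then show ?thesis by simp
qed

fun lin :: "point3 \<Rightarrow> poly3" where "lin (a, b, c) = cst a * vX + cst b * vY + cst c * vZ"
fun dot :: "point3 \<Rightarrow> point3 \<Rightarrow> complex" where "dot (a, b, c) (x, y, z) = a * x + b * y + c * z"

lemma eval3_lin [simp]: "eval3 (lin v) p = dot v p"
  by (cases v; cases p) simp

lemma homogeneous_lin: "homogeneous 1 (lin v)"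
  by (cases v) (simp only: lin.simps homogeneous_add homogeneous_cst_mult homogeneous_vars)

lemma lin_vars: "lin (1, 0, 0) = vX" "lin (0, 1, 0) = vY" "lin (0, 0, 1) = vZ"
  by simp_all

text \<open>Euler's formula divided by the degree. It drives inductions on the degree of a
  form.\<close>

lemma form_Suc:
  assumes "homogeneous (Suc n) F"
  obtains A B C where "F = vX * A + vY * B + vZ * C" "homogeneous n A" "homogeneous n B" "homogeneous n C"
proof
  let ?c = "cst (inverse (of_nat (Suc n)))"
  have "F = cst (inverse (of_nat (Suc n))) * (cst (of_nat (Suc n)) * F)"
    using cst_cancel[of "of_nat (Suc n)" F] by (metis of_nat_neq_0)
  also have "cst (of_nat (Suc n)) * F = vX * dx F + vY * dy F + vZ * dz F" using euler[OF assms] by simp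
  finally show "F = vX * (?c * dx F) + vY * (?c * dy F) + vZ * (?c * dz F)" by (simp add: algebra_simps)
  show "homogeneous n (?c * dx F)" "homogeneous n (?c * dy F)" "homogeneous n (?c * dz F)"
    using homogeneous_d[OF assms] by (auto intro: homogeneous_cst_mult)
qed

lemma form_0: "homogeneous 0 F \<Longrightarrow> F = cst (Poly_Mapping.lookup F (0, 0, 0))"
  by (rule poly3_eqI) (auto simp: homogeneous_lookup cst_def lookup_single when_def zero_prod_def)

lemma eval3_scale:
  assumes "homogeneous n F"
  shows "eval3 F (c * x, c * y, c * z) = c ^ n * eval3 F (x, y, z)"
  using assms
proof (induction n arbitrary: F)
  case 0
  show ?case by (subst (1 2) form_0[OF 0]) simp
next
  case (Suc n)
  obtain A B C where "F = vX * A + vY * B + vZ * C" "homogeneous n A" "homogeneous n B" "homogeneous n C"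
    by (rule form_Suc[OF Suc.prems])
  then show ?case using Suc.IH by (simp add: algebra_simps)
qed

subsection \<open>Common eigenvectors and the projective Nullstellensatz\<close>

text \<open>For a homogeneous ideal this says that its zero set in the projective plane is
  finite.\<close>

definition codim_bounded :: "poly3 set \<Rightarrow> bool" where
  "codim_bounded I \<longleftrightarrow> (\<exists>B s1. \<forall>s\<ge>s1. codim I s \<le> int B)"

lemma codim_bounded_mono: "codim_bounded I \<Longrightarrow> I \<subseteq> J \<Longrightarrow> codim_bounded J"
  unfolding codim_bounded_def using codim_mono order_trans by meson

section \<open>Linear relations modulo an ideal and eigenvectors of a linear form\<close>

lemma span_image_lessThan:
  fixes u :: "nat \<Rightarrow> poly3"
  assumes "x \<in> poly3.span (u ` {..<i})"
  obtains a where "x = (\<Sum>j<i. cst (a j) * u j)"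
proof -
  let ?S = "{\<Sum>j<i. cst (a j) * u j |a. True}"
  have "poly3.span (u ` {..<i}) \<subseteq> ?S"
  proof (rule poly3.span_minimal)
    show "u ` {..<i} \<subseteq> ?S"
    proof safe
      fix k assume k: "k < i"
      have "(\<Sum>j<i. cst (if j = k then 1 else 0) * u j) = (\<Sum>j<i. if j = k then u j else 0)"
        by (rule sum.cong) auto
      also have "\<dots> = u k" using k by simp
      finally show "\<exists>a. u k = (\<Sum>j<i. cst (a j) * u j) \<and> True"
        by (intro exI[of _ "\<lambda>j. if j = k then 1 else 0"]) (rule conjI[OF sym TrueI])
    qed
    show "poly3.subspace ?S" unfolding poly3.subspace_def
    proof (intro conjI ballI allI)
      show "0 \<in> ?S" by (auto intro!: exI[of _ "\<lambda>_. 0"])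
      fix x y assume "x \<in> ?S" "y \<in> ?S"
      then obtain a b where "x = (\<Sum>j<i. cst (a j) * u j)" "y = (\<Sum>j<i. cst (b j) * u j)" by auto
      then have "x + y = (\<Sum>j<i. cst (a j + b j) * u j)" by (simp add: sum.distrib ring_distribs)
      then show "x + y \<in> ?S" unfolding mem_Collect_eq by metis
    next
      fix c x assume "x \<in> ?S"
      then obtain a where "x = (\<Sum>j<i. cst (a j) * u j)" by auto
      then have "cst c * x = (\<Sum>j<i. cst (c * a j) * u j)"
        by (simp only: sum_distrib_left cst_simps(4) mult.assoc)
      then show "cst c * x \<in> ?S" unfolding mem_Collect_eq by metis
    qed
  qed
  then obtain a where "x = (\<Sum>j<i. cst (a j) * u j)" using assms by blast
  then show ?thesis by (rule that)
qed

text \<open>Any \<open>B + 1\<close> elements of a quotient of dimension at most \<open>B\<close>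
  are dependent. The relation has indexed coefficients, and does not speak of dependence of a set,
  because the \<open>u i\<close> may coincide.\<close>

lemma relation_mod_ideal:
  assumes T: "is_ideal T" "codim T s \<le> int B" and u: "\<And>i. homogeneous s (u i)"
  shows "\<exists>a. (\<exists>i\<le>B. a i \<noteq> 0) \<and> (\<Sum>i\<le>B. cst (a i) * u i) \<in> T"
proof (rule ccontr)
  assume *: "\<not> ?thesis"
  then have neg: "(\<Sum>i\<le>B. cst (a i) * u i) \<notin> T" if "\<exists>i\<le>B. a i \<noteq> 0" for a using * that by blast
  have sp: "T \<inter> form s \<subseteq> poly3.span (mon ` monoset s)" using form_span by blast
  obtain C where C: "C \<subseteq> T \<inter> form s" "poly3.independent C" "T \<inter> form s \<subseteq> poly3.span C"
      "card C = poly3.dim (T \<inter> form s)" "finite C"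
    using poly3.obtain_fin_basis[OF sp finite_mon] .
  have CT: "poly3.span C \<subseteq> T" using poly3.span_minimal[OF C(1) subspace_ideal_form[OF T(1)]] by blast
  have "i \<le> Suc B \<Longrightarrow> poly3.independent (C \<union> u ` {..<i}) \<and> card (C \<union> u ` {..<i}) = card C + i" for i
  proof (induction i)
    case 0
    show ?case using C by simp
  next
    case (Suc i)
    have n: "u i \<notin> poly3.span (C \<union> u ` {..<i})"
    proof
      assume "u i \<in> poly3.span (C \<union> u ` {..<i})"
      then obtain x y where xy: "u i = x + y" "x \<in> poly3.span C" "y \<in> poly3.span (u ` {..<i})"
        unfolding poly3.span_Un by auto
      obtain a where a: "y = (\<Sum>j<i. cst (a j) * u j)" using span_image_lessThan[OF xy(3)] .
      define b where "b j = (if j < i then - a j else if j = i then 1 else 0)" for j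
      have "(\<Sum>j\<le>B. cst (b j) * u j) = (\<Sum>j<Suc i. cst (b j) * u j)"
        by (rule sum.mono_neutral_right) (use Suc.prems in \<open>auto simp: b_def\<close>)
      also have "\<dots> = x" using a xy(1) by (simp add: b_def sum_negf)
      finally have "(\<Sum>j\<le>B. cst (b j) * u j) \<in> T" using xy CT by auto
      moreover have "\<exists>j\<le>B. b j \<noteq> 0" using Suc.prems by (auto intro!: exI[of _ i] simp: b_def)
      ultimately show False using neg by blast
    qed
    have n2: "u i \<notin> C \<union> u ` {..<i}" by (rule contra_subsetD[OF poly3.span_superset n])
    have "poly3.independent (insert (u i) (C \<union> u ` {..<i}))" using Suc n by (intro poly3.independent_insertI) auto
    moreover have "card (insert (u i) (C \<union> u ` {..<i})) = Suc (card (C \<union> u ` {..<i}))"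
      using C n2 by (intro card_insert_disjoint) auto
    moreover have "insert (u i) (C \<union> u ` {..<i}) = C \<union> u ` {..<Suc i}" by (auto simp: lessThan_Suc)
    ultimately show ?case using Suc by simp
  qed
  from this[of "Suc B"] have i: "poly3.independent (C \<union> u ` {..<Suc B})" "card (C \<union> u ` {..<Suc B}) = card C + Suc B"
    by auto
  have "C \<union> u ` {..<Suc B} \<subseteq> form s" using C(1) u by (auto simp: form_def)
  then have "C \<union> u ` {..<Suc B} \<subseteq> poly3.span (mon ` monoset s)" using form_span by blast
  then have "card (C \<union> u ` {..<Suc B}) \<le> card (mon ` monoset s)"
    using poly3.independent_span_bound[OF finite_mon i(1)] by blast
  also have "\<dots> \<le> hf s" using card_image_le[OF finite_monoset] card_monoset by metis
  finally show False using i(2) C(4) T(2) unfolding codim_def by linarith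
qed

text \<open>This is l^n Q(X / l); \<open>n\<close> may exceed the degree of
  \<open>Q\<close>.\<close>

definition homogenize :: "poly3 \<Rightarrow> poly3 \<Rightarrow> nat \<Rightarrow> complex poly \<Rightarrow> poly3" where
  "homogenize X l n Q = (\<Sum>i\<le>n. cst (coeff Q i) * X ^ i * l ^ (n - i))"

lemma homogenize_pCons: "homogenize X l (Suc n) (pCons a Q) = cst a * l ^ Suc n + X * homogenize X l n Q"
  unfolding homogenize_def sum.atMost_Suc_shift by (simp add: sum_distrib_left algebra_simps)

lemma homogenize_Suc: "degree Q \<le> n \<Longrightarrow> homogenize X l (Suc n) Q = l * homogenize X l n Q"
  unfolding homogenize_def by (simp add: coeff_eq_0 sum_distrib_left Suc_diff_le algebra_simps)

lemma homogenize_linear_factor: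
  assumes "degree Q \<le> n"
  shows "homogenize X l (Suc n) ([:- c, 1:] * Q) = (X - cst c * l) * homogenize X l n Q"
proof -
  have "homogenize X l (Suc n) ([:- c, 1:] * Q) = homogenize X l (Suc n) (pCons 0 Q) - cst c * homogenize X l (Suc n) Q"
    by (simp add: homogenize_def sum_distrib_left sum_subtractf algebra_simps)
  then show ?thesis using assms by (simp only: homogenize_pCons homogenize_Suc) (simp add: algebra_simps)
qed

lemma homogeneous_homogenize:
  assumes "homogeneous 1 X" "homogeneous 1 l"
  shows "homogeneous n (homogenize X l n Q)"
  unfolding homogenize_def
proof (rule homogeneous_sum)
  fix i assume "i \<in> {..n}"
  then show "homogeneous n (cst (coeff Q i) * X ^ i * l ^ (n - i))"
    using homogeneous_mult[OF homogeneous_cst_mult[OF homogeneous_power[OF assms(1), of i]] homogeneous_power[OF assms(2), of "n - i"]]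
    by simp
qed

lemma nonzero_divisor_power:
  assumes "\<And>u. l * u \<in> T \<Longrightarrow> u \<in> (T :: poly3 set)" "l ^ n * u \<in> T"
  shows "u \<in> T"
  using assms(2) by (induction n) (auto simp: mult.assoc dest: assms(1))

text \<open>As \<open>l\<close> can be cancelled modulo \<open>T\<close>, multiplication by X / l
  behaves like an operator, and \<open>Q\<close> of it kills \<open>h\<close>. Linear factors of
  \<open>Q\<close> are removed until the remaining product does not kill \<open>h\<close>; the
  factor removed last gives the eigenvalue, the remaining product applied to \<open>h\<close> the
  eigenvector. A nonzero constant cannot kill \<open>h\<close>, so the process stops in
  time.\<close>

lemma eigenvector_of_annihilator:
  assumes T: "is_ideal T" and l: "homogeneous 1 l" "\<And>u. l * u \<in> T \<Longrightarrow> u \<in> T" and X: "homogeneous 1 X"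
    and h: "h \<notin> T" and Q: "Q \<noteq> 0" "degree Q \<le> n" "homogenize X l n Q * h \<in> T"
  shows "\<exists>c A m. homogeneous m A \<and> A * h \<notin> T \<and> (X - cst c * l) * (A * h) \<in> T"
  using Q
proof (induction "degree Q" arbitrary: Q n)
  case 0
  have "homogenize X l n Q = (\<Sum>i\<in>{0}. cst (coeff Q i) * X ^ i * l ^ (n - i))"
    unfolding homogenize_def by (rule sum.mono_neutral_right) (use 0 in \<open>auto simp: coeff_eq_0\<close>)
  then have "cst (coeff Q 0) * (l ^ n * h) \<in> T" using 0 by (simp add: mult.assoc)
  moreover have "coeff Q 0 \<noteq> 0" using 0 by (metis leading_coeff_0_iff)
  ultimately have "l ^ n * h \<in> T" using is_ideal_cst_cancel[OF T] by blast
  then show ?case using nonzero_divisor_power[of l T n h] l h by blast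
next
  case (Suc k)
  have "\<not> constant (poly Q)" using Suc(2) by (metis constant_degree nat.distinct(1))
  then obtain c where "poly Q c = 0" using fundamental_theorem_of_algebra by blast
  then obtain Q' where Q': "Q = [:- c, 1:] * Q'" by (auto simp: poly_eq_0_iff_dvd elim: dvdE)
  then have Q'0: "Q' \<noteq> 0" using Suc by auto
  have dQ: "degree Q = Suc (degree Q')" unfolding Q' using Q'0 by (subst degree_mult_eq) auto
  obtain n' where n: "n = Suc n'" "degree Q' \<le> n'" using Suc.prems(2) dQ by (cases n) auto
  have e: "(X - cst c * l) * (homogenize X l n' Q' * h) \<in> T"
    using Suc.prems(3) unfolding Q' n(1) homogenize_linear_factor[OF n(2)] by (simp add: mult.assoc)
  show ?case
  proof (cases "homogenize X l n' Q' * h \<in> T")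
    case True
    then show ?thesis using Suc(1)[of Q' n'] Suc(2) dQ Q'0 n by simp
  next
    case False
    then show ?thesis using e homogeneous_homogenize[OF X l(1)] by blast
  qed
qed

lemma eigenvector_exists:
  assumes T: "is_ideal T" "codim_bounded T" and l: "homogeneous 1 l" "\<And>u. l * u \<in> T \<Longrightarrow> u \<in> T"
    and X: "homogeneous 1 X" and h: "h \<notin> T" "homogeneous s h"
  obtains c A m where "homogeneous m A" "A * h \<notin> T" "(X - cst c * l) * (A * h) \<in> T"
proof -
  obtain B s1 where B: "\<And>s. s \<ge> s1 \<Longrightarrow> codim T s \<le> int B" using T(2) unfolding codim_bounded_def by blast
  \<comment> \<open>The factor \<open>l ^ s1\<close> lifts the degree into the range where the
    codimension is bounded. The value 0 beyond \<open>B\<close> makes every \<open>u i\<close>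
    homogeneous of one degree.\<close>
  define u where "u i = (if i \<le> B then X ^ i * l ^ (B - i) * (l ^ s1 * h) else 0)" for i
  have u: "homogeneous (B + s1 + s) (u i)" for i
  proof (cases "i \<le> B")
    case True
    have "homogeneous ((i * 1 + (B - i) * 1) + (s1 * 1 + s)) (X ^ i * l ^ (B - i) * (l ^ s1 * h))"
      by (intro homogeneous_mult homogeneous_power X l(1) h)
    then show ?thesis using True by (simp add: u_def add.assoc)
  qed (simp add: u_def)
  obtain a where a: "\<exists>i\<le>B. a i \<noteq> 0" "(\<Sum>i\<le>B. cst (a i) * u i) \<in> T"
    using relation_mod_ideal[OF T(1) B, of "B + s1 + s" u] u by auto
  define Q where "Q = (\<Sum>i\<le>B. monom (a i) i)"
  have cQ: "coeff Q i = (if i \<le> B then a i else 0)" for i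
    unfolding Q_def coeff_sum by (auto simp: when_def)
  have dQ: "degree Q \<le> B" by (rule degree_le) (simp add: cQ)
  have Q0: "Q \<noteq> 0" using a(1) cQ by (metis coeff_0)
  have "homogenize X l B Q * (l ^ s1 * h) = (\<Sum>i\<le>B. cst (a i) * u i)"
    unfolding homogenize_def sum_distrib_right by (rule sum.cong) (auto simp: cQ u_def mult.assoc)
  then have "homogenize X l B Q * (l ^ s1 * h) \<in> T" using a by simp
  moreover have "l ^ s1 * h \<notin> T" using nonzero_divisor_power[of l T s1 h] l h by blast
  ultimately obtain c A m where A: "homogeneous m A" "A * (l ^ s1 * h) \<notin> T" "(X - cst c * l) * (A * (l ^ s1 * h)) \<in> T"
    using eigenvector_of_annihilator[OF T(1) l X _ Q0 dQ] by blast
  have "homogeneous (m + s1 * 1) (A * l ^ s1)" by (intro homogeneous_mult homogeneous_power A l(1))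
  then show ?thesis using that[of _ "A * l ^ s1" c] A by (simp add: mult.assoc)
qed

text \<open>The eigenvalues of a simultaneous eigenvector of the coordinates on the quotient by \<open>T\<close> are the
  coordinates of a point.\<close>

lemma common_eigenvector:
  assumes T: "is_ideal T" "codim_bounded T" and l: "\<And>u. lin v * u \<in> T \<Longrightarrow> u \<in> T"
    and h: "h \<notin> T" "homogeneous s h"
  obtains x y z A where "dot v (x, y, z) = 1" "A * h \<notin> T" "(vX - cst x * lin v) * (A * h) \<in> T"
    "(vY - cst y * lin v) * (A * h) \<in> T" "(vZ - cst z * lin v) * (A * h) \<in> T"
proof -
  obtain x A m where A: "homogeneous m A" "A * h \<notin> T" "(vX - cst x * lin v) * (A * h) \<in> T"
    by (rule eigenvector_exists[OF T homogeneous_lin l homogeneous_vars(1) h])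
  \<comment> \<open>Each further eigenvector is a multiple of the previous one, and multiples keep
    the earlier eigenvalues because \<open>T\<close> is an ideal.\<close>
  obtain y A' m' where A': "homogeneous m' A'" "A' * (A * h) \<notin> T" "(vY - cst y * lin v) * (A' * (A * h)) \<in> T"
    by (rule eigenvector_exists[OF T homogeneous_lin l homogeneous_vars(2) A(2) homogeneous_mult[OF A(1) h(2)]])
  obtain z A'' m'' where A'': "homogeneous m'' A''" "A'' * (A' * (A * h)) \<notin> T" "(vZ - cst z * lin v) * (A'' * (A' * (A * h))) \<in> T"
    by (rule eigenvector_exists[OF T homogeneous_lin l homogeneous_vars(3) A'(2)
        homogeneous_mult[OF A'(1) homogeneous_mult[OF A(1) h(2)]]])
  define u where "u = A'' * (A' * (A * h))"
  have x: "(vX - cst x * lin v) * u \<in> T"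
    using is_ideal_mult[OF T(1) A(3), of "A'' * A'"] by (simp add: u_def algebra_simps)
  have y: "(vY - cst y * lin v) * u \<in> T"
    using is_ideal_mult[OF T(1) A'(3), of A''] by (simp add: u_def algebra_simps)
  have z: "(vZ - cst z * lin v) * u \<in> T" using A''(3) by (simp add: u_def)
  obtain a b c where v: "v = (a, b, c)" by (cases v)
  \<comment> \<open>With the coefficients of \<open>v\<close> the coordinates combine to
    \<open>lin v\<close>, whose eigenvalue relative to itself is 1. This normalises the
    point.\<close>
  have "cst a * ((vX - cst x * lin v) * u) + cst b * ((vY - cst y * lin v) * u) + cst c * ((vZ - cst z * lin v) * u) \<in> T" (is "?e \<in> T")
    by (intro is_ideal_add[OF T(1)] is_ideal_mult[OF T(1)] x y z)
  moreover have "?e = cst (1 - dot v (x, y, z)) * (lin v * u)"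
  proof -
    have *: "A * ((X - p * L) * u) + B * ((Y - q * L) * u) + C * ((Z - r * L) * u) = (1 - (A * p + B * q + C * r)) * (L * u)"
      if "L = A * X + B * Y + C * Z" for A B C X Y Z p q r L u :: poly3
      unfolding that by (simp add: algebra_simps)
    have "cst (1 - dot v (x, y, z)) = 1 - (cst a * cst x + cst b * cst y + cst c * cst z)" by (simp add: v)
    then show ?thesis using *[of "lin v" "cst a" vX "cst b" vY "cst c" vZ "cst x" u "cst y" "cst z"] unfolding v by simp
  qed
  ultimately have e: "cst (1 - dot v (x, y, z)) * (lin v * u) \<in> T" by (simp only:)
  have "u \<notin> T" using A''(2) by (simp only: u_def not_False_eq_True)
  then have "lin v * u \<notin> T" using l by blast
  then have "1 - dot v (x, y, z) = 0" using is_ideal_cst_cancel[OF T(1) _ e] by blast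
  then have "dot v (x, y, z) = 1" by simp
  then show ?thesis using that[of x y z "A'' * A' * A"] x y z A''(2) by (simp add: u_def mult.assoc)
qed

text \<open>Modulo the forms \<open>vX - cst x * lin v\<close> and its two analogues the coordinates
  become multiples of \<open>lin v\<close>, so \<open>F\<close> becomes its value at the point times
  a power of \<open>lin v\<close>. The induction on the degree keeps the cofactors
  homogeneous.\<close>

lemma form_expansion:
  assumes "homogeneous (Suc n) F"
  obtains A B C where "homogeneous n A" "homogeneous n B" "homogeneous n C"
    "F = cst (eval3 F (x, y, z)) * lin v ^ Suc n + (vX - cst x * lin v) * A + (vY - cst y * lin v) * B + (vZ - cst z * lin v) * C"
  using assms
proof (induction n arbitrary: F thesis)
  case 0
  obtain G1 G2 G3 where G: "F = vX * G1 + vY * G2 + vZ * G3" "homogeneous 0 G1" "homogeneous 0 G2" "homogeneous 0 G3"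
    by (rule form_Suc[OF "0.prems"(2)])
  have e: "cst (eval3 G1 p) = G1" "cst (eval3 G2 p) = G2" "cst (eval3 G3 p) = G3" for p
    using form_0[OF G(2)] form_0[OF G(3)] form_0[OF G(4)] by (metis eval3_cst)+
  show ?case
  proof (rule "0.prems"(1)[OF G(2-4)])
    show "F = cst (eval3 F (x, y, z)) * lin v ^ Suc 0 + (vX - cst x * lin v) * G1 + (vY - cst y * lin v) * G2 + (vZ - cst z * lin v) * G3"
      unfolding G(1) by (simp add: e) (simp add: algebra_simps)
  qed
next
  case (Suc n)
  obtain G1 G2 G3 where G: "F = vX * G1 + vY * G2 + vZ * G3" "homogeneous (Suc n) G1" "homogeneous (Suc n) G2" "homogeneous (Suc n) G3"
    by (rule form_Suc[OF Suc.prems(2)])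
  let ?l = "lin v"
  obtain A1 B1 C1 where 1: "homogeneous n A1" "homogeneous n B1" "homogeneous n C1"
    "G1 = cst (eval3 G1 (x, y, z)) * ?l ^ Suc n + (vX - cst x * ?l) * A1 + (vY - cst y * ?l) * B1 + (vZ - cst z * ?l) * C1"
    using Suc.IH[OF _ G(2)] by blast
  obtain A2 B2 C2 where 2: "homogeneous n A2" "homogeneous n B2" "homogeneous n C2"
    "G2 = cst (eval3 G2 (x, y, z)) * ?l ^ Suc n + (vX - cst x * ?l) * A2 + (vY - cst y * ?l) * B2 + (vZ - cst z * ?l) * C2"
    using Suc.IH[OF _ G(3)] by blast
  obtain A3 B3 C3 where 3: "homogeneous n A3" "homogeneous n B3" "homogeneous n C3"
    "G3 = cst (eval3 G3 (x, y, z)) * ?l ^ Suc n + (vX - cst x * ?l) * A3 + (vY - cst y * ?l) * B3 + (vZ - cst z * ?l) * C3"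
    using Suc.IH[OF _ G(4)] by blast
  let ?R = "\<lambda>A1 A2 A3. ?l * (cst x * A1 + cst y * A2 + cst z * A3)"
  have R: "homogeneous (Suc n) (?R A1 A2 A3)" if "homogeneous n A1" "homogeneous n A2" "homogeneous n A3" for A1 A2 A3
    using homogeneous_mult[OF homogeneous_lin homogeneous_add[OF homogeneous_add[OF homogeneous_cst_mult[OF that(1), of x] homogeneous_cst_mult[OF that(2), of y]] homogeneous_cst_mult[OF that(3), of z]], of v]
    by simp
  define e1 e2 e3 where e: "e1 = eval3 G1 (x, y, z)" "e2 = eval3 G2 (x, y, z)" "e3 = eval3 G3 (x, y, z)"
  have "F = (vX - cst x * ?l) * G1 + (vY - cst y * ?l) * G2 + (vZ - cst z * ?l) * G3
    + ?l * (cst x * G1 + cst y * G2 + cst z * G3)" unfolding G(1) by (simp add: algebra_simps)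
  also have "cst x * G1 + cst y * G2 + cst z * G3 = cst (eval3 F (x, y, z)) * ?l ^ Suc n
      + (vX - cst x * ?l) * (cst x * A1 + cst y * A2 + cst z * A3)
      + (vY - cst y * ?l) * (cst x * B1 + cst y * B2 + cst z * B3)
      + (vZ - cst z * ?l) * (cst x * C1 + cst y * C2 + cst z * C3)"
  proof -
    have E: "cst (eval3 F (x, y, z)) = cst x * cst e1 + cst y * cst e2 + cst z * cst e3" by (simp add: G(1) e)
    have g1: "G1 = cst e1 * ?l ^ Suc n + (vX - cst x * ?l) * A1 + (vY - cst y * ?l) * B1 + (vZ - cst z * ?l) * C1"
      unfolding e by (rule 1(4))
    have g2: "G2 = cst e2 * ?l ^ Suc n + (vX - cst x * ?l) * A2 + (vY - cst y * ?l) * B2 + (vZ - cst z * ?l) * C2"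
      unfolding e by (rule 2(4))
    have g3: "G3 = cst e3 * ?l ^ Suc n + (vX - cst x * ?l) * A3 + (vY - cst y * ?l) * B3 + (vZ - cst z * ?l) * C3"
      unfolding e by (rule 3(4))
    have *: "X * (E1 * P + a * A1 + b * B1 + c * C1) + Y * (E2 * P + a * A2 + b * B2 + c * C2)
        + Z * (E3 * P + a * A3 + b * B3 + c * C3) = (X * E1 + Y * E2 + Z * E3) * P
        + a * (X * A1 + Y * A2 + Z * A3) + b * (X * B1 + Y * B2 + Z * B3) + c * (X * C1 + Y * C2 + Z * C3)"
      for X Y Z E1 E2 E3 P a b c :: poly3 by (simp add: algebra_simps)
    show ?thesis unfolding E
      unfolding g1 g2 g3 by (rule *)
  qed
  finally have F1: "F = (vX - cst x * ?l) * G1 + (vY - cst y * ?l) * G2 + (vZ - cst z * ?l) * G3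
    + ?l * (cst (eval3 F (x, y, z)) * ?l ^ Suc n
      + (vX - cst x * ?l) * (cst x * A1 + cst y * A2 + cst z * A3)
      + (vY - cst y * ?l) * (cst x * B1 + cst y * B2 + cst z * B3)
      + (vZ - cst z * ?l) * (cst x * C1 + cst y * C2 + cst z * C3))" .
  have *: "a * G1 + b * G2 + c * G3 + l * (e * l ^ k + a * A + b * B + c * C)
    = e * l ^ Suc k + a * (G1 + l * A) + b * (G2 + l * B) + c * (G3 + l * C)" for a b c l e A B C :: poly3 and k
    by (simp add: algebra_simps)
  have F: "F = cst (eval3 F (x, y, z)) * ?l ^ Suc (Suc n)
    + (vX - cst x * ?l) * (G1 + ?R A1 A2 A3) + (vY - cst y * ?l) * (G2 + ?R B1 B2 B3) + (vZ - cst z * ?l) * (G3 + ?R C1 C2 C3)"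
    by (rule trans[OF F1 *])
  show ?case
    by (rule Suc.prems(1)[OF _ _ _ F]) (intro homogeneous_add G R 1 2 3)+
qed

text \<open>Consequently, if \<open>u\<close> is outside \<open>T\<close> and \<open>lin v\<close>
  can be cancelled modulo \<open>T\<close>, a form that multiplies \<open>u\<close> into
  \<open>T\<close> vanishes at the point.\<close>

lemma form_acts_by_value:
  assumes T: "is_ideal T" and F: "homogeneous n F"
    and u: "(vX - cst x * lin v) * u \<in> T" "(vY - cst y * lin v) * u \<in> T" "(vZ - cst z * lin v) * u \<in> T"
  shows "F * u - cst (eval3 F (x, y, z)) * lin v ^ n * u \<in> T"
proof (cases n)
  case 0
  then have "F = cst (eval3 F (x, y, z))" using form_0[of F] F by (metis eval3_cst)
  then have "F * u - cst (eval3 F (x, y, z)) * lin v ^ n * u = 0" using 0 by simp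
  then show ?thesis using is_ideal_0[OF T] by simp
next
  case (Suc k)
  obtain A B C where "F = cst (eval3 F (x, y, z)) * lin v ^ Suc k + (vX - cst x * lin v) * A + (vY - cst y * lin v) * B + (vZ - cst z * lin v) * C"
    using form_expansion[of k F x y z v] F Suc by blast
  then have "F * u - cst (eval3 F (x, y, z)) * lin v ^ n * u
      = (cst (eval3 F (x, y, z)) * lin v ^ Suc k + (vX - cst x * lin v) * A + (vY - cst y * lin v) * B + (vZ - cst z * lin v) * C) * u
        - cst (eval3 F (x, y, z)) * lin v ^ Suc k * u" using Suc by metis
  also have "\<dots> = A * ((vX - cst x * lin v) * u) + B * ((vY - cst y * lin v) * u) + C * ((vZ - cst z * lin v) * u)"
    by (simp add: algebra_simps)
  also have "\<dots> \<in> T" by (intro is_ideal_add[OF T] is_ideal_mult[OF T] u)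
  finally show ?thesis .
qed

text \<open>The least enlargement of an ideal modulo which \<open>l\<close> can be cancelled, as the
  construction of eigenvectors demands.\<close>

definition saturation :: "poly3 \<Rightarrow> poly3 set \<Rightarrow> poly3 set" where
  "saturation l I = {u. \<exists>k. l ^ k * u \<in> I}"

lemma saturation_superset: "I \<subseteq> saturation l I"
  unfolding saturation_def by (auto intro!: exI[of _ 0])

lemma is_ideal_saturation:
  assumes "is_ideal I"
  shows "is_ideal (saturation l I)"
  unfolding is_ideal_def
proof (intro conjI ballI allI)
  show "0 \<in> saturation l I" using is_ideal_0[OF assms] saturation_superset by blast
next
  fix x y assume "x \<in> saturation l I" "y \<in> saturation l I"
  then obtain i j where ij: "l ^ i * x \<in> I" "l ^ j * y \<in> I" by (auto simp: saturation_def)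
  have "l ^ (i + j) * (x + y) = l ^ j * (l ^ i * x) + l ^ i * (l ^ j * y)" by (simp add: power_add algebra_simps)
  then have "l ^ (i + j) * (x + y) \<in> I" using ij is_ideal_add[OF assms] is_ideal_mult[OF assms] by simp
  then show "x + y \<in> saturation l I" by (auto simp: saturation_def)
next
  fix a x assume "x \<in> saturation l I"
  then obtain i where "l ^ i * x \<in> I" by (auto simp: saturation_def)
  then have "l ^ i * (a * x) \<in> I" using is_ideal_mult[OF assms, of _ a] by (simp add: mult.left_commute)
  then show "a * x \<in> saturation l I" by (auto simp: saturation_def)
qed

lemma saturation_cancel: "l * u \<in> saturation l I \<Longrightarrow> u \<in> saturation l I"
  unfolding saturation_def mem_Collect_eq by (metis mult.assoc power_Suc2)

lemma saturation_cancel_power: "l ^ n * u \<in> saturation l I \<Longrightarrow> u \<in> saturation l I"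
  by (rule nonzero_divisor_power[OF saturation_cancel])

text \<open>If no power of \<open>lin v\<close> lies in \<open>I\<close>, the saturation does not
  contain 1. A common eigenvector modulo the saturation then yields a point at which all forms of
  \<open>I\<close> vanish.\<close>

lemma linear_form_power_in_ideal:
  assumes I: "is_ideal I" "codim_bounded I"
    and zeros: "\<And>x y z. (x, y, z) \<noteq> (0, 0, 0) \<Longrightarrow> \<exists>n F. homogeneous n F \<and> F \<in> I \<and> eval3 F (x, y, z) \<noteq> 0"
  shows "\<exists>k. lin v ^ k \<in> I"
proof (rule ccontr)
  assume neg: "\<nexists>k. lin v ^ k \<in> I"
  let ?T = "saturation (lin v) I"
  have T: "is_ideal ?T" "codim_bounded ?T"
    using is_ideal_saturation I codim_bounded_mono[OF I(2) saturation_superset] by auto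
  have "1 \<notin> ?T" using neg by (auto simp: saturation_def)
  then obtain x y z A where A: "dot v (x, y, z) = 1" "A * 1 \<notin> ?T" "(vX - cst x * lin v) * (A * 1) \<in> ?T"
    "(vY - cst y * lin v) * (A * 1) \<in> ?T" "(vZ - cst z * lin v) * (A * 1) \<in> ?T"
    using common_eigenvector[OF T saturation_cancel _ homogeneous_1, of v] by blast
  have "(x, y, z) \<noteq> (0, 0, 0)" using A(1) by (cases v) auto
  then obtain n F where F: "homogeneous n F" "F \<in> I" "eval3 F (x, y, z) \<noteq> 0" using zeros by blast
  have "F * (A * 1) - cst (eval3 F (x, y, z)) * lin v ^ n * (A * 1) \<in> ?T"
    by (rule form_acts_by_value[OF T(1) F(1) A(3-5)])
  moreover have "F * (A * 1) \<in> ?T" using is_ideal_mult'[OF T(1)] F(2) saturation_superset by blast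
  ultimately have "F * (A * 1) - (F * (A * 1) - cst (eval3 F (x, y, z)) * lin v ^ n * (A * 1)) \<in> ?T"
    using is_ideal_diff[OF T(1)] by blast
  then have "cst (eval3 F (x, y, z)) * (lin v ^ n * (A * 1)) \<in> ?T" by (simp add: mult.assoc)
  then have "lin v ^ n * (A * 1) \<in> ?T" using is_ideal_cst_cancel[OF T(1) F(3)] by blast
  then show False using saturation_cancel_power A(2) by blast
qed

lemma mon_eq: "mon (a, b, c) = vX ^ a * vY ^ b * vZ ^ c"
proof -
  have "vX ^ a = Poly_Mapping.single (a, 0, 0) 1" "vY ^ a = Poly_Mapping.single (0, a, 0) 1"
    "vZ ^ a = Poly_Mapping.single (0, 0, a) 1" for a
    by (induction a) (auto simp: vX_def vY_def vZ_def mult_single zero_prod_def[symmetric])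
  then show ?thesis by (simp add: mon_def mult_single)
qed

text \<open>Powers of all three variables lie in \<open>I\<close>, and a monomial whose degree is at
  least the sum of their exponents is divisible by one of them.\<close>

lemma projective_nullstellensatz:
  assumes I: "is_ideal I" "codim_bounded I"
    and zeros: "\<And>x y z. (x, y, z) \<noteq> (0, 0, 0) \<Longrightarrow> \<exists>n F. homogeneous n F \<and> F \<in> I \<and> eval3 F (x, y, z) \<noteq> 0"
  obtains N where "\<And>n. n \<ge> N \<Longrightarrow> form n \<subseteq> I"
proof -
  obtain i j k where ijk: "vX ^ i \<in> I" "vY ^ j \<in> I" "vZ ^ k \<in> I"
    using linear_form_power_in_ideal[OF I zeros] lin_vars by metis
  have "form n \<subseteq> I" if n: "n \<ge> i + j + k" for n
  proof -
    have "mon m \<in> I" if "m \<in> monoset n" for m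
    proof -
      obtain a b c where m: "m = (a, b, c)" by (cases m)
      then have "a + b + c = n" using that by (simp add: monoset_def mdeg_def)
      then consider "a \<ge> i" | "b \<ge> j" | "c \<ge> k" using n by linarith
      then show ?thesis
      proof cases
        case 1
        then have "vX ^ a = vX ^ (a - i) * vX ^ i" by (simp flip: power_add)
        then have "mon m = (vX ^ (a - i) * vY ^ b * vZ ^ c) * vX ^ i" by (simp add: m mon_eq mult_ac)
        then show ?thesis using is_ideal_mult[OF I(1) ijk(1)] by simp
      next
        case 2
        then have "vY ^ b = vY ^ (b - j) * vY ^ j" by (simp flip: power_add)
        then have "mon m = (vX ^ a * vY ^ (b - j) * vZ ^ c) * vY ^ j" by (simp add: m mon_eq mult_ac)
        then show ?thesis using is_ideal_mult[OF I(1) ijk(2)] by simp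
      next
        case 3
        then have "vZ ^ c = vZ ^ (c - k) * vZ ^ k" by (simp flip: power_add)
        then have "mon m = (vX ^ a * vY ^ b * vZ ^ (c - k)) * vZ ^ k" by (simp add: m mon_eq mult_ac)
        then show ?thesis using is_ideal_mult[OF I(1) ijk(3)] by simp
      qed
    qed
    then have "mon ` monoset n \<subseteq> I" by auto
    moreover have "poly3.subspace I" using I(1) by (simp add: poly3.subspace_def is_ideal_def)
    ultimately show ?thesis using poly3.span_minimal form_span by blast
  qed
  then show ?thesis using that by blast
qed

subsection \<open>Transversal intersections of plane curves\<close>

declare ideal_gen.simps [simp del]

text \<open>One representative of every point of the projective plane.\<close>

definition ppts :: "point3 set" where
  "ppts = {(1, b, c) |b c. True} \<union> {(0, 1, c) |c. True} \<union> {(0, 0, 1)}"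

lemma ppts_nonzero: "p \<in> ppts \<Longrightarrow> p \<noteq> (0, 0, 0)"
  by (auto simp: ppts_def)

lemma ppts_representative:
  assumes "(x, y, z) \<noteq> (0, 0, 0)"
  obtains c x' y' z' where "c \<noteq> 0" "(x', y', z') \<in> ppts" "(x, y, z) = (c * x', c * y', c * z')"
proof (cases "x = 0")
  case False
  then show ?thesis using that[of x 1 "y / x" "z / x"] by (simp add: ppts_def)
next
  case x: True
  show ?thesis
  proof (cases "y = 0")
    case False
    then show ?thesis using that[of y 0 1 "z / y"] x by (simp add: ppts_def)
  next
    case True
    then show ?thesis using that[of z 0 0 1] x assms by (simp add: ppts_def)
  qed
qed

text \<open>The candidates for \<open>v\<close> are orthogonal to \<open>q\<close>, and their values
  at \<open>p\<close> are, up to sign, the 2x2 minors of the pair. Distinct normalised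
  representatives are not proportional, so some minor is nonzero.\<close>

lemma ppts_separate:
  assumes "p \<in> ppts" "q \<in> ppts" "p \<noteq> q"
  shows "\<exists>v. dot v q = 0 \<and> dot v p \<noteq> 0"
proof -
  obtain x y z x' y' z' where pq: "p = (x, y, z)" "q = (x', y', z')" by (cases p; cases q) auto
  have "dot v q = 0 \<and> dot v p \<noteq> 0" if "v \<in> {(- y', x', 0), (- z', 0, x'), (0, - z', y')}" "dot v p \<noteq> 0" for v
    using that unfolding pq by auto
  moreover have "dot (- y', x', 0) p \<noteq> 0 \<or> dot (- z', 0, x') p \<noteq> 0 \<or> dot (0, - z', y') p \<noteq> 0"
    using assms unfolding pq ppts_def by auto
  ultimately show ?thesis by blast
qed

text \<open>On the curve (1, t, t^2) each nonzero vector excludes only the roots of one nonzero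
  polynomial in t.\<close>

lemma linear_form_avoiding:
  assumes "finite P" "(0, 0, 0) \<notin> P"
  obtains v where "\<And>p. p \<in> P \<Longrightarrow> dot v p \<noteq> 0"
proof -
  define Q where "Q = (\<lambda>(x, y, z). [:x, y, z:] :: complex poly)"
  have "(\<Prod>p\<in>P. Q p) \<noteq> 0" using assms by (auto simp: Q_def)
  then have "finite {t. poly (\<Prod>p\<in>P. Q p) t = 0}" by (rule poly_roots_finite)
  then obtain t where "poly (\<Prod>p\<in>P. Q p) t \<noteq> 0"
    using infinite_UNIV_char_0 by (metis (mono_tags, lifting) UNIV_eq_I mem_Collect_eq)
  then have t: "poly (Q p) t \<noteq> 0" if "p \<in> P" for p using that assms(1) by (auto simp: poly_prod)
  have "dot (1, t, t * t) p \<noteq> 0" if "p \<in> P" for p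
    using t[OF that] by (cases p) (auto simp: Q_def algebra_simps)
  then show ?thesis using that by blast
qed

text \<open>A product of powers of lines through the other points, filled up to degree
  \<open>s\<close> by a line avoiding \<open>p\<close>. The power \<open>N\<close> is needed because
  later functionals read Taylor coefficients of higher order, which must vanish at the other
  points.\<close>

lemma separating_form:
  assumes P: "finite P" "P \<subseteq> ppts" "p \<in> P" and s: "card P * N \<le> s"
  obtains L where "homogeneous s L" "eval3 L p \<noteq> 0"
    "\<And>q. q \<in> P \<Longrightarrow> q \<noteq> p \<Longrightarrow> \<exists>w M. dot w q = 0 \<and> L = lin w ^ N * M"
proof -
  define v where "v q = (SOME v. dot v q = 0 \<and> dot v p \<noteq> 0)" for q
  have v: "dot (v q) q = 0" "dot (v q) p \<noteq> 0" if "q \<in> P" "q \<noteq> p" for q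
    using someI_ex[OF ppts_separate[of p q]] that P unfolding v_def by auto
  obtain w where w: "dot w p \<noteq> 0"
    using linear_form_avoiding[of "{p}"] ppts_nonzero[of p] P(2,3)
    by (metis finite.emptyI finite_insert singletonD singletonI subsetD)
  let ?A = "P - {p}"
  define r where "r = s - card ?A * N"
  have cA: "card ?A * N \<le> s" using s P by (simp add: card_Diff_singleton) (meson diff_le_self le_trans mult_le_mono1)
  define L where "L = (\<Prod>q\<in>?A. lin (v q) ^ N) * lin w ^ r"
  show ?thesis
  proof (rule that)
    have "homogeneous (card ?A * (N * 1) + r * 1) L" unfolding L_def
      by (intro homogeneous_mult homogeneous_prod homogeneous_power homogeneous_lin) (use P in auto)
    then show "homogeneous s L" using cA by (simp add: r_def)
    show "eval3 L p \<noteq> 0" using v w P by (auto simp: L_def eval3_prod)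
    fix q assume q: "q \<in> P" "q \<noteq> p"
    have "L = lin (v q) ^ N * ((\<Prod>q\<in>?A - {q}. lin (v q) ^ N) * lin w ^ r)"
      unfolding L_def using q P by (subst prod.remove[of ?A q]) (auto simp: mult.assoc)
    then show "\<exists>w M. dot w q = 0 \<and> L = lin w ^ N * M" using v q by blast
  qed
qed

section \<open>Finiteness of intersections and Bezout's lower bound\<close>

definition common_zeros :: "poly3 \<Rightarrow> poly3 \<Rightarrow> point3 set" where
  "common_zeros f g = {p \<in> ppts. eval3 f p = 0 \<and> eval3 g p = 0}"

lemma ideal_gen_2_zero: "h \<in> ideal_gen [f, g] \<Longrightarrow> eval3 f p = 0 \<Longrightarrow> eval3 g p = 0 \<Longrightarrow> eval3 h p = 0"
  unfolding ideal_gen_2 by auto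

text \<open>Forms separating finitely many common zeros are independent modulo
  \<open>(f, g)\<close>, because evaluation at these points kills the ideal. Hence there are at most
  \<open>d * e\<close> of them.\<close>

lemma finite_common_zeros:
  assumes g: "irreducible g" "homogeneous d g" and f: "\<not> g dvd f" "homogeneous e f"
  shows "finite (common_zeros f g)"
proof -
  have "card P \<le> d * e" if P: "finite P" "P \<subseteq> common_zeros f g" for P
  proof -
    have pp: "P \<subseteq> ppts" using P by (auto simp: common_zeros_def)
    define s where "s = card P * 1 + d + e"
    have "\<exists>L. homogeneous s L \<and> eval3 L p \<noteq> 0 \<and> (\<forall>q\<in>P. q \<noteq> p \<longrightarrow> eval3 L q = 0)" if p: "p \<in> P" for p
    proof -
      obtain L where "homogeneous s L" "eval3 L p \<noteq> 0"
        "\<And>q. q \<in> P \<Longrightarrow> q \<noteq> p \<Longrightarrow> \<exists>w M. dot w q = 0 \<and> L = lin w ^ 1 * M"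
        by (rule separating_form[OF P(1) pp p, of 1 s]) (simp add: s_def, blast)
      then show ?thesis by (metis eval3_lin eval3_mult mult_zero_left power_one_right)
    qed
    then obtain L where L: "\<And>p. p \<in> P \<Longrightarrow> homogeneous s (L p) \<and> eval3 (L p) p \<noteq> 0 \<and> (\<forall>q\<in>P. q \<noteq> p \<longrightarrow> eval3 (L p) q = 0)"
      by metis
    have "poly3.dim (ideal_gen [f, g] \<inter> form s) + card P \<le> poly3.dim (form s)"
    proof (rule poly3.dim_add_card_le[where u = L and \<phi> = "\<lambda>p h. eval3 h p", OF subspace_form form_span finite_mon])
      show "poly3.subspace (ideal_gen [f, g] \<inter> form s)" by (rule subspace_ideal_form[OF is_ideal_gen])
      fix p x assume "p \<in> P" "x \<in> ideal_gen [f, g] \<inter> form s"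
      then show "eval3 x p = 0" using ideal_gen_2_zero P unfolding common_zeros_def by blast
    qed (use L P in \<open>auto simp: form_def\<close>)
    then have "int (card P) \<le> codim (ideal_gen [f, g]) s" unfolding codim_def dim_form by linarith
    also have "\<dots> = int (d * e)" by (rule codim_complete_intersection[OF g f]) (simp add: s_def)
    finally show ?thesis by linarith
  qed
  then show ?thesis using finite_if_finite_subsets_card_bdd by metis
qed

fun cross :: "point3 \<Rightarrow> point3 \<Rightarrow> point3" where
  "cross (a1, a2, a3) (b1, b2, b3) = (a2 * b3 - a3 * b2, a3 * b1 - a1 * b3, a1 * b2 - a2 * b1)"

definition grad :: "poly3 \<Rightarrow> point3 \<Rightarrow> point3" where
  "grad f p = (eval3 (dx f) p, eval3 (dy f) p, eval3 (dz f) p)"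

lemma euler_grad:
  assumes "homogeneous n f" "eval3 f p = 0"
  shows "dot (grad f p) p = 0"
proof -
  obtain x y z where p: "p = (x, y, z)" by (cases p)
  have "eval3 (vX * dx f + vY * dy f + vZ * dz f) p = 0"
    unfolding euler[OF assms(1)] using assms(2) by simp
  then show ?thesis by (simp add: grad_def p mult.commute)
qed

text \<open>Two vectors orthogonal to \<open>p\<close> have a cross product that is a multiple of \<open>p\<close>.\<close>

lemma dot_cross_nonzero:
  assumes "dot a p = 0" "dot b p = 0" "dot v p \<noteq> 0" "cross a b \<noteq> (0, 0, 0)"
  shows "dot v (cross a b) \<noteq> 0"
proof
  assume z: "dot v (cross a b) = 0"
  obtain a1 a2 a3 b1 b2 b3 v1 v2 v3 x y w where d: "a = (a1, a2, a3)" "b = (b1, b2, b3)" "v = (v1, v2, v3)" "p = (x, y, w)"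
    by (cases a; cases b; cases v; cases p) auto
  define c1 c2 c3 where c: "c1 = a2 * b3 - a3 * b2" "c2 = a3 * b1 - a1 * b3" "c3 = a1 * b2 - a2 * b1"
  have A: "a1 * x + a2 * y + a3 * w = 0" "b1 * x + b2 * y + b3 * w = 0" using assms d by auto
  have "c2 * w - c3 * y = b1 * (a1 * x + a2 * y + a3 * w) - a1 * (b1 * x + b2 * y + b3 * w)"
    "c3 * x - c1 * w = b2 * (a1 * x + a2 * y + a3 * w) - a2 * (b1 * x + b2 * y + b3 * w)"
    "c1 * y - c2 * x = b3 * (a1 * x + a2 * y + a3 * w) - a3 * (b1 * x + b2 * y + b3 * w)"
    by (simp_all add: c algebra_simps)
  then have e: "c2 * w = c3 * y" "c3 * x = c1 * w" "c1 * y = c2 * x" using A by auto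
  have vc: "v1 * c1 + v2 * c2 + v3 * c3 = 0" using z d c by simp
  have "c1 * (v1 * x + v2 * y + v3 * w) = x * (v1 * c1 + v2 * c2 + v3 * c3) + v2 * (c1 * y - c2 * x) - v3 * (c3 * x - c1 * w)"
    "c2 * (v1 * x + v2 * y + v3 * w) = y * (v1 * c1 + v2 * c2 + v3 * c3) - v1 * (c1 * y - c2 * x) + v3 * (c2 * w - c3 * y)"
    "c3 * (v1 * x + v2 * y + v3 * w) = w * (v1 * c1 + v2 * c2 + v3 * c3) + v1 * (c3 * x - c1 * w) - v2 * (c2 * w - c3 * y)"
    by (simp_all add: algebra_simps)
  then have "c1 = 0" "c2 = 0" "c3 = 0" using e vc assms(3) d by auto
  then show False using assms(4) d c by simp
qed

text \<open>Modulo \<open>(f, g)\<close> multiplication by the linear form is surjective in this degree, between spaces of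
  the same dimension \<open>d e\<close>.\<close>

lemma mult_linear_injective:
  assumes g: "irreducible g" "homogeneous d g" and f: "\<not> g dvd f" "homogeneous e f"
    and N: "form (Suc s) \<subseteq> ideal_gen [f, g, lin v]" and s: "d + e \<le> s" and v: "lin v \<noteq> 0"
    and u: "homogeneous s u" "lin v * u \<in> ideal_gen [f, g]"
  shows "u \<in> ideal_gen [f, g]"
proof -
  let ?I = "ideal_gen [f, g]" and ?l = "lin v"
  have I: "is_ideal ?I" by (rule is_ideal_gen)
  let ?A = "?I \<inter> form (Suc s)" and ?B = "(*) ?l ` form s"
  have A: "poly3.subspace ?A" "?A \<subseteq> form (Suc s)" using subspace_ideal_form[OF I] by auto
  have B: "poly3.subspace ?B" "?B \<subseteq> form (Suc s)" "poly3.dim ?B = hf s"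
    using subspace_mult[OF subspace_form] mult_form[OF homogeneous_lin subset_refl, of v s]
      dim_mult[OF subspace_form subset_refl v] dim_form by auto
  have "form (Suc s) \<subseteq> {x + y |x y. x \<in> ?A \<and> y \<in> ?B}"
  proof
    fix p assume p: "p \<in> form (Suc s)"
    then have "p \<in> ideal_gen [f, g, ?l] \<inter> form (Suc s)" using N by blast
    from ideal_gen_3_form[OF f(2) g(2) homogeneous_lin this]
    obtain a b c where abc: "p = a * f + b * g + c * ?l" "homogeneous (Suc s - e) a" "homogeneous (Suc s - d) b" "homogeneous s c"
      using s by auto
    have "a * f + b * g = p - c * ?l" using abc by simp
    moreover have "homogeneous (Suc s) (c * ?l)" using homogeneous_mult[OF abc(4) homogeneous_lin] by simp
    ultimately have "a * f + b * g \<in> form (Suc s)" using p homogeneous_diff by (simp add: form_def)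
    then have "a * f + b * g \<in> ?A" by (auto simp: ideal_gen_2)
    moreover have "?l * c \<in> ?B" using abc by (auto simp: form_def)
    moreover have "p = (a * f + b * g) + ?l * c" using abc by (simp add: mult.commute)
    ultimately show "p \<in> {x + y |x y. x \<in> ?A \<and> y \<in> ?B}" by blast
  qed
  moreover have "{x + y |x y. x \<in> ?A \<and> y \<in> ?B} \<subseteq> form (Suc s)"
    using A(2) B(2) by (auto simp: form_def intro!: homogeneous_add)
  ultimately have sum: "{x + y |x y. x \<in> ?A \<and> y \<in> ?B} = form (Suc s)" by blast
  define K where "K = {u \<in> form s. ?l * u \<in> ?I}"
  have K: "poly3.subspace K"
    unfolding poly3.subspace_def K_def form_def
    using is_ideal_0[OF I] is_ideal_add[OF I] is_ideal_mult[OF I]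
    by (auto intro: homogeneous_add homogeneous_cst_mult simp: distrib_left mult.left_commute)
  have "?A \<inter> ?B = (*) ?l ` K"
    using mult_form[OF homogeneous_lin subset_refl, of v s] by (auto simp: K_def)
  then have "poly3.dim (?A \<inter> ?B) = poly3.dim K"
    using dim_mult[OF K _ v, of s] by (auto simp: K_def)
  then have "hf (Suc s) + poly3.dim K = poly3.dim ?A + hf s"
    using dim_sum_Int_form[OF A B(1,2)] sum B(3) by (simp add: dim_form)
  \<comment> \<open>Equal codimensions in consecutive degrees leave no room for the kernel
    \<open>K\<close> to exceed the ideal in degree \<open>s\<close>.\<close>
  moreover have "codim ?I (Suc s) = codim ?I s"
    using codim_complete_intersection[OF g f, of s] codim_complete_intersection[OF g f, of "Suc s"] s by simp
  ultimately have "poly3.dim K \<le> poly3.dim (?I \<inter> form s)" unfolding codim_def by linarith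
  moreover have "?I \<inter> form s \<subseteq> K" using is_ideal_mult[OF I] by (auto simp: K_def)
  moreover have "K \<subseteq> poly3.span (mon ` monoset s)" using form_span unfolding K_def by blast
  ultimately have "?I \<inter> form s = K"
    using poly3.dim_eq_imp_eq[OF subspace_ideal_form[OF I]] finite_mon by blast
  then show ?thesis using u by (auto simp: K_def form_def)
qed

text \<open>The Taylor coefficients of \<open>f\<close> and \<open>g\<close> at a transversal zero generate, by Cramer's rule,
  the ideal of the point locally.\<close>

lemma transversal_cramer:
  assumes f: "homogeneous (Suc m) f" "eval3 f (x, y, z) = 0" and g: "homogeneous (Suc n) g" "eval3 g (x, y, z) = 0"
    and v: "dot v (x, y, z) = 1" and c: "cross (grad f (x, y, z)) (grad g (x, y, z)) \<noteq> (0, 0, 0)"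
  obtains D where "homogeneous (m + n) D" "eval3 D (x, y, z) \<noteq> 0"
    "D * (vX - cst x * lin v) \<in> ideal_gen [f, g]" "D * (vY - cst y * lin v) \<in> ideal_gen [f, g]"
    "D * (vZ - cst z * lin v) \<in> ideal_gen [f, g]"
proof -
  obtain v1 v2 v3 where vv: "v = (v1, v2, v3)" by (cases v)
  let ?l = "lin v" and ?p = "(x, y, z)"
  define a b c where abc: "a = vX - cst x * ?l" "b = vY - cst y * ?l" "c = vZ - cst z * ?l"
  have v': "v1 * x + v2 * y + v3 * z = 1" using v vv by simp
  have van: "eval3 a ?p = 0" "eval3 b ?p = 0" "eval3 c ?p = 0" unfolding abc using v by simp_all
  have rel: "cst v1 * a + cst v2 * b + cst v3 * c = 0"
  proof -
    have "cst v1 * a + cst v2 * b + cst v3 * c = (cst v1 * vX + cst v2 * vY + cst v3 * vZ) - (cst (v1 * x + v2 * y + v3 * z)) * ?l"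
      unfolding abc by (simp only: cst_simps ring_distribs mult.assoc) simp
    then show ?thesis unfolding v' by (simp add: vv)
  qed
  obtain F1 F2 F3 where F: "homogeneous m F1" "homogeneous m F2" "homogeneous m F3" "f = a * F1 + b * F2 + c * F3"
    using form_expansion[OF f(1), of x y z v] f(2) unfolding abc by auto
  obtain G1 G2 G3 where G: "homogeneous n G1" "homogeneous n G2" "homogeneous n G3" "g = a * G1 + b * G2 + c * G3"
    using form_expansion[OF g(1), of x y z v] g(2) unfolding abc by auto
  \<comment> \<open>\<open>D\<close> is the determinant with rows \<open>v\<close> and the two
    vectors of cofactors. Cramer's rule applies because \<open>rel\<close> is the missing third
    equation.\<close>
  define D where "D = cst v1 * (F2 * G3 - F3 * G2) + cst v2 * (F3 * G1 - F1 * G3) + cst v3 * (F1 * G2 - F2 * G1)"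
  have 1: "D * a = (G2 * cst v3 - G3 * cst v2) * f + (F3 * cst v2 - F2 * cst v3) * g
      + (F2 * G3 - F3 * G2) * (cst v1 * a + cst v2 * b + cst v3 * c)"
    unfolding D_def F(4) G(4) by (simp add: algebra_simps)
  have 2: "D * b = (G3 * cst v1 - G1 * cst v3) * f + (F1 * cst v3 - F3 * cst v1) * g
      + (F3 * G1 - F1 * G3) * (cst v1 * a + cst v2 * b + cst v3 * c)"
    unfolding D_def F(4) G(4) by (simp add: algebra_simps)
  have 3: "D * c = (G1 * cst v2 - G2 * cst v1) * f + (F2 * cst v1 - F1 * cst v2) * g
      + (F1 * G2 - F2 * G1) * (cst v1 * a + cst v2 * b + cst v3 * c)"
    unfolding D_def F(4) G(4) by (simp add: algebra_simps)
  have dl: "dx ?l = cst v1" "dy ?l = cst v2" "dz ?l = cst v3" by (simp_all add: vv d_add d_mult)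
  have dabc: "dx a = 1 - cst x * cst v1" "dx b = - (cst y * cst v1)" "dx c = - (cst z * cst v1)"
    "dy a = - (cst x * cst v2)" "dy b = 1 - cst y * cst v2" "dy c = - (cst z * cst v2)"
    "dz a = - (cst x * cst v3)" "dz b = - (cst y * cst v3)" "dz c = 1 - cst z * cst v3"
  proof -
    have "dx (p - q) = dx p - dx q" "dy (p - q) = dy p - dy q" "dz (p - q) = dz p - dz q" for p q
      by (metis d_add add_diff_cancel_right' diff_add_cancel)+
    then show "dx a = 1 - cst x * cst v1" "dx b = - (cst y * cst v1)" "dx c = - (cst z * cst v1)"
    "dy a = - (cst x * cst v2)" "dy b = 1 - cst y * cst v2" "dy c = - (cst z * cst v2)"
    "dz a = - (cst x * cst v3)" "dz b = - (cst y * cst v3)" "dz c = 1 - cst z * cst v3"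
      unfolding abc by (simp_all add: d_mult dl)
  qed
  \<comment> \<open>At the point the gradient is the vector of cofactors up to a multiple of
    \<open>v\<close>, which does not affect a determinant that has \<open>v\<close> as a
    row.\<close>
  have grad_eq: "\<exists>\<kappa>. grad h ?p = (eval3 H1 ?p - \<kappa> * v1, eval3 H2 ?p - \<kappa> * v2, eval3 H3 ?p - \<kappa> * v3)"
    if "h = a * H1 + b * H2 + c * H3" for h H1 H2 H3
    by (rule exI[of _ "x * eval3 H1 ?p + y * eval3 H2 ?p + z * eval3 H3 ?p"])
       (simp add: grad_def that d_add d_mult van dabc algebra_simps)
  obtain \<kappa> where gf: "grad f ?p = (eval3 F1 ?p - \<kappa> * v1, eval3 F2 ?p - \<kappa> * v2, eval3 F3 ?p - \<kappa> * v3)"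
    using grad_eq[OF F(4)] by blast
  obtain \<mu> where gg: "grad g ?p = (eval3 G1 ?p - \<mu> * v1, eval3 G2 ?p - \<mu> * v2, eval3 G3 ?p - \<mu> * v3)"
    using grad_eq[OF G(4)] by blast
  have "eval3 D ?p = dot v (cross (grad f ?p) (grad g ?p))"
    unfolding gf gg by (simp add: D_def vv algebra_simps)
  also have "\<dots> \<noteq> 0"
    by (rule dot_cross_nonzero[OF euler_grad[OF f] euler_grad[OF g] _ assms(6)]) (use v in simp)
  finally have "eval3 D ?p \<noteq> 0" .
  moreover have "homogeneous (m + n) D" unfolding D_def
    by (intro homogeneous_add homogeneous_cst_mult homogeneous_diff)
       (use F G homogeneous_mult add.commute in metis)+
  moreover have "D * a \<in> ideal_gen [f, g]" "D * b \<in> ideal_gen [f, g]" "D * c \<in> ideal_gen [f, g]"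
    unfolding 1 2 3 rel ideal_gen_2 by auto
  ultimately show ?thesis using that unfolding abc by blast
qed

text \<open>With fewer points, counting conditions gives a form \<open>h\<close> outside
  \<open>(f, g)\<close> that vanishes at all of them. A common eigenvector \<open>A * h\<close>
  modulo the saturation lies over one common zero. Since \<open>h\<close> vanishes there, it lies in
  the ideal of that point, and Cramer's form \<open>D\<close> multiplies it into
  \<open>(f, g)\<close>. Then \<open>D\<close> would have to vanish at the point, contrary to
  transversality.\<close>

theorem bezout_transversal:
  assumes g: "irreducible g" "homogeneous d g" and f: "\<not> g dvd f" "homogeneous e f"
    and de: "d \<ge> 1" "e \<ge> 1"
    and tr: "\<And>p. p \<noteq> (0, 0, 0) \<Longrightarrow> eval3 f p = 0 \<Longrightarrow> eval3 g p = 0 \<Longrightarrow> cross (grad f p) (grad g p) \<noteq> (0, 0, 0)"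
  shows "d * e \<le> card (common_zeros f g)"
proof (rule ccontr)
  assume less: "\<not> d * e \<le> card (common_zeros f g)"
  let ?Z = "common_zeros f g"
  have fin: "finite ?Z" by (rule finite_common_zeros[OF g f])
  have "(0, 0, 0) \<notin> ?Z" using ppts_nonzero by (auto simp: common_zeros_def)
  then obtain v where v: "\<And>p. p \<in> ?Z \<Longrightarrow> dot v p \<noteq> 0" using linear_form_avoiding[OF fin] by blast
  have rep: "\<exists>c x' y' z'. c \<noteq> 0 \<and> (x', y', z') \<in> ?Z \<and> (x, y, z) = (c * x', c * y', c * z')"
    if nz: "(x, y, z) \<noteq> (0, 0, 0)" and ze: "eval3 f (x, y, z) = 0" "eval3 g (x, y, z) = 0" for x y z
  proof -
    obtain c x' y' z' where c: "c \<noteq> 0" "(x', y', z') \<in> ppts" "(x, y, z) = (c * x', c * y', c * z')"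
      by (rule ppts_representative[OF nz])
    then have "eval3 f (x', y', z') = 0" "eval3 g (x', y', z') = 0"
      using ze eval3_scale[OF f(2)] eval3_scale[OF g(2)] by auto
    then show ?thesis using c by (auto simp: common_zeros_def)
  qed
  let ?l = "lin v" and ?I = "ideal_gen [f, g]"
  let ?J = "ideal_gen [f, g, ?l]"
  have I: "is_ideal ?I" and J: "is_ideal ?J" by (rule is_ideal_gen)+
  have bI: "codim_bounded ?I" unfolding codim_bounded_def
    using codim_complete_intersection[OF g f] by (intro exI[of _ "d * e"] exI[of _ "d + e"]) auto
  have IJ: "?I \<subseteq> ?J"
    by (rule ideal_gen_minimal[OF J]) (use ideal_gen_superset[of _ "[f, g, ?l]"] in auto)
  have memJ: "f \<in> ?J" "g \<in> ?J" "?l \<in> ?J" using ideal_gen_superset[of _ "[f, g, ?l]"] by auto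
  have memI: "f \<in> ?I" "g \<in> ?I" using ideal_gen_superset[of _ "[f, g]"] by auto
  have zJ: "\<exists>n F. homogeneous n F \<and> F \<in> ?J \<and> eval3 F (x, y, z) \<noteq> 0" if nz: "(x, y, z) \<noteq> (0, 0, 0)" for x y z
  proof (cases "eval3 f (x, y, z) = 0 \<and> eval3 g (x, y, z) = 0")
    case True
    then obtain c x' y' z' where c: "c \<noteq> 0" "(x', y', z') \<in> ?Z" "(x, y, z) = (c * x', c * y', c * z')"
      using rep[OF nz] by blast
    have "dot v (x, y, z) = c * dot v (x', y', z')" using c by (cases v) (simp add: algebra_simps)
    then have "eval3 ?l (x, y, z) \<noteq> 0" using c v by simp
    then show ?thesis using memJ homogeneous_lin by blast
  next
    case False
    then show ?thesis using memJ f g by blast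
  qed
  obtain N where N: "\<And>n. n \<ge> N \<Longrightarrow> form n \<subseteq> ?J"
    using projective_nullstellensatz[OF J codim_bounded_mono[OF bI IJ] zJ] by blast
  define s where "s = Suc (N + d + e)"
  have "card ?Z < d * e" using less by simp
  then have "d * e \<noteq> 0" by linarith
  \<comment> \<open>If there are no common zeros, the choice of \<open>v\<close> allows
    \<open>v = 0\<close>. Then \<open>(f, g)\<close> would contain all forms of large degree,
    against its codimension \<open>d * e\<close>.\<close>
  have l0: "?l \<noteq> 0"
  proof
    assume "?l = 0"
    then have "?J \<subseteq> ?I" using is_ideal_0[OF I] memI by (intro ideal_gen_minimal[OF I]) auto
    then have "form s \<subseteq> ?I" using N[of s] by (auto simp: s_def)
    then have "?I \<inter> form s = form s" by blast
    then have "codim ?I s = 0" by (simp add: codim_def dim_form)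
    then show False using codim_complete_intersection[OF g f, of s] \<open>d * e \<noteq> 0\<close> by (auto simp: s_def)
  qed
  \<comment> \<open>Multiplication by \<open>lin v\<close> raises the degree, so the claim must
    cover all degrees from \<open>s\<close> on. It shows that \<open>h\<close> stays outside the
    saturation.\<close>
  have inj: "homogeneous (s + n) u \<Longrightarrow> ?l ^ k * u \<in> ?I \<Longrightarrow> u \<in> ?I" for k n u
  proof (induction k arbitrary: u n)
    case (Suc k)
    have "homogeneous (s + Suc n) (?l * u)" using homogeneous_mult[OF homogeneous_lin Suc.prems(1)] by simp
    moreover have "?l ^ k * (?l * u) \<in> ?I" using Suc.prems(2) by (simp add: mult_ac)
    ultimately have "?l * u \<in> ?I" by (rule Suc.IH)
    then show ?case
      using mult_linear_injective[OF g f N _ l0 Suc.prems(1)] by (auto simp: s_def)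
  qed simp
  let ?V = "{h \<in> form s. \<forall>p\<in>?Z. eval3 h p = 0}"
  have "poly3.dim (form s) \<le> poly3.dim ?V + card ?Z"
    by (rule poly3.dim_conditions[OF subspace_form form_span finite_mon fin]) auto
  moreover have "codim ?I s = int (d * e)" by (rule codim_complete_intersection[OF g f]) (simp add: s_def)
  ultimately have "poly3.dim (?I \<inter> form s) < poly3.dim ?V"
    using \<open>card ?Z < d * e\<close> unfolding codim_def dim_form by linarith
  then have "\<not> ?V \<subseteq> ?I \<inter> form s" using dim_mono_form[of ?V "?I \<inter> form s" s] by auto
  then obtain h where h: "homogeneous s h" "\<And>p. p \<in> ?Z \<Longrightarrow> eval3 h p = 0" "h \<notin> ?I" by (auto simp: form_def)
  let ?T = "saturation ?l ?I"
  have T: "is_ideal ?T" "codim_bounded ?T"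
    using is_ideal_saturation[OF I] codim_bounded_mono[OF bI saturation_superset] by auto
  have hT: "h \<notin> ?T" using inj[of 0 h] h by (auto simp: saturation_def)
  obtain x y z A where A: "dot v (x, y, z) = 1" "A * h \<notin> ?T" "(vX - cst x * ?l) * (A * h) \<in> ?T"
    "(vY - cst y * ?l) * (A * h) \<in> ?T" "(vZ - cst z * ?l) * (A * h) \<in> ?T"
    by (rule common_eigenvector[OF T saturation_cancel hT h(1)])
  have ann: "eval3 F (x, y, z) = 0" if F: "homogeneous n F" "F * (A * h) \<in> ?T" for n F
  proof (rule ccontr)
    assume ne: "eval3 F (x, y, z) \<noteq> 0"
    have "F * (A * h) - cst (eval3 F (x, y, z)) * ?l ^ n * (A * h) \<in> ?T"
      by (rule form_acts_by_value[OF T(1) F(1) A(3-5)])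
    from is_ideal_diff[OF T(1) F(2) this]
    have "cst (eval3 F (x, y, z)) * (?l ^ n * (A * h)) \<in> ?T" by (simp add: mult.assoc)
    then have "?l ^ n * (A * h) \<in> ?T" using is_ideal_cst_cancel[OF T(1) ne] by blast
    then show False using saturation_cancel_power A(2) by blast
  qed
  have IT: "?I \<subseteq> ?T" by (rule saturation_superset)
  have ze: "eval3 f (x, y, z) = 0" "eval3 g (x, y, z) = 0"
    using ann[OF f(2)] ann[OF g(2)] is_ideal_mult'[OF T(1)] IT memI by blast+
  have nz: "(x, y, z) \<noteq> (0, 0, 0)" using A(1) by (cases v) auto
  obtain c x' y' z' where c: "c \<noteq> 0" "(x', y', z') \<in> ?Z" "(x, y, z) = (c * x', c * y', c * z')"
    using rep[OF nz ze] by blast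
  have h0: "eval3 h (x, y, z) = 0" using h(2)[OF c(2)] eval3_scale[OF h(1), of c x' y' z'] c(3) by simp
  have hs: "homogeneous (Suc (N + d + e)) h" using h(1) by (simp add: s_def)
  obtain H1 H2 H3 where "h = cst (eval3 h (x, y, z)) * ?l ^ Suc (N + d + e)
      + (vX - cst x * ?l) * H1 + (vY - cst y * ?l) * H2 + (vZ - cst z * ?l) * H3"
    by (rule form_expansion[OF hs])
  then have H: "h = (vX - cst x * ?l) * H1 + (vY - cst y * ?l) * H2 + (vZ - cst z * ?l) * H3"
    unfolding h0 by simp
  obtain e' d' where e': "e = Suc e'" "d = Suc d'" using de by (metis Suc_le_D One_nat_def)
  obtain D where D: "homogeneous (e' + d') D" "eval3 D (x, y, z) \<noteq> 0"
    "D * (vX - cst x * ?l) \<in> ?I" "D * (vY - cst y * ?l) \<in> ?I" "D * (vZ - cst z * ?l) \<in> ?I"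
    using transversal_cramer[OF _ ze(1) _ ze(2) A(1) tr[OF nz ze]] f(2) g(2) e' by blast
  have "D * (A * h) = A * H1 * (D * (vX - cst x * ?l)) + A * H2 * (D * (vY - cst y * ?l)) + A * H3 * (D * (vZ - cst z * ?l))"
  proof -
    have "D * (A * (a * H1 + b * H2 + c * H3)) = A * H1 * (D * a) + A * H2 * (D * b) + A * H3 * (D * c)" for a b c :: poly3
      by (simp add: algebra_simps)
    then show ?thesis using H by metis
  qed
  also have "\<dots> \<in> ?I" by (intro is_ideal_add[OF I] is_ideal_mult[OF I] D)
  finally have "D * (A * h) \<in> ?T" using IT by blast
  then show False using ann[OF D(1)] D(2) by blast
qed

subsection \<open>The polar ideal\<close>

definition jac :: "poly3 \<Rightarrow> poly3 set" where "jac f = ideal_gen [dx f, dy f, dz f]"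

lemma is_ideal_jac: "is_ideal (jac f)"
  unfolding jac_def by (rule is_ideal_gen)

lemma jac_mem: "dx f \<in> jac f" "dy f \<in> jac f" "dz f \<in> jac f"
  unfolding jac_def using ideal_gen_superset[of _ "[dx f, dy f, dz f]"] by auto

lemma euler_jac:
  assumes "homogeneous n f" "n \<ge> 1"
  shows "f \<in> jac f"
proof -
  have "cst (of_nat n) * f = vX * dx f + vY * dy f + vZ * dz f" using euler[OF assms(1)] by simp
  also have "\<dots> \<in> jac f" by (intro is_ideal_add[OF is_ideal_jac] is_ideal_mult[OF is_ideal_jac] jac_mem)
  finally have "cst (of_nat n) * f \<in> jac f" .
  moreover have "(of_nat n :: complex) \<noteq> 0" using assms(2) by simp
  ultimately show ?thesis using is_ideal_cst_cancel[OF is_ideal_jac] by blast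
qed

text \<open>Some partial derivative is nonzero; having smaller degree than \<open>g\<close> it is
  not divisible by \<open>g\<close>, so together with \<open>g\<close> it already has bounded
  codimension. Smoothness excludes common zeros, and the Nullstellensatz applies.\<close>

lemma smooth_jac_contains_forms:
  assumes g: "irreducible g" "homogeneous d g" "d \<ge> 1" "smooth_curve g"
  obtains N where "\<And>n. n \<ge> N \<Longrightarrow> form n \<subseteq> jac g"
proof -
  have g0: "g \<noteq> 0" using g by (auto simp: irreducible_def)
  have gj: "g \<in> jac g" by (rule euler_jac[OF g(2,3)])
  have "\<exists>h \<in> {dx g, dy g, dz g}. h \<noteq> 0"
  proof (rule ccontr)
    assume "\<not> ?thesis"
    then have "cst (of_nat d) * g = 0" using euler[OF g(2)] by simp
    moreover have "(of_nat d :: complex) \<noteq> 0" using g(3) by simp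
    ultimately have "g = 0" using cst_cancel[of "of_nat d" g] by (metis mult_zero_right)
    then show False using g0 by simp
  qed
  then obtain h where h: "h \<in> {dx g, dy g, dz g}" "h \<noteq> 0" by blast
  then have hh: "homogeneous (d - 1) h" and hj: "h \<in> jac g" using homogeneous_d[OF g(2)] jac_mem by auto
  have nd: "\<not> g dvd h"
  proof
    assume "g dvd h"
    then obtain c where c: "h = g * c" by (auto elim: dvdE)
    then have "c \<noteq> 0" using h(2) by auto
    then have "d \<le> d - 1" using homogeneous_cofactor(1)[OF g(2) g0, of "d - 1" c] hh c by simp
    then show False using g(3) by simp
  qed
  have "codim_bounded (ideal_gen [h, g])" unfolding codim_bounded_def
    using codim_complete_intersection[OF g(1,2) nd hh] by (intro exI[of _ "d * (d - 1)"] exI[of _ "d + (d - 1)"]) auto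
  moreover have "ideal_gen [h, g] \<subseteq> jac g" by (rule ideal_gen_minimal[OF is_ideal_jac]) (use hj gj in auto)
  ultimately have b: "codim_bounded (jac g)" by (rule codim_bounded_mono)
  have "\<exists>n F. homogeneous n F \<and> F \<in> jac g \<and> eval3 F (x, y, z) \<noteq> 0" if "(x, y, z) \<noteq> (0, 0, 0)" for x y z
    using g(4) that gj jac_mem[of g] homogeneous_d[OF g(2)] g(2) unfolding smooth_curve_def by blast
  then show ?thesis using projective_nullstellensatz[OF is_ideal_jac b] that by blast
qed

text \<open>The determinant of \<open>v\<close> and the gradients of \<open>h\<close> and
  \<open>g\<close>. As a derivation in \<open>h\<close> it annihilates \<open>g\<close> and
  \<open>lin v\<close>: it differentiates along the curve inside the affine chart where
  \<open>lin v\<close> is constant.\<close>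

fun der :: "point3 \<Rightarrow> poly3 \<Rightarrow> poly3 \<Rightarrow> poly3" where
  "der (v1, v2, v3) g h = cst v1 * (dy h * dz g - dz h * dy g) + cst v2 * (dz h * dx g - dx h * dz g)
     + cst v3 * (dx h * dy g - dy h * dx g)"

lemma der_add: "der v g (a + b) = der v g a + der v g b"
  by (cases v) (simp add: d_add algebra_simps)

lemma der_mult: "der v g (a * b) = der v g a * b + a * der v g b"
  by (cases v) (simp add: d_mult algebra_simps)

lemma der_self: "der v g g = 0"
  by (cases v) simp

lemma der_cst: "der v g (cst c) = 0"
  by (cases v) simp

lemma eval3_der: "eval3 (der v g h) p = dot v (cross (grad h p) (grad g p))"
  by (cases v) (simp add: grad_def)

lemma homogeneous_der:
  assumes "homogeneous m h" "homogeneous n g"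
  shows "homogeneous ((m - 1) + (n - 1)) (der v g h)"
proof (cases v)
  case (fields v1 v2 v3)
  show ?thesis unfolding fields der.simps
    by (intro homogeneous_add homogeneous_cst_mult homogeneous_diff homogeneous_mult homogeneous_d assms)
qed

text \<open>The Taylor series along the integral curve through \<open>p\<close> of the derivation \<^term>\<open>der v g\<close>.
  This derivation annihilates \<open>g\<close>, so the integral curve is a formal parametrisation of the curve
  \<open>g = 0\<close> near a smooth point.\<close>

definition taylor :: "point3 \<Rightarrow> poly3 \<Rightarrow> point3 \<Rightarrow> poly3 \<Rightarrow> complex fps" where
  "taylor v g p h = Abs_fps (\<lambda>n. eval3 ((der v g ^^ n) h) p / fact n)"

lemma taylor_nth_0: "fps_nth (taylor v g p h) 0 = eval3 h p"
  by (simp add: taylor_def)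

lemma taylor_der: "fps_deriv (taylor v g p h) = taylor v g p (der v g h)"
  by (rule fps_ext) (simp add: taylor_def funpow_swap1 divide_simps del: of_nat_Suc)

lemma taylor_nth_Suc: "fps_nth (taylor v g p h) (Suc n) = fps_nth (taylor v g p (der v g h)) n / of_nat (Suc n)"
  unfolding taylor_der[symmetric] by (simp add: divide_simps del: of_nat_Suc)

lemma der_funpow_add: "(der v g ^^ n) (a + b) = (der v g ^^ n) a + (der v g ^^ n) b"
  by (induction n) (auto simp: der_add)

lemma taylor_add: "taylor v g p (a + b) = taylor v g p a + taylor v g p b"
  by (rule fps_ext) (simp add: taylor_def der_funpow_add add_divide_distrib)

text \<open>The constant terms agree, and by the Leibniz rule the derivatives agree one order
  lower.\<close>

lemma taylor_mult: "taylor v g p (a * b) = taylor v g p a * taylor v g p b"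
proof (rule fps_ext)
  fix n
  show "fps_nth (taylor v g p (a * b)) n = fps_nth (taylor v g p a * taylor v g p b) n"
  proof (induction n arbitrary: a b)
    case 0
    show ?case by (simp add: taylor_nth_0)
  next
    case (Suc n)
    let ?t = "taylor v g p"
    have "of_nat (Suc n) * fps_nth (?t (a * b)) (Suc n) = fps_nth (?t (der v g a * b) + ?t (a * der v g b)) n"
      unfolding taylor_nth_Suc der_mult taylor_add by (simp add: divide_simps del: of_nat_Suc)
    also have "\<dots> = fps_nth (fps_deriv (?t a * ?t b)) n"
      by (simp add: Suc.IH taylor_der algebra_simps)
    also have "\<dots> = of_nat (Suc n) * fps_nth (?t a * ?t b) (Suc n)" by (simp only: fps_deriv_nth Suc_eq_plus1)
    finally show ?case by (metis mult_left_cancel of_nat_neq_0)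
  qed
qed

lemma taylor_0: "taylor v g p 0 = 0"
  using taylor_add[of v g p 0 0] by simp

lemma taylor_self: "eval3 g p = 0 \<Longrightarrow> taylor v g p g = 0"
proof (rule fps_ext)
  fix n assume "eval3 g p = 0"
  then show "fps_nth (taylor v g p g) n = fps_nth 0 n"
    by (cases n) (simp_all add: taylor_nth_0 taylor_nth_Suc der_self taylor_0)
qed

lemma taylor_cst: "taylor v g p (cst c) = fps_const c"
proof (rule fps_ext)
  fix n
  show "fps_nth (taylor v g p (cst c)) n = fps_nth (fps_const c) n"
    by (cases n) (simp_all add: taylor_nth_0 taylor_nth_Suc der_cst taylor_0)
qed

lemma taylor_1: "taylor v g p 1 = 1"
  using taylor_cst[of v g p 1] by simp

lemma taylor_power: "taylor v g p (a ^ n) = taylor v g p a ^ n"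
  by (induction n) (simp_all add: taylor_1 taylor_mult)

text \<open>Bounds the order of contact by the number of curves, which fixes in advance the exponent
  of the separating forms.\<close>

lemma taylor_prod_order:
  assumes "finite A" "\<And>i. i \<in> A \<Longrightarrow> taylor v g p (F i) \<noteq> 0 \<and> subdegree (taylor v g p (F i)) \<le> 1"
  shows "taylor v g p (prod F A) \<noteq> 0 \<and> subdegree (taylor v g p (prod F A)) \<le> card A"
  using assms
proof (induction A rule: finite_induct)
  case empty
  show ?case by (simp add: taylor_1)
next
  case (insert i A)
  have i: "taylor v g p (F i) \<noteq> 0" "subdegree (taylor v g p (F i)) \<le> 1"
    and A: "taylor v g p (prod F A) \<noteq> 0" "subdegree (taylor v g p (prod F A)) \<le> card A"
    using insert by auto
  then have "subdegree (taylor v g p (F i) * taylor v g p (prod F A)) \<le> 1 + card A" by (simp add: subdegree_mult)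
  then show ?case using insert.hyps i A by (simp add: taylor_mult)
qed

section \<open>The ideal of minors and its codimension\<close>

definition polar_ideal :: "poly3 \<Rightarrow> poly3 \<Rightarrow> poly3 set" where
  "polar_ideal f g = ideal_gen [g, dy f * dz g - dz f * dy g, dz f * dx g - dx f * dz g, dx f * dy g - dy f * dx g]"

lemma is_ideal_polar: "is_ideal (polar_ideal f g)"
  unfolding polar_ideal_def by (rule is_ideal_gen)

lemma polar_mem: "g \<in> polar_ideal f g" "dy f * dz g - dz f * dy g \<in> polar_ideal f g"
  "dz f * dx g - dx f * dz g \<in> polar_ideal f g" "dx f * dy g - dy f * dx g \<in> polar_ideal f g"
  unfolding polar_ideal_def by (rule ideal_gen_superset; simp)+

lemma der_in_polar: "der v g f \<in> polar_ideal f g"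
  by (cases v) (auto intro!: is_ideal_add[OF is_ideal_polar] is_ideal_mult[OF is_ideal_polar] polar_mem)

text \<open>Multiply Euler's formula for \<open>f\<close> by a partial of \<open>g\<close>, and the
  one for \<open>g\<close> by the same partial of \<open>f\<close>. The difference consists of
  multiples of minors.\<close>

lemma f_times_jac_in_polar:
  assumes f: "homogeneous e f" "e \<ge> 1" and g: "homogeneous d g" and a: "a \<in> jac g"
  shows "a * f \<in> polar_ideal f g"
proof -
  let ?P = "polar_ideal f g"
  have P: "is_ideal ?P" by (rule is_ideal_polar)
  have "jac g \<subseteq> {a. a * f \<in> ?P}" unfolding jac_def
  proof (rule ideal_gen_minimal)
    show "is_ideal {a. a * f \<in> ?P}"
      using is_ideal_0[OF P] is_ideal_add[OF P] is_ideal_mult[OF P] by (auto simp: is_ideal_def distrib_right mult.assoc)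
    have ef: "cst (of_nat e) * f = vX * dx f + vY * dy f + vZ * dz f" and eg: "cst (of_nat d) * g = vX * dx g + vY * dy g + vZ * dz g"
      using euler[OF f(1)] euler[OF g] by simp_all
    have "cst (of_nat e) * (dx g * f) = vZ * (dz f * dx g - dx f * dz g) - vY * (dx f * dy g - dy f * dx g) + dx f * cst (of_nat d) * g"
      "cst (of_nat e) * (dy g * f) = vX * (dx f * dy g - dy f * dx g) - vZ * (dy f * dz g - dz f * dy g) + dy f * cst (of_nat d) * g"
      "cst (of_nat e) * (dz g * f) = vY * (dy f * dz g - dz f * dy g) - vX * (dz f * dx g - dx f * dz g) + dz f * cst (of_nat d) * g"
      unfolding mult.left_commute[of "cst (of_nat e)"] mult.assoc ef eg by (simp_all add: algebra_simps)
    then have "cst (of_nat e) * (dx g * f) \<in> ?P" "cst (of_nat e) * (dy g * f) \<in> ?P" "cst (of_nat e) * (dz g * f) \<in> ?P"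
      by (simp_all only:) (intro is_ideal_add[OF P] is_ideal_diff[OF P] is_ideal_mult[OF P] polar_mem)+
    then show "set [dx g, dy g, dz g] \<subseteq> {a. a * f \<in> ?P}"
      using is_ideal_cst_cancel[OF P, of "of_nat e"] f(2) by auto
  qed
  then show ?thesis using a by auto
qed

lemma fps_nth_mult_eq_0:
  assumes "\<And>j. j \<le> n \<Longrightarrow> fps_nth A j = (0 :: complex)"
  shows "fps_nth (A * B) n = 0" "fps_nth (B * A) n = 0"
  using assms by (simp_all add: fps_mult_nth)

text \<open>At a point p of \<open>f = g = 0\<close> take the Taylor coefficient of order
  \<open>m p - 1\<close> along the curve \<open>g = 0\<close>. It vanishes on \<open>(f, g)\<close>,
  since \<open>f\<close> has order \<open>m p\<close> there, but not on \<open>der v g f\<close>,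
  the derivative of \<open>f\<close>. Separating forms as factors make these functionals diagonal,
  so every point contributes one dimension beyond \<open>(f, g)\<close>.\<close>

theorem codim_polar_ideal:
  assumes g: "irreducible g" "homogeneous d g" "d \<ge> 1" "smooth_curve g"
    and J: "finite J" "J \<noteq> {}" and F: "\<And>i. i \<in> J \<Longrightarrow> homogeneous d (F i)" "\<And>i. i \<in> J \<Longrightarrow> \<not> g dvd F i"
    and tr: "\<And>i p. i \<in> J \<Longrightarrow> p \<noteq> (0, 0, 0) \<Longrightarrow> eval3 (F i) p = 0 \<Longrightarrow> eval3 g p = 0 \<Longrightarrow> cross (grad (F i) p) (grad g p) \<noteq> (0, 0, 0)"
  shows "\<exists>s0. \<forall>s\<ge>s0. codim (polar_ideal (prod F J) g) s \<le> int (d * (card J * d)) - int (card (common_zeros (prod F J) g))"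
proof -
  define f where "f = prod F J"
  define e where "e = card J * d"
  let ?Z = "common_zeros f g" and ?P = "polar_ideal f g" and ?I = "ideal_gen [f, g]"
  have P: "is_ideal ?P" by (rule is_ideal_polar)
  have fh: "homogeneous e f" unfolding e_def f_def by (rule homogeneous_prod[OF J(1) F(1)])
  have e1: "e \<ge> 1" using J g(3) by (simp add: e_def card_gt_0_iff Suc_le_eq)
  have nd: "\<not> g dvd f" unfolding f_def using J(1) F(2)
  proof (induction J rule: finite_induct)
    case empty
    then show ?case using g(1) by (auto simp: irreducible_def)
  next
    case (insert i J)
    then show ?case using irreducible_dvd_mult_poly3[OF g(1), of "F i" "prod F J"] by auto
  qed
  have fin: "finite ?Z" by (rule finite_common_zeros[OF g(1,2) nd fh])
  have Zp: "?Z \<subseteq> ppts" by (auto simp: common_zeros_def)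
  have "(0, 0, 0) \<notin> ?Z" using ppts_nonzero Zp by blast
  then obtain v where v: "\<And>p. p \<in> ?Z \<Longrightarrow> dot v p \<noteq> 0" using linear_form_avoiding[OF fin] by blast
  let ?t = "taylor v g"
  have ord: "?t p f \<noteq> 0 \<and> subdegree (?t p f) \<le> card J" if p: "p \<in> ?Z" for p
    unfolding f_def
  proof (rule taylor_prod_order[OF J(1)])
    fix i assume i: "i \<in> J"
    show "?t p (F i) \<noteq> 0 \<and> subdegree (?t p (F i)) \<le> 1"
    proof (cases "eval3 (F i) p = 0")
      case True
      have g0: "eval3 g p = 0" using p by (simp add: common_zeros_def)
      have "dot v (cross (grad (F i) p) (grad g p)) \<noteq> 0"
        by (rule dot_cross_nonzero[OF euler_grad[OF F(1)[OF i] True] euler_grad[OF g(2) g0] v[OF p] tr[OF i _ True g0]])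
           (use ppts_nonzero p Zp in blast)
      \<comment> \<open>The first Taylor coefficient is the determinant of \<open>v\<close> and the
        two gradients.\<close>
      then have "fps_nth (?t p (F i)) 1 \<noteq> 0"
        by (simp add: taylor_nth_Suc[of _ _ _ _ 0, simplified] taylor_nth_0 eval3_der)
      then show ?thesis using subdegree_leI by auto
    next
      case False
      then have "fps_nth (?t p (F i)) 0 \<noteq> 0" by (simp add: taylor_nth_0)
      then show ?thesis using subdegree_leI[of "?t p (F i)" 0] by auto
    qed
  qed
  define m where "m p = subdegree (?t p f)" for p
  have m: "m p \<ge> 1" "m p \<le> card J" "fps_nth (?t p f) (m p) \<noteq> 0" "\<And>i. i < m p \<Longrightarrow> fps_nth (?t p f) i = 0"
    if p: "p \<in> ?Z" for p
  proof -
    show a: "fps_nth (?t p f) (m p) \<noteq> 0" "m p \<le> card J" using ord[OF p] unfolding m_def by auto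
    show "\<And>i. i < m p \<Longrightarrow> fps_nth (?t p f) i = 0" unfolding m_def by (rule nth_less_subdegree_zero)
    have "fps_nth (?t p f) 0 = 0" using p by (simp add: taylor_nth_0 common_zeros_def)
    then show "m p \<ge> 1" using a by (cases "m p") auto
  qed
  have tder: "fps_nth (?t p (der v g f)) (m p - 1) \<noteq> 0" "\<And>i. i < m p - 1 \<Longrightarrow> fps_nth (?t p (der v g f)) i = 0"
    if p: "p \<in> ?Z" for p
    unfolding taylor_der[symmetric] using m[OF p] by auto
  obtain N where N: "\<And>n. n \<ge> N \<Longrightarrow> form n \<subseteq> jac g"
    using smooth_jac_contains_forms[OF g] by blast
  \<comment> \<open>The summands of the bound leave room for the forms in \<open>jac g\<close>, the
    complete intersection, the degree of \<open>der v g f\<close> and the separating forms.\<close>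
  have "codim ?P s \<le> int (d * e) - int (card ?Z)" if s: "s \<ge> N + d + e + (e - 1 + (d - 1)) + card ?Z * card J" for s
  proof -
    define r where "r = s - (e - 1 + (d - 1))"
    have "\<forall>p\<in>?Z. \<exists>L. homogeneous r L \<and> eval3 L p \<noteq> 0 \<and> (\<forall>q\<in>?Z. q \<noteq> p \<longrightarrow> (\<exists>w M. dot w q = 0 \<and> L = lin w ^ card J * M))"
    proof
      fix p assume p: "p \<in> ?Z"
      have "card ?Z * card J \<le> r" using s by (simp add: r_def)
      then obtain L where "homogeneous r L" "eval3 L p \<noteq> 0"
        "\<And>q. q \<in> ?Z \<Longrightarrow> q \<noteq> p \<Longrightarrow> \<exists>w M. dot w q = 0 \<and> L = lin w ^ card J * M"
        using separating_form[OF fin Zp p, of "card J" r] by blast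
      then show "\<exists>L. homogeneous r L \<and> eval3 L p \<noteq> 0 \<and> (\<forall>q\<in>?Z. q \<noteq> p \<longrightarrow> (\<exists>w M. dot w q = 0 \<and> L = lin w ^ card J * M))"
        by blast
    qed
    from bchoice[OF this] obtain L where L: "\<And>p. p \<in> ?Z \<Longrightarrow> homogeneous r (L p)" "\<And>p. p \<in> ?Z \<Longrightarrow> eval3 (L p) p \<noteq> 0"
      "\<And>p q. p \<in> ?Z \<Longrightarrow> q \<in> ?Z \<Longrightarrow> q \<noteq> p \<Longrightarrow> \<exists>w M. dot w q = 0 \<and> L p = lin w ^ card J * M" by blast
    have sub: "?I \<inter> form s \<subseteq> ?P \<inter> form s"
    proof
      fix h assume h: "h \<in> ?I \<inter> form s"
      obtain a b where ab: "h = a * f + b * g" "homogeneous (s - e) a"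
        by (rule ideal_gen_2_form[OF fh g(2) h]) (use s in auto)
      have "form (s - e) \<subseteq> jac g" using N s by simp
      then have "a \<in> jac g" using ab by (auto simp: form_def)
      then have "h \<in> ?P" unfolding ab(1)
        by (intro is_ideal_add[OF P] is_ideal_mult[OF P] polar_mem f_times_jac_in_polar[OF fh e1 g(2)])
      then show "h \<in> ?P \<inter> form s" using h by simp
    qed
    have "poly3.dim (?I \<inter> form s) + card ?Z \<le> poly3.dim (?P \<inter> form s)"
    proof (rule poly3.dim_add_card_le[where u = "\<lambda>p. L p * der v g f" and \<phi> = "\<lambda>p h. fps_nth (?t p h) (m p - 1)"
          and W = "mon ` monoset s"])
      show "poly3.subspace (?P \<inter> form s)" by (rule subspace_ideal_form[OF P])
      show "?P \<inter> form s \<subseteq> poly3.span (mon ` monoset s)" using form_span by blast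
      show "finite (mon ` monoset s)" by (rule finite_mon)
      show "poly3.subspace (?I \<inter> form s)" by (rule subspace_ideal_form[OF is_ideal_gen])
      show "?I \<inter> form s \<subseteq> ?P \<inter> form s" by (rule sub)
      show "finite ?Z" by (rule fin)
    next
      fix p assume p: "p \<in> ?Z"
      have "homogeneous (r + (e - 1 + (d - 1))) (L p * der v g f)"
        by (intro homogeneous_mult L(1) p homogeneous_der fh g(2))
      then show "L p * der v g f \<in> ?P \<inter> form s"
        using is_ideal_mult[OF P der_in_polar] s by (simp add: r_def form_def)
    next
      fix p x y
      show "fps_nth (?t p (x + y)) (m p - 1) = fps_nth (?t p x) (m p - 1) + fps_nth (?t p y) (m p - 1)"
        by (simp add: taylor_add)
    next
      fix p c x
      show "fps_nth (?t p (cst c * x)) (m p - 1) = c * fps_nth (?t p x) (m p - 1)"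
        by (simp add: taylor_mult taylor_cst)
    next
      fix p x assume p: "p \<in> ?Z" and "x \<in> ?I \<inter> form s"
      then obtain a b where x: "x = a * f + b * g" by (auto simp: ideal_gen_2)
      have "?t p x = ?t p a * ?t p f" using p by (simp add: x taylor_add taylor_mult taylor_self common_zeros_def)
      then show "fps_nth (?t p x) (m p - 1) = 0"
        using fps_nth_mult_eq_0(2)[of "m p - 1" "?t p f"] m[OF p] by simp
    next
      fix p assume p: "p \<in> ?Z"
      have "fps_nth (?t p (L p) * ?t p (der v g f)) (m p - 1)
          = (\<Sum>i\<in>{0..m p - 1}. fps_nth (?t p (L p)) i * fps_nth (?t p (der v g f)) (m p - 1 - i))"
        by (simp add: fps_mult_nth)
      also have "\<dots> = (\<Sum>i\<in>{0}. fps_nth (?t p (L p)) i * fps_nth (?t p (der v g f)) (m p - 1 - i))"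
        by (rule sum.mono_neutral_right) (use tder(2)[OF p] in auto)
      finally show "fps_nth (?t p (L p * der v g f)) (m p - 1) \<noteq> 0"
        using L(2)[OF p] tder(1)[OF p] by (simp add: taylor_mult taylor_nth_0)
    next
      fix q p assume p: "q \<in> ?Z" "p \<in> ?Z" "q \<noteq> p"
      obtain w M where w: "dot w q = 0" "L p = lin w ^ card J * M" using L(3)[OF p(2,1,3)] by blast
      \<comment> \<open>\<open>lin w\<close> vanishes at \<open>q\<close>, so its power has order at
        least \<open>card J\<close>, which exceeds \<open>m q - 1\<close> because \<open>m q\<close>
        lies between 1 and \<open>card J\<close>.\<close>
      have "fps_nth (?t q (lin w) ^ card J) j = 0" if "j \<le> m q - 1" for j
        using startsby_zero_power_prefix[of "?t q (lin w)" "card J"] that m(1,2)[OF p(1)] w by (simp add: taylor_nth_0)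
      from fps_nth_mult_eq_0(1)[OF this, of "m q - 1" "?t q M * ?t q (der v g f)"]
      show "fps_nth (?t q (L p * der v g f)) (m q - 1) = 0"
        unfolding w(2) by (simp add: taylor_mult taylor_power mult.assoc)
    qed
    then have "codim ?P s \<le> codim ?I s - int (card ?Z)" unfolding codim_def by linarith
    moreover have "codim ?I s = int (d * e)" by (rule codim_complete_intersection[OF g(1,2) nd fh]) (use s in simp)
    ultimately show ?thesis by simp
  qed
  then show ?thesis unfolding f_def e_def by blast
qed

subsection \<open>The Jacobian ideal of a transversal arrangement\<close>

text \<open>Split the degree \<open>s\<close> part \<open>V\<close> of the Jacobian ideal along the
  multiples \<open>F\<close> of \<open>f\<close>. Modulo \<open>F\<close>, \<open>g\<close> times a
  partial of \<open>f\<close> is a partial of \<open>f * g\<close>, so V + F contains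
  \<open>g\<close> times \<open>jac f\<close>. Inside \<open>F\<close>, \<open>V\<close> contains
  \<open>f\<close> times the polar ideal. The term \<open>d * e\<close> is the complete intersection
  count for multiples of \<open>f\<close> and of \<open>g\<close>.\<close>

lemma codim_jac_mult:
  assumes g: "irreducible g" "homogeneous d g" "d \<ge> 1" and f: "homogeneous e f" "e \<ge> 1" "\<not> g dvd f" and s: "d + e \<le> s"
  shows "codim (jac (f * g)) s \<le> int (d * e) + codim (jac f) (s - d) + codim (polar_ideal f g) (s - e)"
proof -
  have f0: "f \<noteq> 0" and g0: "g \<noteq> 0" using f g by (auto simp: irreducible_def)
  have J: "is_ideal (jac (f * g))" by (rule is_ideal_jac)
  have fg: "homogeneous (e + d) (f * g)" by (rule homogeneous_mult[OF f(1) g(2)])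
  let ?V = "jac (f * g) \<inter> form s" and ?F = "(*) f ` form (s - e)" and ?A = "jac f \<inter> form (s - d)"
  let ?G = "(*) g ` ?A" and ?P = "polar_ideal f g \<inter> form (s - e)"
  have V: "poly3.subspace ?V" "?V \<subseteq> form s" using subspace_ideal_form[OF J] by auto
  have F: "poly3.subspace ?F" "?F \<subseteq> form s" "poly3.dim ?F = hf (s - e)"
    using subspace_mult[OF subspace_form] mult_form[OF f(1) subset_refl, of "s - e"] s
      dim_mult[OF subspace_form subset_refl f0] dim_form by auto
  have A: "poly3.subspace ?A" by (rule subspace_ideal_form[OF is_ideal_jac])
  have G: "poly3.subspace ?G" "?G \<subseteq> form s" "poly3.dim ?G = poly3.dim ?A"
    using subspace_mult[OF A] mult_form[OF g(2), of ?A "s - d"] s dim_mult[OF A _ g0, of "s - d"] by auto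
  have P: "poly3.subspace ?P" by (rule subspace_ideal_form[OF is_ideal_polar])
  have dfg: "dx (f * g) = dx f * g + f * dx g" "dy (f * g) = dy f * g + f * dy g" "dz (f * g) = dz f * g + f * dz g"
    by (rule d_mult)+
  have GVF: "?G \<subseteq> {x + y |x y. x \<in> ?V \<and> y \<in> ?F}"
  proof
    fix p assume "p \<in> ?G"
    then obtain h where h: "p = g * h" "h \<in> ?A" by auto
    obtain a b c where abc: "h = a * dx f + b * dy f + c * dz f" "homogeneous (s - d - (e - 1)) a"
      "homogeneous (s - d - (e - 1)) b" "homogeneous (s - d - (e - 1)) c"
      by (rule ideal_gen_3_form[OF homogeneous_d[OF f(1)] h(2)[unfolded jac_def]]) (use s in auto)
    define w where "w = a * dx (f * g) + b * dy (f * g) + c * dz (f * g)"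
    have "homogeneous ((s - d - (e - 1)) + (e + d - 1)) w" unfolding w_def
      by (intro homogeneous_add homogeneous_mult abc homogeneous_d fg)
    moreover have "(s - d - (e - 1)) + (e + d - 1) = s" using s f(2) g(3) by simp
    ultimately have "w \<in> form s" by (simp add: form_def)
    moreover have "w \<in> jac (f * g)" unfolding w_def
      by (intro is_ideal_add[OF J] is_ideal_mult[OF J] jac_mem)
    ultimately have "w \<in> ?V" by simp
    have "homogeneous ((s - d - (e - 1)) + (d - 1)) (- (a * dx g + b * dy g + c * dz g))"
      by (intro homogeneous_add homogeneous_mult abc homogeneous_d g homogeneous_uminus)
    moreover have "(s - d - (e - 1)) + (d - 1) = s - e" using s f(2) g(3) by simp
    ultimately have "f * - (a * dx g + b * dy g + c * dz g) \<in> ?F" by (simp add: form_def)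
    moreover have "p = w + f * - (a * dx g + b * dy g + c * dz g)"
      unfolding h(1) abc(1) w_def dfg by (simp add: algebra_simps)
    ultimately show "p \<in> {x + y |x y. x \<in> ?V \<and> y \<in> ?F}" using \<open>w \<in> ?V\<close> by blast
  qed
  have "{x + y |x y. x \<in> ?G \<and> y \<in> ?F} \<subseteq> {x + y |x y. x \<in> ?V \<and> y \<in> ?F}"
  proof
    fix p assume "p \<in> {x + y |x y. x \<in> ?G \<and> y \<in> ?F}"
    then obtain x y where xy: "p = x + y" "x \<in> ?G" "y \<in> ?F" by blast
    obtain x' y' where x': "x = x' + y'" "x' \<in> ?V" "y' \<in> ?F" using GVF xy(2) by blast
    have "y' + y \<in> ?F" by (rule poly3.subspace_add[OF F(1) x'(3) xy(3)])
    moreover have "p = x' + (y' + y)" using xy x' by (simp add: add.assoc)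
    ultimately show "p \<in> {x + y |x y. x \<in> ?V \<and> y \<in> ?F}" using x'(2) by blast
  qed
  moreover have "{x + y |x y. x \<in> ?V \<and> y \<in> ?F} \<subseteq> form s"
    using V(2) F(2) by (auto simp: form_def intro!: homogeneous_add)
  ultimately have 1: "poly3.dim {x + y |x y. x \<in> ?G \<and> y \<in> ?F} \<le> poly3.dim {x + y |x y. x \<in> ?V \<and> y \<in> ?F}"
    by (rule dim_mono_form)
  have "polar_ideal f g \<subseteq> {p. f * p \<in> jac (f * g)}" unfolding polar_ideal_def
  proof (rule ideal_gen_minimal)
    show "is_ideal {p. f * p \<in> jac (f * g)}"
      using is_ideal_0[OF J] is_ideal_add[OF J] is_ideal_mult[OF J]
      by (auto simp: is_ideal_def distrib_left mult.left_commute)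
    have "f * g \<in> jac (f * g)" using euler_jac[OF fg] f(2) by simp
    \<comment> \<open>\<open>f\<close> times a minor of the gradients of \<open>f\<close> and
      \<open>g\<close> is the same minor for \<open>f\<close> and \<open>f * g\<close>, a
      combination of partials of \<open>f * g\<close>.\<close>
    moreover have "f * (dy f * dz g - dz f * dy g) = dy f * dz (f * g) - dz f * dy (f * g)"
      "f * (dz f * dx g - dx f * dz g) = dz f * dx (f * g) - dx f * dz (f * g)"
      "f * (dx f * dy g - dy f * dx g) = dx f * dy (f * g) - dy f * dx (f * g)"
      unfolding dfg by (simp_all add: algebra_simps)
    ultimately show "set [g, dy f * dz g - dz f * dy g, dz f * dx g - dx f * dz g, dx f * dy g - dy f * dx g] \<subseteq> {p. f * p \<in> jac (f * g)}"
      using is_ideal_diff[OF J] is_ideal_mult[OF J] jac_mem[of "f * g"] by simp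
  qed
  then have "(*) f ` ?P \<subseteq> ?V \<inter> ?F"
    using mult_form[OF f(1) subset_refl, of "s - e"] s by auto
  then have "poly3.dim ((*) f ` ?P) \<le> poly3.dim (?V \<inter> ?F)" using V(2) by (intro dim_mono_form[of _ _ s]) auto
  then have 2: "poly3.dim ?P \<le> poly3.dim (?V \<inter> ?F)" using dim_mult[OF P _ f0, of "s - e"] by simp
  have fg0: "f * g \<noteq> 0" using f0 g0 poly3_mult_eq_0_iff by simp
  have "?G \<inter> ?F \<subseteq> (*) (f * g) ` form (s - d - e)"
  proof
    fix p assume "p \<in> ?G \<inter> ?F"
    then obtain a b where ab: "p = g * a" "p = f * b" "homogeneous (s - e) b" unfolding form_def by blast
    then have "g dvd f * b" by (metis dvd_triv_left)
    then obtain c where c: "b = g * c" using irreducible_dvd_mult_poly3[OF g(1), of f b] f(3) by (auto elim: dvdE)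
    have "homogeneous (s - d - e) c"
    proof (cases "c = 0")
      case False
      have "homogeneous (s - e - d) c"
        using homogeneous_cofactor(2)[OF g(2) g0 _ False, of "s - e"] ab c by simp
      moreover have "s - e - d = s - d - e" by simp
      ultimately show ?thesis by metis
    qed simp
    moreover have "p = f * g * c" using ab(2) c by (simp add: mult.assoc)
    ultimately show "p \<in> (*) (f * g) ` form (s - d - e)" unfolding form_def by blast
  qed
  moreover have "(*) (f * g) ` form (s - d - e) \<subseteq> form s"
    using mult_form[OF fg subset_refl, of "s - d - e"] s by simp
  ultimately have "poly3.dim (?G \<inter> ?F) \<le> poly3.dim ((*) (f * g) ` form (s - d - e))"
    by (rule dim_mono_form)
  then have 3: "poly3.dim (?G \<inter> ?F) \<le> hf (s - d - e)"
    using dim_mult[OF subspace_form subset_refl fg0, of "s - d - e"] dim_form by simp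
  have "poly3.dim {x + y |x y. x \<in> ?V \<and> y \<in> ?F} + poly3.dim (?V \<inter> ?F) = poly3.dim ?V + hf (s - e)"
    using dim_sum_Int_form[OF V F(1,2)] F(3) by simp
  moreover have "poly3.dim {x + y |x y. x \<in> ?G \<and> y \<in> ?F} + poly3.dim (?G \<inter> ?F) = poly3.dim ?A + hf (s - e)"
    using dim_sum_Int_form[OF G(1,2) F(1,2)] F(3) G(3) by simp
  ultimately have "codim (jac (f * g)) s \<le> int (hf s) + int (hf (s - d - e)) - int (hf (s - d)) - int (hf (s - e))
      + codim (jac f) (s - d) + codim (polar_ideal f g) (s - e)"
    using 1 2 3 unfolding codim_def by linarith
  moreover have "2 * (int (hf s) + int (hf (s - d - e)) - int (hf (s - d)) - int (hf (s - e))) = 2 * int (d * e)"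
    using hf_eq[of s] hf_eq[of "s - d - e"] hf_eq[of "s - e"] hf_eq[of "s - d"] s
    by (simp add: of_nat_diff algebra_simps)
  then have "int (hf s) + int (hf (s - d - e)) - int (hf (s - d)) - int (hf (s - e)) = int (d * e)" by simp
  ultimately show ?thesis by simp
qed

section \<open>Adding the curves one at a time\<close>

locale transversal_arrangement =
  fixes d k :: nat and F :: "nat \<Rightarrow> poly3"
  assumes d: "d \<ge> 1"
    and irr: "\<And>i. i < k \<Longrightarrow> irreducible (F i)" and hom: "\<And>i. i < k \<Longrightarrow> homogeneous d (F i)"
    and smooth: "\<And>i. i < k \<Longrightarrow> smooth_curve (F i)"
    and ndvd: "\<And>i j. i < k \<Longrightarrow> j < k \<Longrightarrow> i \<noteq> j \<Longrightarrow> \<not> F i dvd F j"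
    and tr: "\<And>i j p. i < k \<Longrightarrow> j < k \<Longrightarrow> i \<noteq> j \<Longrightarrow> p \<noteq> (0, 0, 0) \<Longrightarrow> eval3 (F i) p = 0 \<Longrightarrow> eval3 (F j) p = 0 \<Longrightarrow>
      cross (grad (F i) p) (grad (F j) p) \<noteq> (0, 0, 0)"
begin

text \<open>A point on m of the curves is new for all but the first of them, so the numbers of new
  points add up to the sum of m - 1 over all intersection points.\<close>

definition new_points :: "nat \<Rightarrow> point3 set" where
  "new_points j = common_zeros (\<Prod>i<j. F i) (F j)"

lemma new_points_eq: "new_points j = {p \<in> ppts. eval3 (F j) p = 0 \<and> (\<exists>i<j. eval3 (F i) p = 0)}"
  unfolding new_points_def common_zeros_def by (auto simp: eval3_prod)

lemma codim_jac_arrangement: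
  assumes "1 \<le> j" "j \<le> k"
  shows "\<exists>s0. \<forall>s\<ge>s0. codim (jac (\<Prod>i<j. F i)) s \<le> int (d * d * (j * (j - 1))) - int (\<Sum>i<j. card (new_points i))"
  using assms
proof (induction j rule: nat_induct_at_least)
  case base
  have k0: "0 < k" using base by simp
  obtain N where N: "\<And>n. n \<ge> N \<Longrightarrow> form n \<subseteq> jac (F 0)"
    using smooth_jac_contains_forms[OF irr[OF k0] hom[OF k0] d smooth[OF k0]] by blast
  have "new_points 0 = {}" by (auto simp: new_points_eq)
  moreover have "codim (jac (F 0)) s = 0" if "s \<ge> N" for s
    using N[OF that] by (simp add: codim_def dim_form Int_absorb1)
  ultimately show ?case by (intro exI[of _ N]) simp
next
  case (Suc j)
  let ?f = "\<Prod>i<j. F i"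
  have j: "j < k" "j \<ge> 1" using Suc by auto
  obtain s1 where s1: "\<And>s. s \<ge> s1 \<Longrightarrow> codim (jac ?f) s \<le> int (d * d * (j * (j - 1))) - int (\<Sum>i<j. card (new_points i))"
    using Suc.IH j by auto
  have "0 \<in> {..<j}" using j by simp
  then have J: "finite {..<j}" "{..<j} \<noteq> {}" by (simp, blast)
  have "\<exists>s0. \<forall>s\<ge>s0. codim (polar_ideal ?f (F j)) s \<le> int (d * (card {..<j} * d)) - int (card (common_zeros ?f (F j)))"
    by (rule codim_polar_ideal[OF irr hom d smooth J]) (use j hom ndvd tr in auto)
  then obtain s2 where s2: "\<And>s. s \<ge> s2 \<Longrightarrow> codim (polar_ideal ?f (F j)) s \<le> int (d * (j * d)) - int (card (new_points j))"
    by (auto simp: new_points_def)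
  have hf: "homogeneous (j * d) ?f"
    using homogeneous_prod[of "{..<j}" d F] hom j by auto
  have nd: "\<not> F j dvd ?f"
  proof -
    have "i \<le> j \<Longrightarrow> \<not> F j dvd (\<Prod>i<i. F i)" for i
    proof (induction i)
      case 0
      then show ?case using irr[OF j(1)] by (auto simp: irreducible_def)
    next
      case (Suc i)
      then show ?case using irreducible_dvd_mult_poly3[OF irr[OF j(1)], of "\<Prod>i<i. F i" "F i"] ndvd[of j i] j by auto
    qed
    then show ?thesis by simp
  qed
  have "codim (jac (\<Prod>i<Suc j. F i)) s \<le> int (d * d * (Suc j * (Suc j - 1))) - int (\<Sum>i<Suc j. card (new_points i))"
    if s: "s \<ge> s1 + s2 + d + j * d" for s
  proof -
    have "codim (jac (?f * F j)) s \<le> int (d * (j * d)) + codim (jac ?f) (s - d) + codim (polar_ideal ?f (F j)) (s - j * d)"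
      by (rule codim_jac_mult[OF irr[OF j(1)] hom[OF j(1)] d hf _ nd]) (use s j d in auto)
    also have "codim (jac ?f) (s - d) \<le> int (d * d * (j * (j - 1))) - int (\<Sum>i<j. card (new_points i))"
      by (rule s1) (use s in simp)
    also have "codim (polar_ideal ?f (F j)) (s - j * d) \<le> int (d * (j * d)) - int (card (new_points j))"
      by (rule s2) (use s in simp)
    finally have "codim (jac (?f * F j)) s \<le> int (d * (j * d)) + (int (d * d * (j * (j - 1))) - int (\<Sum>i<j. card (new_points i)))
      + (int (d * (j * d)) - int (card (new_points j)))" by simp
    \<comment> \<open>One summand \<open>d * (j * d)\<close> comes from the product formula and one
      from the polar ideal; together they turn j (j - 1) into (j + 1) j.\<close>
    moreover have "d * (j * d) + d * d * (j * (j - 1)) + d * (j * d) = d * d * (Suc j * (Suc j - 1))"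
      using j by (cases j) (auto simp: algebra_simps)
    then have "int (d * (j * d)) + int (d * d * (j * (j - 1))) + int (d * (j * d)) = int (d * d * (Suc j * (Suc j - 1)))"
      by (metis of_nat_add)
    ultimately show ?thesis by simp
  qed
  then show ?case by blast
qed

text \<open>Count ordered pairs of distinct curves together with a common point. Each pair has at
  least \<open>d * d\<close> points by Bezout, and a point on m curves is counted m (m - 1) times,
  at most 4 (m - 1) as m is at most 4.\<close>

lemma card_new_points:
  assumes mult: "\<And>p. p \<noteq> (0, 0, 0) \<Longrightarrow> card {i. i < k \<and> eval3 (F i) p = 0} < 5"
  shows "d * d * (k * (k - 1)) \<le> 4 * (\<Sum>j<k. card (new_points j))"
proof -
  let ?Q = "{(i, j). i < k \<and> j < k \<and> i \<noteq> j}"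
  let ?M = "\<lambda>p. {i. i < k \<and> eval3 (F i) p = 0}"
  let ?cz = "\<lambda>q. common_zeros (F (fst q)) (F (snd q))"
  have Q: "?Q = ({..<k} \<times> {..<k}) - (\<lambda>i. (i, i)) ` {..<k}" by auto
  have finQ: "finite ?Q" unfolding Q by auto
  have card_offdiag: "card {q \<in> A \<times> A. fst q \<noteq> snd q} = card A * (card A - 1)" if "finite A" for A :: "nat set"
  proof -
    have "{q \<in> A \<times> A. fst q \<noteq> snd q} = A \<times> A - (\<lambda>i. (i, i)) ` A" by auto
    moreover have "card ((\<lambda>i. (i, i)) ` A) = card A" by (rule card_image) (auto simp: inj_on_def)
    ultimately show ?thesis using that by (simp add: card_Diff_subset image_subset_iff diff_mult_distrib2)
  qed
  have "?Q = {q \<in> {..<k} \<times> {..<k}. fst q \<noteq> snd q}" by auto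
  then have cQ: "card ?Q = k * (k - 1)" using card_offdiag[of "{..<k}"] by simp
  have fincz: "finite (?cz q)" and cz: "d * d \<le> card (?cz q)" if qQ: "q \<in> ?Q" for q
  proof -
    obtain i j where q: "q = (i, j)" "i < k" "j < k" "i \<noteq> j" using qQ by auto
    show "finite (?cz q)" unfolding q fst_conv snd_conv
      by (rule finite_common_zeros[OF irr[OF q(3)] hom[OF q(3)] ndvd[OF q(3,2)] hom[OF q(2)]]) (use q in simp)
    show "d * d \<le> card (?cz q)" unfolding q fst_conv snd_conv
      by (rule bezout_transversal[OF irr[OF q(3)] hom[OF q(3)] ndvd[OF q(3,2)] hom[OF q(2)] d d])
         (use q tr in auto)
  qed
  define P where "P = (\<Union>q\<in>?Q. ?cz q)"
  have finP: "finite P" unfolding P_def using finQ fincz by blast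
  have Pp: "P \<subseteq> ppts" by (auto simp: P_def common_zeros_def)
  have "d * d * (k * (k - 1)) = (\<Sum>q\<in>?Q. d * d)" using cQ by simp
  also have "\<dots> \<le> (\<Sum>q\<in>?Q. card (?cz q))" by (rule sum_mono) (rule cz)
  also have "\<dots> = (\<Sum>q\<in>?Q. card {p \<in> P. p \<in> ?cz q})"
  proof (rule sum.cong)
    fix q assume "q \<in> ?Q"
    then have "?cz q \<subseteq> P" unfolding P_def by blast
    then show "card (?cz q) = card {p \<in> P. p \<in> ?cz q}" by (intro arg_cong[of _ _ card]) blast
  qed simp
  also have "\<dots> = (\<Sum>p\<in>P. card {q \<in> ?Q. p \<in> ?cz q})"
    by (rule sum_multicount_gen[OF finQ finP]) simp
  also have "\<dots> \<le> (\<Sum>p\<in>P. 4 * card {j \<in> {..<k}. p \<in> new_points j})"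
  proof (rule sum_mono)
    fix p assume p: "p \<in> P"
    then have pp: "p \<in> ppts" using Pp by auto
    have finM: "finite (?M p)" by auto
    have "{q \<in> ?Q. p \<in> ?cz q} = {q \<in> ?M p \<times> ?M p. fst q \<noteq> snd q}" using pp by (auto simp: common_zeros_def)
    then have 1: "card {q \<in> ?Q. p \<in> ?cz q} = card (?M p) * (card (?M p) - 1)" using card_offdiag[OF finM] by simp
    have ne: "?M p \<noteq> {}" using p by (auto simp: P_def common_zeros_def)
    have "{j \<in> {..<k}. p \<in> new_points j} = ?M p - {Min (?M p)}"
    proof (intro set_eqI iffI)
      fix j assume "j \<in> {j \<in> {..<k}. p \<in> new_points j}"
      then obtain i where ij: "j < k" "eval3 (F j) p = 0" "i < j" "eval3 (F i) p = 0" by (auto simp: new_points_eq)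
      then have "Min (?M p) \<le> i" by (intro Min_le) auto
      then have "j \<noteq> Min (?M p)" using ij(3) by linarith
      then show "j \<in> ?M p - {Min (?M p)}" using ij(1,2) by blast
    next
      fix j assume j: "j \<in> ?M p - {Min (?M p)}"
      then have "Min (?M p) \<le> j" "j \<noteq> Min (?M p)" by (intro Min_le[OF finM], blast, blast)
      then have "Min (?M p) < j" by linarith
      moreover have "eval3 (F (Min (?M p))) p = 0" using Min_in[OF finM ne] by simp
      ultimately show "j \<in> {j \<in> {..<k}. p \<in> new_points j}" using j pp by (auto simp: new_points_eq)
    qed
    then have 2: "card {j \<in> {..<k}. p \<in> new_points j} = card (?M p) - 1"
      using Min_in[OF finM ne] by simp
    have "card (?M p) \<le> 4" using mult[of p] ppts_nonzero[OF pp] by simp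
    then show "card {q \<in> ?Q. p \<in> ?cz q} \<le> 4 * card {j \<in> {..<k}. p \<in> new_points j}"
      unfolding 1 2 by (rule mult_le_mono1)
  qed
  also have "\<dots> = 4 * (\<Sum>p\<in>P. card {j \<in> {..<k}. p \<in> new_points j})" by (simp add: sum_distrib_left)
  also have "(\<Sum>p\<in>P. card {j \<in> {..<k}. p \<in> new_points j}) = (\<Sum>j<k. card {p \<in> P. p \<in> new_points j})"
    by (rule sum_multicount_gen[OF finP]) simp_all
  also have "(\<Sum>j<k. card {p \<in> P. p \<in> new_points j}) = (\<Sum>j<k. card (new_points j))"
  proof (rule sum.cong)
    fix j assume "j \<in> {..<k}"
    have "new_points j \<subseteq> P"
    proof
      fix p assume "p \<in> new_points j"
      then obtain i where "p \<in> ppts" "eval3 (F j) p = 0" "i < j" "eval3 (F i) p = 0" by (auto simp: new_points_eq)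
      then have "(i, j) \<in> ?Q" "p \<in> ?cz (i, j)" using \<open>j \<in> {..<k}\<close> by (auto simp: common_zeros_def)
      then show "p \<in> P" unfolding P_def by blast
    qed
    then show "card {p \<in> P. p \<in> new_points j} = card (new_points j)"
      by (intro arg_cong[of _ _ card]) auto
  qed simp
  finally show ?thesis by simp
qed

end

section \<open>From distinct tangents to independent gradients\<close>

lemma cross_eq_0_imp:
  assumes "cross a b = (0, 0, 0)" "a \<noteq> (0, 0, 0)" "dot a u = 0"
  shows "dot b u = 0"
proof -
  obtain a1 a2 a3 b1 b2 b3 x y z where d: "a = (a1, a2, a3)" "b = (b1, b2, b3)" "u = (x, y, z)"
    by (cases a; cases b; cases u) auto
  have e: "a2 * b3 = a3 * b2" "a3 * b1 = a1 * b3" "a1 * b2 = a2 * b1" using assms(1) d by auto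
  have "a1 * (b1 * x + b2 * y + b3 * z) = b1 * (a1 * x + a2 * y + a3 * z) + (a1 * b2 - a2 * b1) * y - (a3 * b1 - a1 * b3) * z"
    "a2 * (b1 * x + b2 * y + b3 * z) = b2 * (a1 * x + a2 * y + a3 * z) - (a1 * b2 - a2 * b1) * x + (a2 * b3 - a3 * b2) * z"
    "a3 * (b1 * x + b2 * y + b3 * z) = b3 * (a1 * x + a2 * y + a3 * z) + (a3 * b1 - a1 * b3) * x - (a2 * b3 - a3 * b2) * y"
    by (simp_all add: algebra_simps)
  then show ?thesis using e assms(2,3) d by auto
qed

text \<open>Smoothness makes both gradients nonzero at p. Parallel nonzero gradients have the same
  orthogonal complement, which is the tangent line.\<close>

lemma tangent_lines_differ_imp_transversal:
  assumes "smooth_curve f" "smooth_curve g" "p \<noteq> (0, 0, 0)" "eval3 f p = 0" "eval3 g p = 0"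
    and "tangent_line f p \<noteq> tangent_line g p"
  shows "cross (grad f p) (grad g p) \<noteq> (0, 0, 0)"
proof
  assume c: "cross (grad f p) (grad g p) = (0, 0, 0)"
  have "grad f p \<noteq> (0, 0, 0)" "grad g p \<noteq> (0, 0, 0)"
    using assms(1-5) unfolding smooth_curve_def grad_def prod.inject by blast+
  moreover have "cross (grad g p) (grad f p) = (0, 0, 0)" using c by (auto simp: grad_def mult.commute)
  ultimately have "dot (grad f p) u = 0 \<longleftrightarrow> dot (grad g p) u = 0" for u
    using c cross_eq_0_imp by blast
  then have "{u. dot (grad f p) u = 0} = {u. dot (grad g p) u = 0}" by blast
  moreover have "tangent_line h p = {u. dot (grad h p) u = 0}" for h
    by (auto simp: tangent_line_def grad_def)
  ultimately show False using assms(6) by (simp only: not_True_eq_False)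
qed

lemma d_arrangement_transversal:
  assumes "d_arrangement d k F"
  shows "transversal_arrangement d k F"
proof -
  have a: "d \<ge> 1" "\<And>i. i < k \<Longrightarrow> homogeneous d (F i) \<and> irreducible (F i) \<and> smooth_curve (F i)"
    "\<And>i j. i < k \<Longrightarrow> j < k \<Longrightarrow> i \<noteq> j \<Longrightarrow> \<not> F i dvd F j"
    "\<And>i j q. q \<noteq> (0, 0, 0) \<Longrightarrow> i < k \<Longrightarrow> j < k \<Longrightarrow> i \<noteq> j \<Longrightarrow> eval3 (F i) q = 0 \<Longrightarrow> eval3 (F j) q = 0 \<Longrightarrow>
      tangent_line (F i) q \<noteq> tangent_line (F j) q"
    using assms unfolding d_arrangement_def by blast+
  show ?thesis
  proof
    fix i j p assume "i < k" "j < k" "i \<noteq> j" "p \<noteq> (0, 0, 0)" "eval3 (F i) p = 0" "eval3 (F j) p = 0"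
    then show "cross (grad (F i) p) (grad (F j) p) \<noteq> (0, 0, 0)"
      using a(2)[of i] a(2)[of j] a(4)[of p i j] tangent_lines_differ_imp_transversal[of "F i" "F j" p] by blast
  qed (use a in blast)+
qed

subsection \<open>Free curves\<close>

type_synonym triple = "poly3 \<times> poly3 \<times> poly3"

fun tscale :: "complex \<Rightarrow> triple \<Rightarrow> triple" where
  "tscale c (p, q, r) = (cst c * p, cst c * q, cst c * r)"

lemma vector_space_triple: "vector_space tscale"
  by unfold_locales (auto simp: algebra_simps)

interpretation triple: vector_space tscale
  by (rule vector_space_triple)

interpretation poly3_triple: vector_space_pair "\<lambda>c (p :: poly3). cst c * p" tscale
  by unfold_locales

interpretation triple_poly3: vector_space_pair tscale "\<lambda>c (p :: poly3). cst c * p"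
  by unfold_locales

lemma linear_to_triple:
  "Vector_Spaces.linear (\<lambda>c (p :: poly3). cst c * p) tscale (\<lambda>s. (s * a, s * b, s * c))"
  unfolding Vector_Spaces.linear_iff using poly3.vector_space_axioms triple.vector_space_axioms
  by (simp add: distrib_right mult.assoc)

lemma linear_from_triple:
  "Vector_Spaces.linear tscale (\<lambda>c (p :: poly3). cst c * p) (\<lambda>(p, q, r). p * a + q * b + r * c)"
  unfolding Vector_Spaces.linear_iff using poly3.vector_space_axioms triple.vector_space_axioms
  by (auto simp: ring_distribs mult.assoc)

text \<open>Rank-nullity for the map from triples of forms of degree \<open>n\<close> given by the
  generators. The image contains the ideal in degree \<open>n + m\<close>, the kernel contains the
  independent multiples of the two syzygies, and these inclusions suffice for an upper
  bound.\<close>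

lemma dim_syzygies_le:
  assumes r1: "homogeneous d1 r11" "homogeneous d1 r12" "homogeneous d1 r13"
    and r2: "homogeneous d2 r21" "homogeneous d2 r22" "homogeneous d2 r23"
    and g: "homogeneous m g1" "homogeneous m g2" "homogeneous m g3"
    and ker: "{(a, b, c). a * g1 + b * g2 + c * g3 = 0} =
      {(s * r11 + t * r21, s * r12 + t * r22, s * r13 + t * r23) |s t. True}"
    and inj: "\<And>s t. (s * r11 + t * r21, s * r12 + t * r22, s * r13 + t * r23) = (0, 0, 0) \<Longrightarrow> s = 0 \<and> t = 0"
    and n: "d1 \<le> n" "d2 \<le> n"
  shows "poly3.dim (ideal_gen [g1, g2, g3] \<inter> form (n + m)) + hf (n - d1) + hf (n - d2) \<le> 3 * hf n"
proof -
  let ?V = "form n \<times> form n \<times> form n"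
  let ?L = "\<lambda>(p, q, r). p * g1 + q * g2 + r * g3"
  \<comment> \<open>The products with 1 and 0 match the shape of \<open>linear_to_triple\<close>, so
    that \<open>img\<close> applies to each coordinate.\<close>
  define W :: "triple set" where "W = (\<lambda>s. (s * 1, s * 0, s * 0)) ` (mon ` monoset n) \<union> (\<lambda>s. (s * 0, s * 1, s * 0)) ` (mon ` monoset n)
      \<union> (\<lambda>s. (s * 0, s * 0, s * 1)) ` (mon ` monoset n)"
  have finW: "finite W" unfolding W_def using finite_mon by blast
  have img: "(s * a, s * b, s * c) \<in> triple.span ((\<lambda>s. (s * a, s * b, s * c)) ` (mon ` monoset n))" if "s \<in> form n" for s a b c
    using form_span that unfolding poly3_triple.linear_span_image[OF linear_to_triple] by blast
  have VW: "?V \<subseteq> triple.span W"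
  proof safe
    fix a b c assume abc: "a \<in> form n" "b \<in> form n" "c \<in> form n"
    have 1: "(a * 1, a * 0, a * 0) \<in> triple.span W"
      by (rule subsetD[OF triple.span_mono img[OF abc(1)]]) (auto simp: W_def)
    have 2: "(b * 0, b * 1, b * 0) \<in> triple.span W"
      by (rule subsetD[OF triple.span_mono img[OF abc(2)]]) (auto simp: W_def)
    have 3: "(c * 0, c * 0, c * 1) \<in> triple.span W"
      by (rule subsetD[OF triple.span_mono img[OF abc(3)]]) (auto simp: W_def)
    from triple.span_add[OF triple.span_add[OF 1 2] 3]
    show "(a, b, c) \<in> triple.span W" by simp
  qed
  have cm: "card (mon ` monoset n) \<le> hf n" using card_image_le[OF finite_monoset] card_monoset by metis
  have "card W \<le> card (mon ` monoset n) + card (mon ` monoset n) + card (mon ` monoset n)"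
    unfolding W_def by (intro order_trans[OF card_Un_le] add_mono card_image_le finite_mon)
  then have "card W \<le> 3 * hf n" using cm by linarith
  then have dV: "triple.dim ?V \<le> 3 * hf n" using triple.dim_le_card[OF VW finW] by linarith
  have subV: "triple.subspace ?V" unfolding triple.subspace_def
    by (auto simp: form_def zero_prod_def intro: homogeneous_add homogeneous_cst_mult)
  have "ideal_gen [g1, g2, g3] \<inter> form (n + m) \<subseteq> ?L ` ?V"
  proof
    fix p assume "p \<in> ideal_gen [g1, g2, g3] \<inter> form (n + m)"
    from ideal_gen_3_form[OF g this]
    obtain a b c where "p = a * g1 + b * g2 + c * g3" "homogeneous n a" "homogeneous n b" "homogeneous n c" by auto
    then have "p = ?L (a, b, c)" "(a, b, c) \<in> ?V" by (auto simp: form_def)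
    then show "p \<in> ?L ` ?V" by blast
  qed
  moreover have "?L ` ?V \<subseteq> form (n + m)"
    using g by (auto simp: form_def intro!: homogeneous_add homogeneous_mult)
  ultimately have 1: "poly3.dim (ideal_gen [g1, g2, g3] \<inter> form (n + m)) \<le> poly3.dim (?L ` ?V)"
    by (rule dim_mono_form)
  have 2: "triple.dim ?V = poly3.dim (?L ` ?V) + triple.dim (?V \<inter> {x. ?L x = 0})"
    by (rule triple_poly3.rank_nullity[OF linear_from_triple subV VW finW])
  let ?f1 = "\<lambda>s. (s * r11, s * r12, s * r13)" and ?f2 = "\<lambda>s. (s * r21, s * r22, s * r23)"
  let ?A = "?f1 ` form (n - d1)" and ?B = "?f2 ` form (n - d2)"
  have A: "triple.subspace ?A" and B: "triple.subspace ?B"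
    by (rule poly3_triple.linear_subspace_image[OF linear_to_triple subspace_form])+
  have dA: "triple.dim ?A = hf (n - d1)" unfolding dim_form[symmetric]
  proof (rule poly3_triple.dim_image_inj_on[OF linear_to_triple subspace_form form_span finite_mon])
    fix s assume "?f1 s = 0"
    then have "(s * r11 + 0 * r21, s * r12 + 0 * r22, s * r13 + 0 * r23) = (0, 0, 0)" by (simp add: zero_prod_def)
    then show "s = 0" using inj by blast
  qed
  have dB: "triple.dim ?B = hf (n - d2)" unfolding dim_form[symmetric]
  proof (rule poly3_triple.dim_image_inj_on[OF linear_to_triple subspace_form form_span finite_mon])
    fix t assume "?f2 t = 0"
    then have "(0 * r11 + t * r21, 0 * r12 + t * r22, 0 * r13 + t * r23) = (0, 0, 0)" by (simp add: zero_prod_def)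
    then show "t = 0" using inj by blast
  qed
  have AV: "?A \<subseteq> ?V" and BV: "?B \<subseteq> ?V"
    using homogeneous_mult[of "n - d1" _ d1] homogeneous_mult[of "n - d2" _ d2] r1 r2 n by (auto simp: form_def)
  have AB: "?A \<inter> ?B = {0}"
  proof
    show "?A \<inter> ?B \<subseteq> {0}"
    proof
      fix x assume "x \<in> ?A \<inter> ?B"
      then obtain s t where st: "x = ?f1 s" "?f1 s = ?f2 t" by auto
      then have "(s * r11 + (- t) * r21, s * r12 + (- t) * r22, s * r13 + (- t) * r23) = (0, 0, 0)" by simp
      then have "s = 0" using inj by blast
      then show "x \<in> {0}" using st by (simp add: zero_prod_def)
    qed
    show "{0} \<subseteq> ?A \<inter> ?B" using triple.subspace_0 A B by auto
  qed
  have "triple.dim {x + y |x y. x \<in> ?A \<and> y \<in> ?B} + triple.dim (?A \<inter> ?B) = triple.dim ?A + triple.dim ?B"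
    by (rule triple.dim_sum_Int[OF A _ B _ finW]) (use AV BV VW in blast)+
  then have 3: "hf (n - d1) + hf (n - d2) \<le> triple.dim {x + y |x y. x \<in> ?A \<and> y \<in> ?B}"
    unfolding AB dA dB using triple.dim_le_card[of "{0}" "{}"] by simp
  have "{x + y |x y. x \<in> ?A \<and> y \<in> ?B} \<subseteq> ?V \<inter> {x. ?L x = 0}"
  proof
    fix w assume "w \<in> {x + y |x y. x \<in> ?A \<and> y \<in> ?B}"
    then obtain x y where xy: "w = x + y" "x \<in> ?A" "y \<in> ?B" by blast
    then have "w \<in> ?V" using triple.subspace_add[OF subV] AV BV by blast
    moreover obtain s t where "w = (s * r11 + t * r21, s * r12 + t * r22, s * r13 + t * r23)" using xy by auto
    then have "w \<in> {(a, b, c). a * g1 + b * g2 + c * g3 = 0}" unfolding ker by blast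
    ultimately show "w \<in> ?V \<inter> {x. ?L x = 0}" by auto
  qed
  then have "triple.dim {x + y |x y. x \<in> ?A \<and> y \<in> ?B} \<le> triple.dim (?V \<inter> {x. ?L x = 0})"
    by (rule triple.dim_mono_fin[OF _ _ finW]) (use VW in blast)
  then show ?thesis using 1 2 3 dV by linarith
qed

lemma free_curve_codim:
  assumes "free_curve f D" "D \<ge> 1"
  obtains d1 d2 where "d1 + d2 = D - 1"
    "\<And>s. s \<ge> 2 * D \<Longrightarrow> int ((D - 1) * (D - 1)) - int (d1 * d2) \<le> codim (jac f) s"
proof -
  obtain g1 g2 g3 r11 r12 r13 r21 r22 r23 d1 d2 where c:
    "d1 + d2 = D - 1 \<and>
       homogeneous (D - 1) g1 \<and> homogeneous (D - 1) g2 \<and> homogeneous (D - 1) g3 \<and>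
       homogeneous d1 r11 \<and> homogeneous d1 r12 \<and> homogeneous d1 r13 \<and>
       homogeneous d2 r21 \<and> homogeneous d2 r22 \<and> homogeneous d2 r23 \<and>
       {a * g1 + b * g2 + c * g3 | a b c. True} =
         {a * dx f + b * dy f + c * dz f | a b c. True} \<and>
       {(a, b, c). a * g1 + b * g2 + c * g3 = 0} =
         {(s * r11 + t * r21, s * r12 + t * r22, s * r13 + t * r23) | s t. True} \<and>
       (\<forall>s t. (s * r11 + t * r21, s * r12 + t * r22, s * r13 + t * r23) = (0, 0, 0)
          \<longrightarrow> s = 0 \<and> t = 0) \<and>
       (\<forall>p \<in> {g1, g2, g3, r11, r12, r13, r21, r22, r23}. Poly_Mapping.lookup p (0, 0, 0) = 0)"
    using assms(1) unfolding free_curve_def by (elim exE) (rule that)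
  have *: "d1 + d2 = D - 1"
    "homogeneous (D - 1) g1" "homogeneous (D - 1) g2" "homogeneous (D - 1) g3"
    "homogeneous d1 r11" "homogeneous d1 r12" "homogeneous d1 r13"
    "homogeneous d2 r21" "homogeneous d2 r22" "homogeneous d2 r23"
    "{a * g1 + b * g2 + c * g3 | a b c. True} = {a * dx f + b * dy f + c * dz f | a b c. True}"
    "{(a, b, c). a * g1 + b * g2 + c * g3 = 0} =
         {(s * r11 + t * r21, s * r12 + t * r22, s * r13 + t * r23) | s t. True}"
    "\<forall>s t. (s * r11 + t * r21, s * r12 + t * r22, s * r13 + t * r23) = (0, 0, 0) \<longrightarrow> s = 0 \<and> t = 0"
    using c by - (elim conjE, assumption)+
  have J: "jac f = ideal_gen [g1, g2, g3]" unfolding jac_def ideal_gen_3 using *(11) by simp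
  have "int ((D - 1) * (D - 1)) - int (d1 * d2) \<le> codim (jac f) s" if s: "s \<ge> 2 * D" for s
  proof -
    define n where "n = s - (D - 1)"
    have n: "d1 \<le> n" "d2 \<le> n" "s = n + (d1 + d2)" using *(1) s assms(2) by (auto simp: n_def)
    have inj: "\<And>s t. (s * r11 + t * r21, s * r12 + t * r22, s * r13 + t * r23) = (0, 0, 0) \<Longrightarrow> s = 0 \<and> t = 0"
      using *(13) by blast
    have "s = n + (D - 1)" using n(3) *(1) by simp
    then have "poly3.dim (jac f \<inter> form s) + hf (n - d1) + hf (n - d2) \<le> 3 * hf n"
      unfolding J by (simp only: dim_syzygies_le[OF *(5-10) *(2-4) *(12) inj n(1,2)])
    then have "int (hf s) + int (hf (n - d1)) + int (hf (n - d2)) - 3 * int (hf n) \<le> codim (jac f) s"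
      unfolding codim_def by linarith
    \<comment> \<open>The alternating sum of Hilbert functions along the resolution. Its terms
      linear in \<open>n\<close> cancel because \<open>d1 + d2 = D - 1\<close>, which leaves a
      constant.\<close>
    moreover have "2 * (int (hf s) + int (hf (n - d1)) + int (hf (n - d2)) - 3 * int (hf n))
        = 2 * (int ((D - 1) * (D - 1)) - int (d1 * d2))"
      unfolding *(1)[symmetric]
      using hf_eq[of s] hf_eq[of "n - d1"] hf_eq[of "n - d2"] hf_eq[of n] n
      by (simp add: of_nat_diff algebra_simps)
    then have "int (hf s) + int (hf (n - d1)) + int (hf (n - d2)) - 3 * int (hf n)
        = int ((D - 1) * (D - 1)) - int (d1 * d2)" by simp
    ultimately show ?thesis by simp
  qed
  then show ?thesis using that *(1) by blast
qed

theorem theorem5p2: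
  fixes d k :: nat and fs :: "nat \<Rightarrow> poly3"
  assumes "d_arrangement d k fs"
    and "d \<ge> 3" and "k \<ge> 3"
    and "\<forall>q. q \<noteq> (0, 0, 0) \<longrightarrow> arr_mult k fs q < 5"
  shows "\<not> free_curve (\<Prod>i<k. fs i) (k * d)"
proof
  assume free: "free_curve (\<Prod>i<k. fs i) (k * d)"
  interpret transversal_arrangement d k fs by (rule d_arrangement_transversal[OF assms(1)])
  let ?f = "\<Prod>i<k. fs i" and ?D = "k * d"
  obtain s0 where s0: "\<And>s. s \<ge> s0 \<Longrightarrow> codim (jac ?f) s \<le> int (d * d * (k * (k - 1))) - int (\<Sum>i<k. card (new_points i))"
    using codim_jac_arrangement[of k] assms(3) by auto
  have D1: "?D \<ge> 1" using assms(2,3) by simp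
  obtain d1 d2 where e: "d1 + d2 = ?D - 1"
    "\<And>s. s \<ge> 2 * ?D \<Longrightarrow> int ((?D - 1) * (?D - 1)) - int (d1 * d2) \<le> codim (jac ?f) s"
    using free_curve_codim[OF free D1] by blast
  have n: "d * d * (k * (k - 1)) \<le> 4 * (\<Sum>j<k. card (new_points j))"
    by (rule card_new_points) (use assms(4)[unfolded arr_mult_def] in blast)
  have "int ((?D - 1) * (?D - 1)) - int (d1 * d2) \<le> int (d * d * (k * (k - 1))) - int (\<Sum>i<k. card (new_points i))"
    using s0[of "s0 + 2 * ?D"] e(2)[of "s0 + 2 * ?D"] by linarith
  then have 1: "4 * int ((?D - 1) * (?D - 1)) \<le> 4 * int (d1 * d2) + 3 * int (d * d * (k * (k - 1)))"
    using n by linarith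
  \<comment> \<open>The product of the exponents is largest when they are equal; inserting this
    leaves three quarters of (D - 1)^2 on the left.\<close>
  have "4 * (int d1 * int d2) \<le> (int d1 + int d2) * (int d1 + int d2)"
    using zero_le_square[of "int d1 - int d2"] by (simp add: algebra_simps)
  also have "int d1 + int d2 = int (?D - 1)" using e(1) by (metis of_nat_add)
  finally have 2: "int ((?D - 1) * (?D - 1)) \<le> int (d * d * (k * (k - 1)))" using 1 by simp
  have "int (?D - 1) = int k * int d - 1" "int (k - 1) = int k - 1" using D1 assms(3) by (simp_all add: of_nat_diff)
  then have "(int k * int d - 1) * (int k * int d - 1) \<le> int d * int d * (int k * (int k - 1))"
    using 2 by (simp only: of_nat_mult)
  \<comment> \<open>With D = k d this reads d D + 1 <= 2 D, which \<open>d \<ge> 3\<close>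
    contradicts.\<close>
  then have "int d * (int d * int k) + 1 \<le> 2 * (int d * int k)" by (simp add: algebra_simps)
  moreover have "3 * (int d * int k) \<le> int d * (int d * int k)" using assms(2) by (intro mult_right_mono) auto
  moreover have "0 \<le> int d * int k" by simp
  ultimately show False by linarith
qed

end
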